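(* Let $\nu\in\Lambda_{\mathfrak n}(\mathcal B)$. Then $\deg\nu=r(\nu)$. Furthermore, in the expansion $\xi_\nu=\sum_{\gamma\in\Gamma(\nu)}s_\gamma z_\gamma$ one must have $s_{\gamma_{\mathfrak r}}\neq0$, and if $t=\sum_{\beta\in\mathcal B}t_\beta e_{-\beta}\in\mathfrak r_-^{\times}$ (with $t_\beta\in\mathbb C^{\times}$ for all $\beta\in\mathcal B$), then $$\xi_\nu(t)=s_{\gamma_{\mathfrak r}}\prod_{\beta\in\mathcal B}t_\beta^{r_\beta(\nu)}.$$
   Context: Let $\mathfrak g$ be a complex semisimple Lie algebra, $\mathfrak h$ a Cartan subalgebra, $(\cdot,\cdot)$ the Killing form and also the bilinear form it induces on $\mathfrak h^*$, and $\Delta\subset\mathfrak h^*$ the set of roots. For each $\varphi\in\Delta$ let $e_\varphi\in\mathfrak g$ be a corresponding root vector. Let $\mathfrak b\supset\mathfrak h$ be a Borel subalgebra with nilradical $\mathfrak n$, and $\mathfrak g=\mathfrak n_-+\mathfrak h+\mathfrak n$ the corresponding triangular decomposition; $\Delta_+=\{\varphi\in\Delta: e_\varphi\in\mathfrak n\}$, and $\Pi\subset\Delta_+$ is the set of simple roots. Cascade: for $\varphi\in\Delta_+$ write $\varphi=\sum_{\alpha\in\Pi}n_\alpha(\varphi)\alpha$ and $\Pi(\varphi)=\{\alpha\in\Pi: n_\alpha(\varphi)>0\}$ (a connected subset of $\Pi$); $\mathfrak g(\varphi)$ is the simple Lie subalgebra generated by $e_{\pm\alpha}$, $\alpha\in\Pi(\varphi)$,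 with root set $\Delta(\varphi)\subset\Delta$. A root $\beta\in\Delta_+$ is locally high if it is the highest root of $\mathfrak g(\beta)$. For $\beta$ locally high, $\mathfrak g(\beta)^o$ is the (possibly zero) semisimple subalgebra spanned by $e_\varphi,e_{-\varphi},[e_\varphi,e_{-\varphi}]$ for $\varphi\in\Delta(\beta)$ with $(\varphi,\beta)=0$ (positive roots: those in $\Delta_+$); the highest roots of its simple components are again locally high. A chain cascade is a sequence $\{\beta_1,\dots,\beta_k\}$ of positive roots with $\beta_1$ the highest root of a simple component of $\mathfrak g$ and, for $1<j\le k$, $\beta_j$ the highest root of a simple component of $\mathfrak g(\beta_{j-1})^o$. The cascade $\mathcal B$ is the set of all positive roots belonging to some chain cascade. Let $G$ be a simply connected Lie group with Lie algebra $\mathfrak g$, and $N,H,B=NH$ the subgroups corresponding to $\mathfrak n,\mathfrak h,\mathfrak b$. Let $\Phi:\mathfrak g\to\mathfrak n_-$ be the projection with kernel $\mathfrak b$. Identifying $\mathfrak n^*$ with $\mathfrak n_-$ via the Killing form, the coadjoint action of $u\in N$ on $\mathfrak n_-$ is $\mathrm{Coad}\,u(z)=\Phi(\mathrm{Ad}\,u(z))$; it extends to an action of $B$ on $\mathfrak n_-$ with $H$ acting by the adjoint representation. Let $\mathfrak r_-$ be the span of $e_{-\beta}$, $\beta\in\mathcal B$, $\mathfrak r_-^{\times}$ the set of elements $\sum_{\beta\in\mathcal B}t_\beta e_{-\beta}$ with all $t_\beta\ne0$, and $X=\mathrm{Coad}\,N(\mathfrak r_-^{\times})$; $X$ is a $B$-orbit,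 Zariski open in $\mathfrak n_-$, and an affine variety. For an affine variety $V$, $A(V)$ is the algebra of regular functions; a group acting on $V$ acts on $A(V)$ by $(g\cdot\phi)(v)=\phi(g^{-1}\cdot v)$, and a superscript $N$ denotes $N$-invariants. The Killing form pairing of $\mathfrak n$ and $\mathfrak n_-$ identifies the symmetric algebra $S(\mathfrak n)$ with $A(\mathfrak n_-)$, and by restriction $S(\mathfrak n)\subset A(X)$. $\Lambda(\mathcal B)\subset\mathfrak h^*$ is the free abelian group generated by $\mathcal B$. For $\nu\in\Lambda(\mathcal B)$, $\xi_\nu$ denotes the nonzero vector, unique up to scalar, in $A(X)^N$ of $H$-weight $\nu$ (i.e. $\exp x\cdot\xi_\nu=e^{\nu(x)}\xi_\nu$ for $x\in\mathfrak h$); a choice of scalar is fixed. $\Lambda_{\mathfrak n}(\mathcal B)=\{\nu\in\Lambda(\mathcal B)\mid\xi_\nu\in S(\mathfrak n)^N\}$. For $\nu\in\Lambda_{\mathfrak n}(\mathcal B)$, $\xi_\nu$ is a homogeneous polynomial, and $\deg\nu$ denotes its degree. For $\nu\in\mathfrak h^*$ and $\beta\in\mathcal B$, $r_\beta(\nu)=(\beta,\nu)/(\beta,\beta)$ and $r(\nu)=\sum_{\beta\in\mathcal B}r_\beta(\nu)$. For $\nu\in\Lambda_{\mathfrak n}(\mathcal B)$ one has $\nu=\sum_{\beta\in\mathcal B}r_\beta(\nu)\beta$ with all $r_\beta(\nu)$ nonnegative integers. $\Gamma$ is the set of all maps $\gamma:\Delta_+\to\mathbb Z_+$ (nonnegative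 integers). For $\gamma\in\Gamma$ put $d(\gamma)=\sum_{\varphi\in\Delta_+}\gamma(\varphi)$, $\gamma^{\mathrm{root}}=\sum_{\varphi\in\Delta_+}\gamma(\varphi)\varphi$ and $z_\gamma=\prod_{\varphi\in\Delta_+}e_\varphi^{\gamma(\varphi)}\in S(\mathfrak n)$. For $\nu\in\Lambda_{\mathfrak n}(\mathcal B)$ let $\Gamma(\nu)=\{\gamma\in\Gamma\mid d(\gamma)=\deg\nu,\ \gamma^{\mathrm{root}}=\nu\}$; there are scalars $s_\gamma$ ($\gamma\in\Gamma(\nu)$) with $\xi_\nu=\sum_{\gamma\in\Gamma(\nu)}s_\gamma z_\gamma$. Finally $\gamma_{\mathfrak r}$ is the unique element of $\Gamma(\nu)$ with $\gamma_{\mathfrak r}(\varphi)=0$ for $\varphi\in\Delta_+\setminus\mathcal B$; necessarily $\gamma_{\mathfrak r}(\beta)=r_\beta(\nu)$ for all $\beta\in\mathcal B$.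
   Formalization: The root vectors are assumed normalized so that (e_β, e_{-β}) = 1 for every β in the cascade B; for arbitrary root vectors the displayed formula for ξ_ν(t) fails, e.g. in sl_2 when (e_β, e_{-β}) ≠ 1. *)

theory Defs
  imports "HOL-Analysis.Analysis"
begin

section \<open>Finite-dimensional complex Lie algebras\<close>

text \<open>The underlying space of the Lie algebra is the whole type \<open>'g\<close>; subalgebras and
  ideals are subsets.\<close>

record 'g lie_struct =
  smult :: "complex \<Rightarrow> 'g \<Rightarrow> 'g"
  brk :: "'g \<Rightarrow> 'g \<Rightarrow> 'g"

definition lie_algebra :: "('g::ab_group_add, 'm) lie_struct_scheme \<Rightarrow> bool" where
  "lie_algebra L \<longleftrightarrow>
     vector_space (smult L) \<and>
     (\<forall>x. Vector_Spaces.linear (smult L) (smult L) (\<lambda>y. brk L x y)) \<and>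
     (\<forall>y. Vector_Spaces.linear (smult L) (smult L) (\<lambda>x. brk L x y)) \<and>
     (\<forall>x. brk L x x = 0) \<and>
     (\<forall>x y z. brk L x (brk L y z) + brk L y (brk L z x) + brk L z (brk L x y) = 0)"

definition finite_dim :: "('g::ab_group_add, 'm) lie_struct_scheme \<Rightarrow> bool" where
  "finite_dim L \<longleftrightarrow> (\<exists>S. finite S \<and> module.span (smult L) S = UNIV)"

definition subalgebra :: "('g::ab_group_add, 'm) lie_struct_scheme \<Rightarrow> 'g set \<Rightarrow> bool" where
  "subalgebra L k \<longleftrightarrow>
     module.subspace (smult L) k \<and> (\<forall>x\<in>k. \<forall>y\<in>k. brk L x y \<in> k)"

definition ideal_of :: "('g::ab_group_add, 'm) lie_struct_scheme \<Rightarrow> 'g set \<Rightarrow> 'g set \<Rightarrow> bool" where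
  "ideal_of L k I \<longleftrightarrow>
     module.subspace (smult L) I \<and> I \<subseteq> k \<and> (\<forall>x\<in>k. \<forall>y\<in>I. brk L x y \<in> I)"

definition abelian_subset :: "('g::ab_group_add, 'm) lie_struct_scheme \<Rightarrow> 'g set \<Rightarrow> bool" where
  "abelian_subset L k \<longleftrightarrow> (\<forall>x\<in>k. \<forall>y\<in>k. brk L x y = 0)"

definition brk_span :: "('g::ab_group_add, 'm) lie_struct_scheme \<Rightarrow> 'g set \<Rightarrow> 'g set \<Rightarrow> 'g set" where
  "brk_span L S T = module.span (smult L) {brk L x y |x y. x \<in> S \<and> y \<in> T}"

definition solvable :: "('g::ab_group_add, 'm) lie_struct_scheme \<Rightarrow> 'g set \<Rightarrow> bool" where
  "solvable L k \<longleftrightarrow> (\<exists>n. ((\<lambda>d. brk_span L d d) ^^ n) k = {0})"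

definition nilpotent :: "('g::ab_group_add, 'm) lie_struct_scheme \<Rightarrow> 'g set \<Rightarrow> bool" where
  "nilpotent L k \<longleftrightarrow> (\<exists>n. ((\<lambda>c. brk_span L k c) ^^ n) k = {0})"

definition semisimple :: "('g::ab_group_add, 'm) lie_struct_scheme \<Rightarrow> bool" where
  "semisimple L \<longleftrightarrow>
     lie_algebra L \<and> finite_dim L \<and>
     (\<forall>I. ideal_of L UNIV I \<and> solvable L I \<longrightarrow> I = {0})"

definition simple_subalgebra :: "('g::ab_group_add, 'm) lie_struct_scheme \<Rightarrow> 'g set \<Rightarrow> bool" where
  "simple_subalgebra L s \<longleftrightarrow>
     subalgebra L s \<and> \<not> abelian_subset L s \<and> (\<forall>I. ideal_of L s I \<longrightarrow> I = {0} \<or> I = s)"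

definition simple_component :: "('g::ab_group_add, 'm) lie_struct_scheme \<Rightarrow> 'g set \<Rightarrow> 'g set \<Rightarrow> bool" where
  "simple_component L k s \<longleftrightarrow> ideal_of L k s \<and> simple_subalgebra L s"

definition generated :: "('g::ab_group_add, 'm) lie_struct_scheme \<Rightarrow> 'g set \<Rightarrow> 'g set" where
  "generated L S = \<Inter>{k. subalgebra L k \<and> S \<subseteq> k}"

definition endo_trace :: "('g::ab_group_add, 'm) lie_struct_scheme \<Rightarrow> ('g \<Rightarrow> 'g) \<Rightarrow> complex" where
  "endo_trace L f =
     (let E = (SOME E. \<not> module.dependent (smult L) E \<and> module.span (smult L) E = UNIV)
      in \<Sum>b\<in>E. module.representation (smult L) E (f b) b)"

definition killing :: "('g::ab_group_add, 'm) lie_struct_scheme \<Rightarrow> 'g \<Rightarrow> 'g \<Rightarrow> complex" where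
  "killing L x y = endo_trace L (\<lambda>z. brk L x (brk L y z))"

text \<open>The operator \<open>exp (ad x) = Ad (exp x)\<close>.  As \<open>'g\<close> carries no topology, convergence of the
  exponential series is expressed through the linear functionals, which is the usual
  convergence in finite dimension.\<close>

definition exp_ad :: "('g::ab_group_add, 'm) lie_struct_scheme \<Rightarrow> 'g \<Rightarrow> 'g \<Rightarrow> 'g" where
  "exp_ad L x z =
     (THE w. \<forall>l. Vector_Spaces.linear (smult L) (*) l \<longrightarrow>
        (\<lambda>k. l ((brk L x ^^ k) z) / fact k) sums l w)"

definition borel_subalgebra :: "('g::ab_group_add, 'm) lie_struct_scheme \<Rightarrow> 'g set \<Rightarrow> bool" where
  "borel_subalgebra L b \<longleftrightarrow>
     subalgebra L b \<and> solvable L b \<and>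
     (\<forall>k. subalgebra L k \<and> solvable L k \<and> b \<subseteq> k \<longrightarrow> k = b)"

text \<open>The largest nilpotent ideal of \<open>b\<close>, as the sum of all nilpotent ideals.\<close>

definition nilradical :: "('g::ab_group_add, 'm) lie_struct_scheme \<Rightarrow> 'g set \<Rightarrow> 'g set" where
  "nilradical L b = module.span (smult L) (\<Union>{I. ideal_of L b I \<and> nilpotent L I})"

text \<open>Cartan subalgebras of a semisimple complex Lie algebra, defined (as in Helgason) as the
  maximal abelian subalgebras all of whose elements are ad-diagonalizable.\<close>

definition cartan_subalgebra :: "('g::ab_group_add, 'm) lie_struct_scheme \<Rightarrow> 'g set \<Rightarrow> bool" where
  "cartan_subalgebra L h \<longleftrightarrow>
     subalgebra L h \<and> abelian_subset L h \<and>
     (\<forall>k. subalgebra L k \<and> abelian_subset L k \<and> h \<subseteq> k \<longrightarrow> k = h) \<and>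
     (\<forall>x\<in>h. module.span (smult L) {v. \<exists>c. brk L x v = smult L c v} = UNIV)"


section \<open>Roots and the triangular decomposition\<close>

text \<open>Elements of the dual of the Cartan subalgebra \<open>h\<close> are represented by functions on \<open>'g\<close>
  that are linear on \<open>h\<close> and vanish outside \<open>h\<close>, so that equality of functions is equality of
  functionals.\<close>

type_synonym 'g weight = "'g \<Rightarrow> complex"

record 'g root_datum = "'g lie_struct" +
  cartan :: "'g set"
  borel :: "'g set"
  rootvec :: "'g weight \<Rightarrow> 'g"

definition dual_cartan :: "('g::ab_group_add, 'm) root_datum_scheme \<Rightarrow> 'g weight set" where
  "dual_cartan L = {\<eta>.
     (\<forall>x\<in>cartan L. \<forall>y\<in>cartan L. \<eta> (x + y) = \<eta> x + \<eta> y) \<and>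
     (\<forall>c. \<forall>x\<in>cartan L. \<eta> (smult L c x) = c * \<eta> x) \<and>
     (\<forall>x. x \<notin> cartan L \<longrightarrow> \<eta> x = 0)}"

definition root_space :: "('g::ab_group_add, 'm) root_datum_scheme \<Rightarrow> 'g weight \<Rightarrow> 'g set" where
  "root_space L \<phi> = {v. \<forall>x\<in>cartan L. brk L x v = smult L (\<phi> x) v}"

definition roots :: "('g::ab_group_add, 'm) root_datum_scheme \<Rightarrow> 'g weight set" where
  "roots L = {\<phi> \<in> dual_cartan L. \<phi> \<noteq> (\<lambda>_. 0) \<and> root_space L \<phi> \<noteq> {0}}"

definition triangular_datum :: "('g::ab_group_add, 'm) root_datum_scheme \<Rightarrow> bool" where
  "triangular_datum L \<longleftrightarrow>
     semisimple L \<and> cartan_subalgebra L (cartan L) \<and>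
     borel_subalgebra L (borel L) \<and> cartan L \<subseteq> borel L \<and>
     (\<forall>\<phi>\<in>roots L. rootvec L \<phi> \<in> root_space L \<phi> \<and> rootvec L \<phi> \<noteq> 0)"

text \<open>The bilinear form on the dual of \<open>h\<close> induced by the Killing form.\<close>

definition dual_vec :: "('g::ab_group_add, 'm) root_datum_scheme \<Rightarrow> 'g weight \<Rightarrow> 'g" where
  "dual_vec L \<eta> = (THE a. a \<in> cartan L \<and> (\<forall>x\<in>cartan L. killing L a x = \<eta> x))"

definition dual_form :: "('g::ab_group_add, 'm) root_datum_scheme \<Rightarrow> 'g weight \<Rightarrow> 'g weight \<Rightarrow> complex" where
  "dual_form L \<eta> \<mu> = killing L (dual_vec L \<eta>) (dual_vec L \<mu>)"

definition nil_plus :: "('g::ab_group_add, 'm) root_datum_scheme \<Rightarrow> 'g set" where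
  "nil_plus L = nilradical L (borel L)"

definition pos_roots :: "('g::ab_group_add, 'm) root_datum_scheme \<Rightarrow> 'g weight set" where
  "pos_roots L = {\<phi> \<in> roots L. rootvec L \<phi> \<in> nil_plus L}"

definition nil_minus :: "('g::ab_group_add, 'm) root_datum_scheme \<Rightarrow> 'g set" where
  "nil_minus L = module.span (smult L) {rootvec L (- \<phi>) |\<phi>. \<phi> \<in> pos_roots L}"

definition simple_roots :: "('g::ab_group_add, 'm) root_datum_scheme \<Rightarrow> 'g weight set" where
  "simple_roots L = {\<alpha> \<in> pos_roots L.
     \<not> (\<exists>\<phi>\<in>pos_roots L. \<exists>\<psi>\<in>pos_roots L. \<alpha> = (\<lambda>x. \<phi> x + \<psi> x))}"


section \<open>The cascade of orthogonal roots\<close>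

definition simple_coeffs :: "('g::ab_group_add, 'm) root_datum_scheme \<Rightarrow> 'g weight \<Rightarrow> 'g weight \<Rightarrow> nat" where
  "simple_coeffs L \<phi> = (THE n. (\<forall>\<alpha>. \<alpha> \<notin> simple_roots L \<longrightarrow> n \<alpha> = 0) \<and>
     \<phi> = (\<lambda>x. \<Sum>\<alpha>\<in>simple_roots L. of_nat (n \<alpha>) * \<alpha> x))"

definition simple_support :: "('g::ab_group_add, 'm) root_datum_scheme \<Rightarrow> 'g weight \<Rightarrow> 'g weight set" where
  "simple_support L \<phi> = {\<alpha> \<in> simple_roots L. simple_coeffs L \<phi> \<alpha> > 0}"

text \<open>The subalgebra \<open>g(\<phi>)\<close>.\<close>

definition supp_algebra :: "('g::ab_group_add, 'm) root_datum_scheme \<Rightarrow> 'g weight \<Rightarrow> 'g set" where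
  "supp_algebra L \<phi> =
     generated L (\<Union>\<alpha>\<in>simple_support L \<phi>. {rootvec L \<alpha>, rootvec L (- \<alpha>)})"

definition roots_of :: "('g::ab_group_add, 'm) root_datum_scheme \<Rightarrow> 'g set \<Rightarrow> 'g weight set" where
  "roots_of L k = {\<phi> \<in> roots L. rootvec L \<phi> \<in> k}"

text \<open>\<open>\<phi>\<close> is the highest root of \<open>s\<close> with respect to the positive roots of \<open>s\<close> in \<open>pos_roots L\<close>.\<close>

definition highest_root :: "('g::ab_group_add, 'm) root_datum_scheme \<Rightarrow> 'g set \<Rightarrow> 'g weight \<Rightarrow> bool" where
  "highest_root L s \<phi> \<longleftrightarrow>
     \<phi> \<in> roots_of L s \<inter> pos_roots L \<and>
     (\<forall>\<psi>\<in>roots_of L s. \<exists>c :: 'g weight \<Rightarrow> nat.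
        \<phi> - \<psi> = (\<lambda>x. \<Sum>\<theta>\<in>roots_of L s \<inter> pos_roots L. of_nat (c \<theta>) * \<theta> x))"

text \<open>The subalgebra spanned by \<open>e\<^sub>\<phi>\<close>, \<open>e\<^sub>-\<^sub>\<phi>\<close> and their bracket, for \<open>\<phi>\<close> a root of \<open>g(\<beta>)\<close>
  orthogonal to \<open>\<beta>\<close>; it is only used for locally high \<open>\<beta>\<close>.\<close>

definition perp_algebra :: "('g::ab_group_add, 'm) root_datum_scheme \<Rightarrow> 'g weight \<Rightarrow> 'g set" where
  "perp_algebra L \<beta> = module.span (smult L)
     (\<Union>\<phi> \<in> {\<phi> \<in> roots_of L (supp_algebra L \<beta>). dual_form L \<phi> \<beta> = 0}.
        {rootvec L \<phi>, rootvec L (- \<phi>), brk L (rootvec L \<phi>) (rootvec L (- \<phi>))})"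

definition chain_cascade :: "('g::ab_group_add, 'm) root_datum_scheme \<Rightarrow> 'g weight list \<Rightarrow> bool" where
  "chain_cascade L bs \<longleftrightarrow>
     bs \<noteq> [] \<and>
     (\<exists>s. simple_component L UNIV s \<and> highest_root L s (bs ! 0)) \<and>
     (\<forall>j. Suc j < length bs \<longrightarrow>
        (\<exists>s. simple_component L (perp_algebra L (bs ! j)) s \<and> highest_root L s (bs ! Suc j)))"

definition cascade :: "('g::ab_group_add, 'm) root_datum_scheme \<Rightarrow> 'g weight set" where
  "cascade L = {\<beta>. \<exists>bs. chain_cascade L bs \<and> \<beta> \<in> set bs}"

text \<open>The free abelian group \<open>\<Lambda>(\<B>)\<close>.\<close>

definition cascade_lattice :: "('g::ab_group_add, 'm) root_datum_scheme \<Rightarrow> 'g weight set" where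
  "cascade_lattice L =
     {\<lambda>x. \<Sum>\<beta>\<in>cascade L. of_int (c \<beta>) * \<beta> x |c :: 'g weight \<Rightarrow> int. True}"

definition r_coeff :: "('g::ab_group_add, 'm) root_datum_scheme \<Rightarrow> 'g weight \<Rightarrow> 'g weight \<Rightarrow> complex" where
  "r_coeff L \<beta> \<nu> = dual_form L \<beta> \<nu> / dual_form L \<beta> \<beta>"

definition r_total :: "('g::ab_group_add, 'm) root_datum_scheme \<Rightarrow> 'g weight \<Rightarrow> complex" where
  "r_total L \<nu> = (\<Sum>\<beta>\<in>cascade L. r_coeff L \<beta> \<nu>)"


section \<open>The coadjoint action and the orbit \<open>X\<close>\<close>

text \<open>The coadjoint action of \<open>N\<close> depends on \<open>u \<in> N\<close> only through \<open>Ad u\<close>, so \<open>N\<close> is represented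
  by the operator group \<open>Ad N\<close>, which (\<open>N\<close> being connected) is generated by the \<open>exp (ad x)\<close>
  with \<open>x \<in> n\<close>.\<close>

inductive_set Ad_N :: "('g::ab_group_add, 'm) root_datum_scheme \<Rightarrow> ('g \<Rightarrow> 'g) set"
  for L :: "('g::ab_group_add, 'm) root_datum_scheme" where
  Ad_N_id: "id \<in> Ad_N L"
| Ad_N_exp: "x \<in> nil_plus L \<Longrightarrow> u \<in> Ad_N L \<Longrightarrow> exp_ad L x \<circ> u \<in> Ad_N L"

text \<open>The projection onto \<open>n\<^sub>-\<close> with kernel the Borel subalgebra.\<close>

definition proj_minus :: "('g::ab_group_add, 'm) root_datum_scheme \<Rightarrow> 'g \<Rightarrow> 'g" where
  "proj_minus L z = (THE y. y \<in> nil_minus L \<and> z - y \<in> borel L)"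

definition Coad :: "('g::ab_group_add, 'm) root_datum_scheme \<Rightarrow> ('g \<Rightarrow> 'g) \<Rightarrow> 'g \<Rightarrow> 'g" where
  "Coad L u z = proj_minus L (u z)"

definition r_elem :: "('g::ab_group_add, 'm) root_datum_scheme \<Rightarrow> ('g weight \<Rightarrow> complex) \<Rightarrow> 'g" where
  "r_elem L t = (\<Sum>\<beta>\<in>cascade L. smult L (t \<beta>) (rootvec L (- \<beta>)))"

definition r_minus_times :: "('g::ab_group_add, 'm) root_datum_scheme \<Rightarrow> 'g set" where
  "r_minus_times L = {r_elem L t |t. \<forall>\<beta>\<in>cascade L. t \<beta> \<noteq> 0}"

definition orbit_X :: "('g::ab_group_add, 'm) root_datum_scheme \<Rightarrow> 'g set" where
  "orbit_X L = {Coad L u v |u v. u \<in> Ad_N L \<and> v \<in> r_minus_times L}"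


section \<open>\<open>S(n)\<close>, regular functions and invariants\<close>

text \<open>\<open>S(n)\<close>, identified through the Killing form with the polynomial functions on \<open>n\<^sub>-\<close>:
  \<open>y \<in> n\<close> is the function \<open>v \<mapsto> (y, v)\<close>.  The functions are defined on all of \<open>'g\<close>,
  but only their values on \<open>n\<^sub>-\<close> matter.\<close>

inductive_set Sym_n :: "('g::ab_group_add, 'm) root_datum_scheme \<Rightarrow> ('g \<Rightarrow> complex) set"
  for L :: "('g::ab_group_add, 'm) root_datum_scheme" where
  Sym_const: "(\<lambda>_. c) \<in> Sym_n L"
| Sym_elem: "y \<in> nil_plus L \<Longrightarrow> (\<lambda>v. killing L y v) \<in> Sym_n L"
| Sym_add: "p \<in> Sym_n L \<Longrightarrow> q \<in> Sym_n L \<Longrightarrow> (\<lambda>v. p v + q v) \<in> Sym_n L"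
| Sym_mult: "p \<in> Sym_n L \<Longrightarrow> q \<in> Sym_n L \<Longrightarrow> (\<lambda>v. p v * q v) \<in> Sym_n L"

definition Sym_n_inv :: "('g::ab_group_add, 'm) root_datum_scheme \<Rightarrow> ('g \<Rightarrow> complex) set" where
  "Sym_n_inv L = {p \<in> Sym_n L. \<forall>u\<in>Ad_N L. \<forall>v\<in>nil_minus L. p (Coad L u v) = p v}"

definition homogeneous :: "('g::ab_group_add, 'm) root_datum_scheme \<Rightarrow> nat \<Rightarrow> ('g \<Rightarrow> complex) \<Rightarrow> bool" where
  "homogeneous L d p \<longleftrightarrow> (\<forall>c. \<forall>v\<in>nil_minus L. p (smult L c v) = c ^ d * p v)"

text \<open>\<open>A(X)\<close>: functions that are locally on \<open>X\<close> quotients of polynomials.  Functions are total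
  on \<open>'g\<close>, but only their values on \<open>X\<close> matter.\<close>

definition regular_on_X :: "('g::ab_group_add, 'm) root_datum_scheme \<Rightarrow> ('g \<Rightarrow> complex) \<Rightarrow> bool" where
  "regular_on_X L f \<longleftrightarrow>
     (\<forall>v\<in>orbit_X L. \<exists>p\<in>Sym_n L. \<exists>q\<in>Sym_n L. q v \<noteq> 0 \<and>
        (\<forall>w\<in>orbit_X L. q w \<noteq> 0 \<longrightarrow> f w = p w / q w))"

text \<open>\<open>f\<close> is a nonzero element of \<open>A(X)\<^sup>N\<close> of \<open>H\<close>-weight \<open>\<nu>\<close>, where
  \<open>(exp x \<cdot> f) (v) = f (exp (- x) \<cdot> v)\<close>.\<close>

definition inv_weight_vector :: "('g::ab_group_add, 'm) root_datum_scheme \<Rightarrow> 'g weight \<Rightarrow> ('g \<Rightarrow> complex) \<Rightarrow> bool" where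
  "inv_weight_vector L \<nu> f \<longleftrightarrow>
     regular_on_X L f \<and>
     (\<forall>u\<in>Ad_N L. \<forall>v\<in>orbit_X L. f (Coad L u v) = f v) \<and>
     (\<exists>v\<in>orbit_X L. f v \<noteq> 0) \<and>
     (\<forall>x\<in>cartan L. \<forall>v\<in>orbit_X L. f (exp_ad L (- x) v) = exp (\<nu> x) * f v)"

text \<open>In the following \<open>xi\<close> is a choice of the vectors \<open>\<xi>\<^sub>\<nu>\<close>, \<open>\<nu> \<in> \<Lambda>(\<B>)\<close>.\<close>

definition Lambda_n :: "('g::ab_group_add, 'm) root_datum_scheme \<Rightarrow> ('g weight \<Rightarrow> 'g \<Rightarrow> complex) \<Rightarrow> 'g weight set" where
  "Lambda_n L xi = {\<nu> \<in> cascade_lattice L. \<exists>p\<in>Sym_n_inv L. \<forall>v\<in>orbit_X L. xi \<nu> v = p v}"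

definition xi_degree :: "('g::ab_group_add, 'm) root_datum_scheme \<Rightarrow> ('g weight \<Rightarrow> 'g \<Rightarrow> complex) \<Rightarrow> 'g weight \<Rightarrow> nat" where
  "xi_degree L xi \<nu> =
     (THE d. \<exists>p\<in>Sym_n L. (\<forall>v\<in>orbit_X L. xi \<nu> v = p v) \<and> homogeneous L d p)"

text \<open>Maps \<open>\<gamma>\<close> from the positive roots to the natural numbers are extended by 0 to all weights.\<close>

definition Gamma_all :: "('g::ab_group_add, 'm) root_datum_scheme \<Rightarrow> ('g weight \<Rightarrow> nat) set" where
  "Gamma_all L = {\<gamma>. \<forall>\<phi>. \<phi> \<notin> pos_roots L \<longrightarrow> \<gamma> \<phi> = 0}"

definition z_mono :: "('g::ab_group_add, 'm) root_datum_scheme \<Rightarrow> ('g weight \<Rightarrow> nat) \<Rightarrow> 'g \<Rightarrow> complex" where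
  "z_mono L \<gamma> v = (\<Prod>\<phi>\<in>pos_roots L. killing L (rootvec L \<phi>) v ^ \<gamma> \<phi>)"

definition Gamma_nu :: "('g::ab_group_add, 'm) root_datum_scheme \<Rightarrow> ('g weight \<Rightarrow> 'g \<Rightarrow> complex) \<Rightarrow> 'g weight \<Rightarrow> ('g weight \<Rightarrow> nat) set" where
  "Gamma_nu L xi \<nu> = {\<gamma> \<in> Gamma_all L.
     (\<Sum>\<phi>\<in>pos_roots L. \<gamma> \<phi>) = xi_degree L xi \<nu> \<and>
     (\<lambda>x. \<Sum>\<phi>\<in>pos_roots L. of_nat (\<gamma> \<phi>) * \<phi> x) = \<nu>}"

definition gamma_r :: "('g::ab_group_add, 'm) root_datum_scheme \<Rightarrow> ('g weight \<Rightarrow> 'g \<Rightarrow> complex) \<Rightarrow> 'g weight \<Rightarrow> 'g weight \<Rightarrow> nat" where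
  "gamma_r L xi \<nu> =
     (THE \<gamma>. \<gamma> \<in> Gamma_nu L xi \<nu> \<and> (\<forall>\<phi>\<in>pos_roots L - cascade L. \<gamma> \<phi> = 0))"

end

theory Submission
  imports Defs "HOL-Library.Function_Algebras" "HOL-Library.Multiset"
begin

text \<open>By \<open>N\<close>-invariance \<open>\<xi>\<^sub>\<nu>\<close> is determined by its restriction to the torus of all
  \<open>r_elem L t\<close>.  The roots of the cascade are pairwise orthogonal, so that \<open>H\<close> acts transitively
  on this torus, and the weight condition makes the restriction a nonzero multiple of the Laurent monomial
  with exponents \<open>r_\<beta>(\<nu>)\<close>; as \<open>\<xi>\<^sub>\<nu>\<close> is polynomial, the exponents are natural numbers.
  Hence \<open>\<xi>\<^sub>\<nu>\<close> is homogeneous of degree \<open>r(\<nu>)\<close> on the cone \<open>X\<close>.  On the torus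
  every \<open>z\<^sub>\<gamma>\<close> involving a root outside the cascade vanishes, and linear independence of the
  cascade leaves only \<open>\<gamma>\<^sub>r\<close>.

  The structure theory behind this needs no representation theory of \<open>sl\<^sub>2\<close>: all facts about root
  strings follow from the vanishing of the trace of \<open>ad [e, f]\<close> on subspaces
  stable under \<open>e\<close> and \<open>f\<close> that are spanned by weight vectors.\<close>

section \<open>Traces and the Killing form\<close>

text \<open>The definitions speak of ideals, generated subalgebras and maximal solvable algebras,
  while the argument on the torus needs statements about roots: cascade roots are positive and
  pairwise orthogonal. The translation rests on three points. Traces show that every weight takes at
  \<open>[e, f]\<close> a real multiple of the value of \<phi>, so the Killing form becomes a sum of
  squares; its nondegeneracy and all sign arguments come from this. Positivity is extracted from the
  maximality of the Borel subalgebra: a set of roots without vanishing nonnegative combination can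
  be enlarged by one of any two opposite roots, and the roots in its cone together with the Cartan
  subalgebra span a solvable algebra. Finally, the algebras met by the cascade are controlled
  through their root sets, which are faces, a property passing to ideals and to the orthogonal part
  of a highest root. Polynomiality of the weight vector enters twice: on a line it has no pole,
  which excludes negative exponents, and on a cone its homogeneous components can be
  separated.\<close>

locale fd_lie_algebra =
  fixes L :: "('g::ab_group_add, 'm) lie_struct_scheme"
  assumes lie: "lie_algebra L" and fin_dim: "finite_dim L"
begin

abbreviation sc (infixr "\<cdot>" 75) where "sc \<equiv> smult L"
abbreviation br where "br \<equiv> brk L"

sublocale vector_space "smult L"
  using lie by (simp add: lie_algebra_def)

text \<open>The basis that \<^const>\<open>endo_trace\<close> chooses, so that no change of basis is needed to
  relate \<^const>\<open>killing\<close> to traces.\<close>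

definition bas :: "'g set" where
  "bas = (SOME E. \<not> module.dependent (smult L) E \<and> module.span (smult L) E = UNIV)"

lemma bas: "independent bas \<and> span bas = UNIV"
  unfolding bas_def
proof (rule someI_ex)
  show "\<exists>E. independent E \<and> span E = UNIV"
    using maximal_independent_subset[of UNIV] by (metis top.extremum_uniqueI)
qed

lemma finite_bas: "finite bas"
proof -
  obtain S where "finite S" "span S = UNIV" using fin_dim by (auto simp: finite_dim_def)
  then show ?thesis using independent_span_bound[of S bas] bas by auto
qed

sublocale finite_dimensional_vector_space "smult L" bas
  using bas finite_bas by unfold_locales auto

declare independent_Basis [simp] span_Basis [simp]

lemma br_linear: "Vector_Spaces.linear (smult L) (smult L) (br x)"
  "Vector_Spaces.linear (smult L) (smult L) (\<lambda>x. br x y)"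
  using lie by (simp_all add: lie_algebra_def)

lemma br_hom: "module_hom (smult L) (smult L) (br x)"
  "module_hom (smult L) (smult L) (\<lambda>x. br x y)"
  using br_linear by (simp_all only: module_hom_iff_linear)

lemmas br_add = module_hom.add[OF br_hom(1)] module_hom.add[OF br_hom(2)]
lemmas br_scale = module_hom.scale[OF br_hom(1)] module_hom.scale[OF br_hom(2)]
lemmas br_diff = module_hom.diff[OF br_hom(1)] module_hom.diff[OF br_hom(2)]
lemmas br_neg = module_hom.neg[OF br_hom(1)] module_hom.neg[OF br_hom(2)]
lemmas br_zero = module_hom.zero[OF br_hom(1)] module_hom.zero[OF br_hom(2)]
lemmas br_sum = module_hom.sum[OF br_hom(1)] module_hom.sum[OF br_hom(2)]
lemmas br_simps = br_add br_scale br_diff br_neg br_zero br_sum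

lemma br_self: "br x x = 0"
  using lie by (simp add: lie_algebra_def)

lemma br_anti: "br x y = - br y x"
proof -
  have "br (x + y) (x + y) = br x y + br y x" unfolding br_add by (simp add: br_self)
  then have "br x y + br y x = 0" by (metis br_self)
  then show ?thesis by (simp add: eq_neg_iff_add_eq_0)
qed

lemma jacobi: "br x (br y z) = br (br x y) z + br y (br x z)"
proof -
  have "br x (br y z) + br y (br z x) + br z (br x y) = 0"
    using lie by (simp add: lie_algebra_def)
  moreover have "br y (br z x) = - br y (br x z)" by (metis br_anti br_neg(1))
  moreover have "br z (br x y) = - br (br x y) z" by (metis br_anti)
  ultimately show ?thesis by (simp add: algebra_simps)
qed

lemma span_br_closed:
  assumes "\<And>g. g \<in> G \<Longrightarrow> br x g \<in> span H" and "v \<in> span G"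
  shows "br x v \<in> span H"
  using assms(2)
proof (induction rule: span_induct_alt)
  case base show ?case by (simp add: br_zero span_zero)
next
  case (step c a y)
  then show ?case using assms(1) by (simp add: br_simps span_add span_scale)
qed

lemma span_br_closed2:
  assumes "\<And>g h. g \<in> G \<Longrightarrow> h \<in> H \<Longrightarrow> br g h \<in> span K" and "v \<in> span G" "w \<in> span H"
  shows "br v w \<in> span K"
  using assms(2)
proof (induction rule: span_induct_alt)
  case base show ?case by (simp add: br_zero span_zero)
next
  case (step c a y)
  then show ?case using span_br_closed[of H a K w] assms(1,3) by (simp add: br_simps span_add span_scale)
qed

section \<open>Traces on stable subspaces\<close>

definition tr :: "'g set \<Rightarrow> ('g \<Rightarrow> 'g) \<Rightarrow> complex" where
  "tr B T = (\<Sum>b\<in>B. representation B (T b) b)"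

lemma rep_sum:
  assumes "independent B" "v \<in> span B"
  shows "(\<Sum>b\<in>B. representation B v b \<cdot> b) = v"
  by (rule sum_representation_eq) (use assms finiteI_independent in auto)

lemma rep_hom:
  assumes "independent B" "module_hom (smult L) (smult L) T" "\<And>b. b \<in> B \<Longrightarrow> T b \<in> span B" "v \<in> span B"
  shows "representation B (T v) c = (\<Sum>b\<in>B. representation B v b * representation B (T b) c)"
proof -
  interpret T: module_hom "smult L" "smult L" T by fact
  have "T v = T (\<Sum>b\<in>B. representation B v b \<cdot> b)" using rep_sum assms by simp
  also have "\<dots> = (\<Sum>b\<in>B. representation B v b \<cdot> T b)" by (simp add: T.sum T.scale)
  finally show ?thesis
    using assms(1,3) by (simp add: representation_sum representation_scale span_scale)
qed

text \<open>\<open>tr B\<close> is meant as the trace on the subspace \<open>span B\<close>, so both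
  operators have to preserve it. Working on subspaces is what later turns commutators into linear
  relations between weights.\<close>

lemma tr_comm:
  assumes "independent B" "module_hom (smult L) (smult L) T" "module_hom (smult L) (smult L) U"
    and "\<And>b. b \<in> B \<Longrightarrow> T b \<in> span B" "\<And>b. b \<in> B \<Longrightarrow> U b \<in> span B"
  shows "tr B (\<lambda>v. T (U v)) = tr B (\<lambda>v. U (T v))"
proof -
  have "tr B (\<lambda>v. T (U v)) =
      (\<Sum>b\<in>B. \<Sum>c\<in>B. representation B (U b) c * representation B (T c) b)"
    unfolding tr_def by (rule sum.cong[OF refl]) (rule rep_hom; use assms in auto)
  also have "\<dots> = (\<Sum>b\<in>B. \<Sum>c\<in>B. representation B (T b) c * representation B (U c) b)"
    by (subst sum.swap) (simp add: mult.commute)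
  also have "\<dots> = tr B (\<lambda>v. U (T v))"
    unfolding tr_def by (rule sum.cong[OF refl], rule rep_hom[symmetric]) (use assms in auto)
  finally show ?thesis .
qed

text \<open>\<open>killing\<close> is computed in the fixed basis \<open>bas\<close>, whereas
  weights are read off from a basis of weight vectors; this connects the two. Expanding
  \<open>c\<close> in \<open>B\<close> and \<open>T b\<close> in \<open>C\<close> leads to the same
  double sum from both sides.\<close>

lemma tr_indep:
  assumes "independent B" "independent C" "span B = span C" "module_hom (smult L) (smult L) T"
    and "\<And>b. b \<in> B \<Longrightarrow> T b \<in> span B"
  shows "tr B T = tr C T"
proof -
  interpret T: module_hom "smult L" "smult L" T by fact
  have inv: "T v \<in> span B" if "v \<in> span B" for v
    using that by (induction rule: span_induct_alt) (simp_all add: T.add T.scale span_zero span_add span_scale assms(5))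
  have C: "c \<in> span B" if "c \<in> C" for c using that assms(3) span_base by auto
  have B: "b \<in> span C" if "b \<in> B" for b using that assms(3) span_base by auto
  have "tr C T = (\<Sum>c\<in>C. \<Sum>b\<in>B. representation B c b * representation C (T b) c)"
    unfolding tr_def
  proof (rule sum.cong[OF refl])
    fix c assume c: "c \<in> C"
    have "T c = (\<Sum>b\<in>B. representation B c b \<cdot> T b)"
      using arg_cong[OF rep_sum[OF assms(1) C[OF c]], of T] by (simp add: T.sum T.scale)
    then show "representation C (T c) c = (\<Sum>b\<in>B. representation B c b * representation C (T b) c)"
      using assms(2,3,5) by (simp add: representation_sum representation_scale span_scale)
  qed
  also have "\<dots> = (\<Sum>b\<in>B. \<Sum>c\<in>C. representation B c b * representation C (T b) c)"
    by (rule sum.swap)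
  also have "\<dots> = tr B T" unfolding tr_def
  proof (rule sum.cong[OF refl])
    fix b assume b: "b \<in> B"
    have "T b = (\<Sum>c\<in>C. representation C (T b) c \<cdot> c)"
      using rep_sum[of C "T b"] assms b by simp
    then have "representation B (T b) b = representation B (\<Sum>c\<in>C. representation C (T b) c \<cdot> c) b" by simp
    also have "\<dots> = (\<Sum>c\<in>C. representation C (T b) c * representation B c b)"
      using assms(1) C by (simp add: representation_sum representation_scale span_scale)
    finally show "(\<Sum>c\<in>C. representation B c b * representation C (T b) c) = representation B (T b) b"
      by (simp add: mult.commute)
  qed
  finally show ?thesis by simp
qed

lemma tr_diag:
  assumes "independent B" "\<And>b. b \<in> B \<Longrightarrow> T b = w b \<cdot> b"
  shows "tr B T = (\<Sum>b\<in>B. w b)"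
  unfolding tr_def
  by (rule sum.cong[OF refl]) (simp add: assms representation_scale span_base representation_basis)

lemma tr_add:
  assumes "independent B" "\<And>b. b \<in> B \<Longrightarrow> T b \<in> span B" "\<And>b. b \<in> B \<Longrightarrow> U b \<in> span B"
  shows "tr B (\<lambda>v. T v + U v) = tr B T + tr B U"
  unfolding tr_def using assms by (simp add: representation_add sum.distrib)

lemma tr_diff:
  assumes "independent B" "\<And>b. b \<in> B \<Longrightarrow> T b \<in> span B" "\<And>b. b \<in> B \<Longrightarrow> U b \<in> span B"
  shows "tr B (\<lambda>v. T v - U v) = tr B T - tr B U"
  unfolding tr_def using assms by (simp add: representation_diff sum_subtractf)

lemma tr_scale:
  assumes "independent B" "\<And>b. b \<in> B \<Longrightarrow> T b \<in> span B"
  shows "tr B (\<lambda>v. c \<cdot> T v) = c * tr B T"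
  unfolding tr_def using assms by (simp add: representation_scale sum_distrib_left)

section \<open>The invariant Killing form\<close>

abbreviation kil where "kil \<equiv> killing L"

lemma kil_tr: "kil x y = tr bas (\<lambda>z. br x (br y z))"
  unfolding killing_def endo_trace_def tr_def bas_def Let_def ..

lemma br2_hom: "module_hom (smult L) (smult L) (\<lambda>z. br x (br y z))"
  by unfold_locales (simp_all add: br_simps)

lemma kil_sym: "kil x y = kil y x"
  unfolding kil_tr by (rule tr_comm) (simp_all add: br_hom)

lemma kil_add: "kil (x + y) z = kil x z + kil y z" "kil z (x + y) = kil z x + kil z y"
proof -
  show "kil (x + y) z = kil x z + kil y z" for x y z
    unfolding kil_tr by (simp add: br_add tr_add)
  then show "kil z (x + y) = kil z x + kil z y" by (metis kil_sym)
qed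

lemma kil_scale: "kil (c \<cdot> x) z = c * kil x z" "kil z (c \<cdot> x) = c * kil z x"
proof -
  show "kil (c \<cdot> x) z = c * kil x z" for x z
    unfolding kil_tr by (simp add: br_scale tr_scale)
  then show "kil z (c \<cdot> x) = c * kil z x" by (metis kil_sym)
qed

lemma kil_hom: "module_hom (smult L) (*) (kil x)" "module_hom (smult L) (*) (\<lambda>x. kil x y)"
  by unfold_locales (simp_all add: kil_add kil_scale algebra_simps)

lemmas kil_simps = kil_add kil_scale
  module_hom.zero[OF kil_hom(1)] module_hom.zero[OF kil_hom(2)]
  module_hom.neg[OF kil_hom(1)] module_hom.neg[OF kil_hom(2)]
  module_hom.sum[OF kil_hom(1)] module_hom.sum[OF kil_hom(2)]
  module_hom.diff[OF kil_hom(1)] module_hom.diff[OF kil_hom(2)]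

text \<open>The operator of \<open>br x y\<close> is a commutator, and moving the operator of
  \<open>y\<close> cyclically around the trace trades it for the commutator with
  \<open>z\<close>.\<close>

lemma kil_inv: "kil (br x y) z = kil x (br y z)"
proof -
  have 1: "br (br x y) v = br x (br y v) - br y (br x v)" for v
    using jacobi[of x y v] by (simp add: algebra_simps)
  have "kil (br x y) z = tr bas (\<lambda>v. br x (br y (br z v))) - tr bas (\<lambda>v. br y (br x (br z v)))"
    unfolding kil_tr 1 by (rule tr_diff) simp_all
  also have "tr bas (\<lambda>v. br y (br x (br z v))) = tr bas (\<lambda>v. br x (br z (br y v)))"
    by (rule tr_comm) (simp_all add: br_hom br2_hom)
  also have "tr bas (\<lambda>v. br x (br y (br z v))) - tr bas (\<lambda>v. br x (br z (br y v)))
     = tr bas (\<lambda>v. br x (br y (br z v)) - br x (br z (br y v)))"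
    by (rule tr_diff[symmetric]) simp_all
  also have "\<dots> = tr bas (\<lambda>v. br x (br (br y z) v))"
  proof -
    have "br x (br y (br z v)) - br x (br z (br y v)) = br x (br (br y z) v)" for v
      by (simp add: jacobi[of y z v] br_add)
    then show ?thesis by simp
  qed
  finally show ?thesis unfolding kil_tr .
qed

section \<open>Convergence of the exponential of ad x\<close>

lemma lin_rep: "Vector_Spaces.linear (smult L) (*) (\<lambda>v. representation bas v b)"
  by (rule linear_representation) simp_all

lemma lin_expand:
  assumes "Vector_Spaces.linear (smult L) (*) l"
  shows "l v = (\<Sum>b\<in>bas. representation bas v b * l b)"
proof -
  interpret l: module_hom "smult L" "(*)" l using assms by (simp add: module_hom_iff_linear)
  show ?thesis
    using arg_cong[OF rep_sum[OF independent_Basis, of v], of l] by (simp add: l.sum l.scale)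
qed

text \<open>The coordinates in \<open>bas\<close> are among the functionals. This supplies the
  uniqueness that the description operator in \<open>exp_ad\<close> needs.\<close>

lemma eq_by_functionals:
  assumes "\<And>l. Vector_Spaces.linear (smult L) (*) l \<Longrightarrow> l v = (l w :: complex)"
  shows "v = w"
proof -
  have "representation bas v = representation bas w" by (rule ext) (rule assms[OF lin_rep])
  then show ?thesis
    by (metis rep_sum[OF independent_Basis] span_Basis UNIV_I)
qed

definition exp_sums :: "'g \<Rightarrow> 'g \<Rightarrow> 'g \<Rightarrow> bool" where
  "exp_sums x z w \<longleftrightarrow> (\<forall>l. Vector_Spaces.linear (smult L) (*) l \<longrightarrow>
     (\<lambda>k. l ((br x ^^ k) z) / fact k) sums l w)"

lemma exp_ad_eqI: "exp_sums x z w \<Longrightarrow> exp_ad L x z = w"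
  unfolding exp_ad_def exp_sums_def
  by (rule the_equality) (auto intro!: eq_by_functionals intro: sums_unique2)

text \<open>In the l1-norm \<open>N\<close> of the coordinates, \<open>br x\<close> is bounded by
  \<open>K\<close>, so each coordinate series is dominated by the series of \<open>exp K\<close>.
  The limits are assembled to \<open>w\<close>; an arbitrary functional is a finite combination of
  coordinates.\<close>

lemma ex_exp_sums: "\<exists>w. exp_sums x z w"
proof -
  define r where "r v b = representation bas v b" for v b
  define N where "N v = (\<Sum>b\<in>bas. norm (r v b))" for v
  define K where "K = (\<Sum>b\<in>bas. N (br x b))"
  have r_le: "norm (r v b) \<le> N v" for v b
  proof (cases "b \<in> bas")
    case True then show ?thesis unfolding N_def by (intro member_le_sum) (auto simp: finite_bas)
  next
    case False
    then have "r v b = 0" using representation_ne_zero[of bas v b] by (auto simp: r_def)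
    then show ?thesis by (simp add: N_def sum_nonneg)
  qed
  have Nbr: "N (br x v) \<le> K * N v" for v
  proof -
    have "r (br x v) c = (\<Sum>b\<in>bas. r v b * r (br x b) c)" for c
      unfolding r_def by (rule rep_hom) (simp_all add: br_hom)
    then have "N (br x v) = (\<Sum>c\<in>bas. norm (\<Sum>b\<in>bas. r v b * r (br x b) c))" by (simp add: N_def)
    also have "\<dots> \<le> (\<Sum>c\<in>bas. \<Sum>b\<in>bas. norm (r v b) * norm (r (br x b) c))"
      by (intro sum_mono order.trans[OF norm_sum]) (simp add: norm_mult)
    also have "\<dots> = (\<Sum>b\<in>bas. norm (r v b) * N (br x b))"
      by (subst sum.swap) (simp add: N_def sum_distrib_left)
    also have "\<dots> \<le> (\<Sum>b\<in>bas. N v * N (br x b))"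
      by (intro sum_mono mult_right_mono r_le) (simp add: N_def sum_nonneg)
    also have "\<dots> = K * N v" by (simp add: K_def sum_distrib_left sum_distrib_right mult.commute)
    finally show ?thesis .
  qed
  have K0: "K \<ge> 0" by (simp add: K_def N_def sum_nonneg)
  have pw: "N ((br x ^^ k) z) \<le> K ^ k * N z" for k
  proof (induction k)
    case (Suc k)
    have "N ((br x ^^ Suc k) z) \<le> K * N ((br x ^^ k) z)" using Nbr by simp
    also have "\<dots> \<le> K * (K ^ k * N z)" by (intro mult_left_mono Suc K0)
    finally show ?case by (simp add: mult.assoc)
  qed simp
  have summ: "summable (\<lambda>k. r ((br x ^^ k) z) b / fact k)" for b
  proof (rule summable_comparison_test)
    have "norm (r ((br x ^^ k) z) b / fact k) \<le> N z * (inverse (fact k) * K ^ k)" for k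
    proof -
      have "norm (r ((br x ^^ k) z) b / fact k) = norm (r ((br x ^^ k) z) b) / fact k"
        by (simp add: norm_divide)
      also have "\<dots> \<le> (K ^ k * N z) / fact k"
        by (intro divide_right_mono order.trans[OF r_le pw]) simp
      finally show ?thesis by (simp add: field_simps)
    qed
    then show "\<exists>M. \<forall>n\<ge>M. norm (r ((br x ^^ n) z) b / fact n) \<le> N z * (inverse (fact n) * K ^ n)" by blast
    show "summable (\<lambda>k. N z * (inverse (fact k) * K ^ k))"
      by (intro summable_mult summable_exp)
  qed
  define w where "w = (\<Sum>b\<in>bas. (\<Sum>k. r ((br x ^^ k) z) b / fact k) \<cdot> b)"
  have "exp_sums x z w" unfolding exp_sums_def
  proof (intro allI impI)
    fix l assume l: "Vector_Spaces.linear (smult L) (*) l"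
    interpret l: module_hom "smult L" "(*)" l using l by (simp add: module_hom_iff_linear)
    have "(\<lambda>k. \<Sum>b\<in>bas. (r ((br x ^^ k) z) b / fact k) * l b) sums
       (\<Sum>b\<in>bas. (\<Sum>k. r ((br x ^^ k) z) b / fact k) * l b)"
      by (intro sums_sum sums_mult2 summable_sums summ)
    moreover have "(\<Sum>b\<in>bas. (r ((br x ^^ k) z) b / fact k) * l b) = l ((br x ^^ k) z) / fact k" for k
      by (subst lin_expand[OF l, of "(br x ^^ k) z"]) (simp add: r_def sum_divide_distrib)
    ultimately show "(\<lambda>k. l ((br x ^^ k) z) / fact k) sums l w"
      by (simp add: w_def l.sum l.scale)
  qed
  then show ?thesis by blast
qed

lemma br_pow_scale: "(br x ^^ k) (c \<cdot> z) = c \<cdot> (br x ^^ k) z"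
  by (induction k) (simp_all add: br_scale)

text \<open>This is what makes the orbit X a cone.\<close>

lemma exp_ad_scale: "exp_ad L x (c \<cdot> z) = c \<cdot> exp_ad L x z"
proof -
  obtain w where w: "exp_sums x z w" using ex_exp_sums by blast
  have "exp_sums x (c \<cdot> z) (c \<cdot> w)" unfolding exp_sums_def
  proof (intro allI impI)
    fix l assume l: "Vector_Spaces.linear (smult L) (*) l"
    interpret l: module_hom "smult L" "(*)" l using l by (simp add: module_hom_iff_linear)
    have "(\<lambda>k. l ((br x ^^ k) z) / fact k) sums l w" using w l by (simp add: exp_sums_def)
    from sums_mult[OF this, of c]
    show "(\<lambda>k. l ((br x ^^ k) (c \<cdot> z)) / fact k) sums l (c \<cdot> w)"
      by (simp add: br_pow_scale l.scale)
  qed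
  then show ?thesis using w by (simp add: exp_ad_eqI)
qed

text \<open>The action of H on the torus is evaluated in this way, the summands of
  \<open>r_elem\<close> being eigenvectors.\<close>

lemma exp_ad_eigen:
  assumes "\<And>i. i \<in> I \<Longrightarrow> br x (v i) = a i \<cdot> v i"
  shows "exp_ad L x (\<Sum>i\<in>I. v i) = (\<Sum>i\<in>I. exp (a i) \<cdot> v i)"
proof (rule exp_ad_eqI, unfold exp_sums_def, intro allI impI)
  fix l assume l: "Vector_Spaces.linear (smult L) (*) l"
  interpret l: module_hom "smult L" "(*)" l using l by (simp add: module_hom_iff_linear)
  have pw: "(br x ^^ k) (\<Sum>i\<in>I. v i) = (\<Sum>i\<in>I. a i ^ k \<cdot> v i)" for k
    by (induction k) (simp_all add: br_sum br_scale assms mult.commute)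
  have "(\<lambda>k. \<Sum>i\<in>I. (a i ^ k /\<^sub>R fact k) * l (v i)) sums (\<Sum>i\<in>I. exp (a i) * l (v i))"
    by (intro sums_sum sums_mult2 exp_converges)
  moreover have "(\<Sum>i\<in>I. (a i ^ k /\<^sub>R fact k) * l (v i)) = l ((br x ^^ k) (\<Sum>i\<in>I. v i)) / fact k" for k
    by (simp add: pw l.sum l.scale sum_divide_distrib scaleR_conv_of_real field_simps)
  ultimately show "(\<lambda>k. l ((br x ^^ k) (\<Sum>i\<in>I. v i)) / fact k) sums l (\<Sum>i\<in>I. exp (a i) \<cdot> v i)"
    by (simp add: l.sum l.scale)
qed

end

section \<open>Weight spaces\<close>

context fd_lie_algebra
begin

text \<open>Applying \<open>br x\<close> minus the scalar \<open>e p x\<close> removes the component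
  at \<open>p\<close> and multiplies the one at \<open>i\<close> by \<open>e i x - e p x\<close>,
  which is nonzero for an \<open>x\<close> separating \<open>p\<close> from \<open>i\<close>. So the
  induction hypothesis applies to the rest.\<close>

lemma eigen_component:
  fixes v :: "'i \<Rightarrow> 'g"
  assumes "finite F" "subspace W" and W: "\<And>x w. x \<in> X \<Longrightarrow> w \<in> W \<Longrightarrow> br x w \<in> W"
    and "\<And>i x. i \<in> F \<Longrightarrow> x \<in> X \<Longrightarrow> br x (v i) = e i x \<cdot> v i"
    and "\<And>i j. i \<in> F \<Longrightarrow> j \<in> F \<Longrightarrow> i \<noteq> j \<Longrightarrow> \<exists>x\<in>X. e i x \<noteq> e j x"
    and "(\<Sum>i\<in>F. v i) \<in> W"
  shows "\<forall>i\<in>F. v i \<in> W"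
  using assms(1,4,5,6)
proof (induction F arbitrary: v rule: finite_induct)
  case (insert p F)
  have sum: "v p + (\<Sum>i\<in>F. v i) \<in> W" using insert by simp
  have F: "v i \<in> W" if i: "i \<in> F" for i
  proof -
    have "p \<noteq> i" using i insert by auto
    then obtain x where x: "x \<in> X" "e p x \<noteq> e i x" using insert.prems(2)[of p i] i by auto
    have "br x (v p + (\<Sum>i\<in>F. v i)) - e p x \<cdot> (v p + (\<Sum>i\<in>F. v i)) \<in> W"
      using sum assms(2) W x by (intro subspace_diff subspace_scale) auto
    also have "br x (v p + (\<Sum>i\<in>F. v i)) - e p x \<cdot> (v p + (\<Sum>i\<in>F. v i)) = (\<Sum>i\<in>F. (e i x - e p x) \<cdot> v i)"
      using insert.prems(1) x
      by (simp add: br_simps scale_right_distrib scale_sum_right scale_left_diff_distrib sum_subtractf)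
    finally have *: "(\<Sum>i\<in>F. (e i x - e p x) \<cdot> v i) \<in> W" .
    have "\<forall>i\<in>F. (e i x - e p x) \<cdot> v i \<in> W"
    proof (rule insert.IH)
      show "br y ((e i x - e p x) \<cdot> v i) = e i y \<cdot> (e i x - e p x) \<cdot> v i" if "i \<in> F" "y \<in> X" for i y
        using insert.prems(1)[of i y] that by (simp add: br_scale mult.commute)
      show "\<exists>x\<in>X. e i x \<noteq> e j x" if "i \<in> F" "j \<in> F" "i \<noteq> j" for i j
        using insert.prems(2) that by auto
    qed (rule *)
    then have "(e i x - e p x) \<cdot> v i \<in> W" using i by blast
    then have "inverse (e i x - e p x) \<cdot> (e i x - e p x) \<cdot> v i \<in> W" using assms(2) by (rule subspace_scale[rotated])
    then show ?thesis using x by simp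
  qed
  have "v p + (\<Sum>i\<in>F. v i) - (\<Sum>i\<in>F. v i) \<in> W"
    using sum F assms(2) by (intro subspace_diff subspace_sum) auto
  then show ?case using F by simp
qed simp

text \<open>Demanding \<open>w i = 0\<close> off \<open>F\<close> in the induction makes it possible
  to add a vector of \<open>V i\<close> whether or not \<open>i\<close> already occurs.\<close>

lemma mem_span_UN:
  assumes "\<And>i. i \<in> I \<Longrightarrow> subspace (V i)" "x \<in> span (\<Union>i\<in>I. V i)"
  obtains F w where "finite F" "F \<subseteq> I" "\<And>i. i \<in> F \<Longrightarrow> w i \<in> V i" "x = (\<Sum>i\<in>F. w i)"
proof -
  have "\<exists>F w. finite F \<and> F \<subseteq> I \<and> (\<forall>i\<in>F. w i \<in> V i) \<and> (\<forall>i. i \<notin> F \<longrightarrow> w i = 0) \<and> x = (\<Sum>i\<in>F. w i)"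
    using assms(2)
  proof (induction rule: span_induct_alt)
    case base
    show ?case by (rule exI[of _ "{}"], rule exI[of _ "\<lambda>_. 0"]) simp
  next
    case (step c a y)
    then obtain F w where F: "finite F" "F \<subseteq> I" "\<forall>i\<in>F. w i \<in> V i" "\<forall>i. i \<notin> F \<longrightarrow> w i = 0" "y = (\<Sum>i\<in>F. w i)"
      by blast
    from step(1) obtain i where i: "i \<in> I" "a \<in> V i" by blast
    define w' where "w' j = w j + (if j = i then c \<cdot> a else 0)" for j
    have "(\<Sum>j\<in>insert i F. w j) = y"
      unfolding F(5) using F by (intro sum.mono_neutral_right) auto
    then have "c \<cdot> a + y = (\<Sum>j\<in>insert i F. w' j)"
      using F(1) by (simp add: w'_def sum.distrib del: sum.insert)
    moreover have "\<forall>j\<in>insert i F. w' j \<in> V j"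
    proof
      fix j assume j: "j \<in> insert i F"
      then have sub: "subspace (V j)" using i F(2) assms(1) by auto
      then have "w j \<in> V j" using F(3,4) subspace_0 by (cases "j \<in> F") auto
      then show "w' j \<in> V j" using i sub by (auto simp: w'_def intro: subspace_add subspace_scale)
    qed
    moreover have "\<forall>j. j \<notin> insert i F \<longrightarrow> w' j = 0" using F(4) by (simp add: w'_def)
    ultimately show ?case using F(1,2) i by (intro exI[of _ "insert i F"] exI[of _ w']) auto
  qed
  then show ?thesis using that by blast
qed

lemma eigen_subspace: "subspace {v. br x v = c \<cdot> v}"
  by (rule subspaceI) (simp_all add: br_simps scale_right_distrib mult.commute)

text \<open>If \<open>v\<close> is an eigenvector of \<open>y\<close> with eigenvalue
  \<open>d\<close>, the operator of \<open>y\<close> minus \<open>d\<close> annihilates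
  \<open>v\<close> and, commuting with that of \<open>x\<close>, respects the decomposition of
  \<open>v\<close> into eigenvectors of \<open>x\<close>. Hence it annihilates every part.\<close>

lemma joint_eigenvectors_span:
  assumes "finite S" "S \<subseteq> H" "abelian_subset L H"
    and diag: "\<And>x. x \<in> H \<Longrightarrow> span {v. \<exists>c. br x v = c \<cdot> v} = UNIV"
  shows "span {v. \<forall>x\<in>S. \<exists>c. br x v = c \<cdot> v} = UNIV"
  using assms(1,2)
proof (induction S rule: finite_induct)
  case (insert x S)
  define E where "E = {v. \<forall>y\<in>S. \<exists>c. br y v = c \<cdot> v}"
  define E' where "E' = {v. \<forall>y\<in>insert x S. \<exists>c. br y v = c \<cdot> v}"
  have "v \<in> span E'" if v: "v \<in> E" for v
  proof -
    have "v \<in> span (\<Union>c. {v. br x v = c \<cdot> v})"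
      using diag[of x] insert.prems by (simp add: UNION_eq)
    then obtain C w where C: "finite C" "\<And>c. c \<in> C \<Longrightarrow> br x (w c) = c \<cdot> w c" "v = (\<Sum>c\<in>C. w c)"
      by (rule mem_span_UN[rotated]) (auto simp: eigen_subspace)
    have "w c \<in> E'" if c: "c \<in> C" for c
    proof -
      have "\<exists>d. br y (w c) = d \<cdot> w c" if y: "y \<in> S" for y
      proof -
        obtain d where d: "br y v = d \<cdot> v" using v y by (auto simp: E_def)
        have xy: "br x y = 0" using insert.prems y assms(3) by (auto simp: abelian_subset_def)
        have "\<forall>c\<in>C. br y (w c) - d \<cdot> w c \<in> {0}"
        proof (rule eigen_component[where X = "{x}" and e = "\<lambda>c _. c"])
          show "br x' (br y (w c) - d \<cdot> w c) = c \<cdot> (br y (w c) - d \<cdot> w c)"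
            if "c \<in> C" "x' \<in> {x}" for c x'
            using that C(2)[of c] jacobi[of x y "w c"]
            by (simp add: xy br_simps scale_right_diff_distrib mult.commute)
          show "(\<Sum>c\<in>C. br y (w c) - d \<cdot> w c) \<in> {0}"
            using d by (simp add: C(3) sum_subtractf br_sum scale_sum_right)
        qed (simp_all add: C(1) br_zero)
        then have "br y (w c) = d \<cdot> w c" using c by simp
        then show ?thesis ..
      qed
      then show ?thesis using C(2)[OF c] by (auto simp: E'_def)
    qed
    then show ?thesis unfolding C(3) by (intro span_sum span_base)
  qed
  then have "span E \<subseteq> span E'" by (intro span_minimal) auto
  then show ?case using insert by (auto simp: E_def E'_def)
qed simp

lemma brk_span_mono: "S \<subseteq> S' \<Longrightarrow> T \<subseteq> T' \<Longrightarrow> brk_span L S T \<subseteq> brk_span L S' T'"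
  unfolding brk_span_def by (rule span_mono) blast

lemma brk_spanI: "x \<in> S \<Longrightarrow> y \<in> T \<Longrightarrow> br x y \<in> brk_span L S T"
  unfolding brk_span_def by (rule span_base) blast

lemma brk_span_subset: "subspace U \<Longrightarrow> (\<And>x y. x \<in> S \<Longrightarrow> y \<in> T \<Longrightarrow> br x y \<in> U) \<Longrightarrow> brk_span L S T \<subseteq> U"
  unfolding brk_span_def by (rule span_minimal) auto

lemma brk_span_subspace: "subspace (brk_span L S T)"
  unfolding brk_span_def by simp

definition acts_on :: "'g set \<Rightarrow> 'g set \<Rightarrow> bool" where
  "acts_on M A \<longleftrightarrow> subspace A \<and> (\<forall>m\<in>M. \<forall>a\<in>A. br m a \<in> A)"

end

section \<open>Weight spaces of the Cartan subalgebra\<close>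

locale triangular =
  fixes L :: "('g::ab_group_add, 'm) root_datum_scheme"
  assumes td: "triangular_datum L"
begin

sublocale fd_lie_algebra L
  using td by unfold_locales (auto simp: triangular_datum_def semisimple_def)

abbreviation (input) "h \<equiv> cartan L"
abbreviation (input) "h_stable \<equiv> acts_on h"
abbreviation (input) "rs \<equiv> root_space L"
abbreviation (input) "wspan A \<equiv> span (\<Union>\<phi>\<in>A. rs \<phi>)"
abbreviation (input) "dual \<equiv> dual_cartan L"
abbreviation (input) "wts \<equiv> insert 0 (roots L)"

lemma cartan: "cartan_subalgebra L h"
  using td by (simp add: triangular_datum_def)

lemma h_subspace: "subspace h" and h_abelian: "x \<in> h \<Longrightarrow> y \<in> h \<Longrightarrow> br x y = 0"
  and h_diag: "x \<in> h \<Longrightarrow> span {v. \<exists>c. br x v = c \<cdot> v} = UNIV"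
  using cartan by (auto simp: cartan_subalgebra_def subalgebra_def abelian_subset_def)

lemma h_maximal: "subalgebra L k \<Longrightarrow> abelian_subset L k \<Longrightarrow> h \<subseteq> k \<Longrightarrow> k = h"
  using cartan unfolding cartan_subalgebra_def by blast

lemma rs_iff: "v \<in> rs \<phi> \<longleftrightarrow> (\<forall>x\<in>h. br x v = \<phi> x \<cdot> v)"
  by (simp add: root_space_def)

lemma rs_subspace: "subspace (rs \<phi>)"
  by (rule subspaceI) (simp_all add: rs_iff br_simps scale_right_distrib mult.commute)

lemma rs_br: "u \<in> rs \<phi> \<Longrightarrow> v \<in> rs \<psi> \<Longrightarrow> br u v \<in> rs (\<phi> + \<psi>)"
  by (simp add: rs_iff jacobi[of _ u v] br_simps scale_left_distrib add.commute)

lemma dual_sep: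
  assumes "\<phi> \<in> dual" "\<psi> \<in> dual" "\<phi> \<noteq> \<psi>" shows "\<exists>x\<in>h. \<phi> x \<noteq> \<psi> x"
proof (rule ccontr)
  assume "\<not> (\<exists>x\<in>h. \<phi> x \<noteq> \<psi> x)"
  then have "\<phi> x = \<psi> x" for x using assms(1,2) by (cases "x \<in> h") (auto simp: dual_cartan_def)
  then show False using assms(3) by auto
qed

lemma dual_0: "0 \<in> dual" and dual_add: "\<phi> \<in> dual \<Longrightarrow> \<psi> \<in> dual \<Longrightarrow> \<phi> + \<psi> \<in> dual"
  and dual_uminus: "\<phi> \<in> dual \<Longrightarrow> - \<phi> \<in> dual"
  by (auto simp: dual_cartan_def algebra_simps)

lemma roots_dual: "\<phi> \<in> roots L \<Longrightarrow> \<phi> \<in> dual"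
  by (simp add: roots_def)

lemma wts_dual: "\<phi> \<in> wts \<Longrightarrow> \<phi> \<in> dual"
  using roots_dual dual_0 by auto

lemma roots_iff: "\<phi> \<in> roots L \<longleftrightarrow> \<phi> \<in> dual \<and> \<phi> \<noteq> 0 \<and> rs \<phi> \<noteq> {0}"
  by (simp add: roots_def zero_fun_def)

lemma wt_component:
  assumes "finite F" "F \<subseteq> dual" "subspace W" "\<And>x w. x \<in> h \<Longrightarrow> w \<in> W \<Longrightarrow> br x w \<in> W"
    "\<And>\<phi>. \<phi> \<in> F \<Longrightarrow> v \<phi> \<in> rs \<phi>" "(\<Sum>\<phi>\<in>F. v \<phi>) \<in> W" "\<phi> \<in> F"
  shows "v \<phi> \<in> W"
proof -
  have "\<forall>\<phi>\<in>F. v \<phi> \<in> W"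
  proof (rule eigen_component[where X = h and e = "\<lambda>\<phi>. \<phi>"])
    show "\<exists>x\<in>h. i x \<noteq> j x" if "i \<in> F" "j \<in> F" "i \<noteq> j" for i j
      using dual_sep that assms(2) by blast
    show "br x (v i) = i x \<cdot> v i" if "i \<in> F" "x \<in> h" for i x
      using assms(5)[OF that(1)] that(2) by (simp add: rs_iff)
  qed (use assms in auto)
  then show ?thesis using assms by blast
qed

lemma rs_disjoint:
  assumes "v \<in> rs \<psi>" "\<psi> \<in> dual" "F \<subseteq> dual" "v \<in> wspan F" "v \<noteq> 0"
  shows "\<psi> \<in> F"
proof (rule ccontr)
  assume psi: "\<psi> \<notin> F"
  obtain G w where G: "finite G" "G \<subseteq> F" "\<And>\<phi>. \<phi> \<in> G \<Longrightarrow> w \<phi> \<in> rs \<phi>" "v = (\<Sum>\<phi>\<in>G. w \<phi>)"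
    using mem_span_UN[OF _ assms(4)] rs_subspace by metis
  \<comment> \<open>Placing \<open>- v\<close> at the new index \<psi> makes the total sum zero; the
    component lemma with \<open>W = {0}\<close> then forces \<open>v = 0\<close>.\<close>
  have "(w(\<psi> := - v)) \<psi> \<in> {0}"
  proof (rule wt_component[where F = "insert \<psi> G" and v = "w(\<psi> := - v)" and \<phi> = \<psi>])
    show "(\<Sum>\<phi>\<in>insert \<psi> G. (w(\<psi> := - v)) \<phi>) \<in> {0}"
    proof -
      have "\<psi> \<notin> G" using psi G by auto
      then have "(\<Sum>\<phi>\<in>G. (w(\<psi> := - v)) \<phi>) = v" unfolding G(4) by (intro sum.cong) auto
      then show ?thesis using \<open>\<psi> \<notin> G\<close> G(1) by simp
    qed
    show "(w(\<psi> := - v)) \<phi> \<in> rs \<phi>" if "\<phi> \<in> insert \<psi> G" for \<phi>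
      using that G(3) assms(1) subspace_neg[OF rs_subspace] by auto
  qed (use G assms br_zero in auto)
  then show False using assms(5) by simp
qed

lemma weight_of_joint_eigenvector:
  assumes "v \<noteq> 0" "\<And>x. x \<in> h \<Longrightarrow> \<exists>c. br x v = c \<cdot> v"
  shows "\<exists>\<phi>\<in>dual. v \<in> rs \<phi>"
proof -
  define \<phi> where "\<phi> x = (if x \<in> h then (SOME c. br x v = c \<cdot> v) else 0)" for x
  have *: "br x v = \<phi> x \<cdot> v" if "x \<in> h" for x
    using that someI_ex[OF assms(2)[OF that]] by (simp add: \<phi>_def)
  have "\<phi> (x + y) = \<phi> x + \<phi> y" if "x \<in> h" "y \<in> h" for x y
  proof -
    have "\<phi> (x + y) \<cdot> v = (\<phi> x + \<phi> y) \<cdot> v"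
      using *[OF subspace_add[OF h_subspace that]] *[OF that(1)] *[OF that(2)] by (simp add: br_simps scale_left_distrib)
    then show ?thesis using assms(1) by simp
  qed
  moreover have "\<phi> (c \<cdot> x) = c * \<phi> x" if "x \<in> h" for x c
  proof -
    have "\<phi> (c \<cdot> x) \<cdot> v = br (c \<cdot> x) v" using *[OF subspace_scale[OF h_subspace that]] by simp
    also have "\<dots> = (c * \<phi> x) \<cdot> v" using *[OF that] by (simp add: br_scale)
    finally have "\<phi> (c \<cdot> x) \<cdot> v = (c * \<phi> x) \<cdot> v" .
    then show ?thesis using assms(1) by simp
  qed
  ultimately have "\<phi> \<in> dual" by (simp add: dual_cartan_def \<phi>_def)
  then show ?thesis using * rs_iff by auto
qed

text \<open>Simultaneous diagonalisation is available for finite sets only, hence the basis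
  \<open>S\<close> of the Cartan subalgebra. It is enough, because the elements acting on a given
  \<open>v\<close> by a scalar form a subspace.\<close>

lemma rs_span_dual: "wspan dual = UNIV"
proof -
  obtain S where S: "S \<subseteq> h" "independent S" "h \<subseteq> span S" by (rule basis_exists[of h])
  have "{v. \<forall>x\<in>S. \<exists>c. br x v = c \<cdot> v} \<subseteq> wspan dual"
  proof
    fix v assume v: "v \<in> {v. \<forall>x\<in>S. \<exists>c. br x v = c \<cdot> v}"
    show "v \<in> wspan dual"
    proof (cases "v = 0")
      case False
      have sub: "subspace {x. \<exists>c. br x v = c \<cdot> v}"
      proof (rule subspaceI)
        show "0 \<in> {x. \<exists>c. br x v = c \<cdot> v}" by (auto simp: br_zero intro: exI[of _ 0])
        show "x + y \<in> {x. \<exists>c. br x v = c \<cdot> v}" if "x \<in> {x. \<exists>c. br x v = c \<cdot> v}" "y \<in> {x. \<exists>c. br x v = c \<cdot> v}" for x y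
          using that by (auto simp: br_add scale_left_distrib[symmetric])
        show "c \<cdot> x \<in> {x. \<exists>c. br x v = c \<cdot> v}" if "x \<in> {x. \<exists>c. br x v = c \<cdot> v}" for x c
          using that by (auto simp: br_scale)
      qed
      have "span S \<subseteq> {x. \<exists>c. br x v = c \<cdot> v}" using v by (intro span_minimal sub) auto
      then have "\<exists>c. br x v = c \<cdot> v" if "x \<in> h" for x using S(3) that by blast
      then have "\<exists>\<phi>\<in>dual. v \<in> rs \<phi>" by (rule weight_of_joint_eigenvector[OF False])
      then show ?thesis using span_base by blast
    qed (simp add: span_zero)
  qed
  then have "span {v. \<forall>x\<in>S. \<exists>c. br x v = c \<cdot> v} \<subseteq> wspan dual"
    by (rule span_minimal) simp
  moreover have "span {v. \<forall>x\<in>S. \<exists>c. br x v = c \<cdot> v} = UNIV"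
    by (rule joint_eigenvectors_span[of S h])
      (use S finiteI_independent h_diag h_abelian in \<open>auto simp: abelian_subset_def\<close>)
  ultimately show ?thesis by auto
qed

text \<open>The vectors of a finite basis involve only finitely many weights, and by
  \<open>rs_disjoint\<close> no further weight can have a nonzero space.\<close>

lemma finite_roots: "finite (roots L)"
proof -
  have "\<forall>b\<in>bas. \<exists>F. finite F \<and> F \<subseteq> dual \<and> b \<in> wspan F"
  proof
    fix b assume "b \<in> bas"
    have "b \<in> wspan dual" by (simp add: rs_span_dual)
    then obtain F w where F: "finite F" "F \<subseteq> dual" "\<And>i. i \<in> F \<Longrightarrow> w i \<in> rs i" "b = (\<Sum>i\<in>F. w i)"
      by (rule mem_span_UN[rotated]) (auto simp: rs_subspace)
    have "b \<in> wspan F" unfolding F(4) using F(3) by (intro span_sum span_base) auto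
    then show "\<exists>F. finite F \<and> F \<subseteq> dual \<and> b \<in> wspan F" using F by blast
  qed
  then obtain F where F: "\<forall>b\<in>bas. finite (F b) \<and> F b \<subseteq> dual \<and> b \<in> wspan (F b)"
    by (rule bchoice[THEN exE])
  define G where "G = (\<Union>b\<in>bas. F b)"
  have G: "finite G" "G \<subseteq> dual" using F finite_bas by (auto simp: G_def)
  have "b \<in> wspan G" if "b \<in> bas" for b
  proof -
    have "wspan (F b) \<subseteq> wspan G" using that by (intro span_mono) (auto simp: G_def)
    then show ?thesis using F that by auto
  qed
  then have "span bas \<subseteq> wspan G" by (intro span_minimal) auto
  then have span: "v \<in> wspan G" for v using span_Basis by auto
  have "\<psi> \<in> G" if psi: "\<psi> \<in> roots L" for \<psi>
  proof -
    obtain v where "v \<in> rs \<psi>" "v \<noteq> 0" using psi subspace_0[OF rs_subspace, of \<psi>] by (auto simp: roots_iff)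
    then show ?thesis by (metis rs_disjoint roots_dual psi G(2) span)
  qed
  then have "roots L \<subseteq> G" by (rule subsetI)
  then show ?thesis using G(1) by (rule finite_subset)
qed

lemma wt_decomp:
  obtains w where "\<And>\<phi>. w \<phi> \<in> rs \<phi>" "v = (\<Sum>\<phi>\<in>wts. w \<phi>)"
proof -
  have "v \<in> wspan dual" by (simp add: rs_span_dual)
  then obtain F w where F: "finite F" "F \<subseteq> dual" "\<And>i. i \<in> F \<Longrightarrow> w i \<in> rs i" "v = (\<Sum>i\<in>F. w i)"
    by (rule mem_span_UN[rotated]) (auto simp: rs_subspace)
  define w' where "w' \<phi> = (if \<phi> \<in> F then w \<phi> else 0)" for \<phi>
  have "w' \<phi> \<in> rs \<phi>" for \<phi> using F(3) subspace_0[OF rs_subspace] by (simp add: w'_def)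
  moreover have "v = (\<Sum>\<phi>\<in>wts. w' \<phi>)"
    unfolding F(4)
  proof (rule sum.mono_neutral_cong)
    show "w i = 0" if "i \<in> F - wts" for i
      using that F(2,3) roots_iff[of i] by auto
  qed (use F finite_roots in \<open>auto simp: w'_def\<close>)
  ultimately show ?thesis using that by blast
qed

text \<open>An element commuting with the Cartan subalgebra spans together with it an abelian
  subalgebra, so maximality applies.\<close>

lemma rs_0: "rs 0 = h"
proof
  show "h \<subseteq> rs 0" using h_abelian by (auto simp: rs_iff)
  show "rs 0 \<subseteq> h"
  proof
    fix v assume v: "v \<in> rs 0"
    define k where "k = span (insert v h)"
    have ab: "br x y = 0" if "x \<in> k" "y \<in> k" for x y
    proof -
      have "br g k = 0" if "g \<in> insert v h" "k \<in> insert v h" for g k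
      proof -
        have "br x v = 0" if "x \<in> h" for x using that v by (simp add: rs_iff)
        moreover from this have "br v x = 0" if "x \<in> h" for x using that br_anti[of v x] by simp
        ultimately show ?thesis using that h_abelian br_self by auto
      qed
      then have "br x y \<in> span {}" using that
        by (intro span_br_closed2[of "insert v h" "insert v h" "{}" x y]) (simp_all only: k_def span_zero)
      then show ?thesis by simp
    qed
    have "k = h"
      by (rule h_maximal) (use ab in \<open>auto simp: subalgebra_def abelian_subset_def k_def span_zero span_base\<close>)
    then show "v \<in> h" using span_base[of v "insert v h"] by (auto simp: k_def)
  qed
qed

lemma stable_comp:
  assumes "h_stable W" "v \<in> W"
  obtains w where "\<forall>\<phi>\<in>wts. w \<phi> \<in> rs \<phi> \<inter> W" "v = (\<Sum>\<phi>\<in>wts. w \<phi>)"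
proof -
  obtain w where w: "\<And>\<phi>. w \<phi> \<in> rs \<phi>" "v = (\<Sum>\<phi>\<in>wts. w \<phi>)" using wt_decomp by blast
  have "w \<phi> \<in> W" if "\<phi> \<in> wts" for \<phi>
    by (rule wt_component[OF _ _ _ _ _ _ that])
      (use w assms finite_roots wts_dual in \<open>auto simp: acts_on_def\<close>)
  then have "\<forall>\<phi>\<in>wts. w \<phi> \<in> rs \<phi> \<inter> W" using w(1) by blast
  then show thesis using w(2) by (rule that)
qed

text \<open>The pair \<open>\<theta> = \<eta> = 0\<close> may miss \<open>T\<close> because the
  Cartan subalgebra is abelian. This later removes the Cartan part from brackets in a Borel
  subalgebra.\<close>

lemma wspan_br:
  assumes "A \<subseteq> dual" "B \<subseteq> dual" "x \<in> wspan A" "y \<in> wspan B"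
    and T: "\<And>\<theta> \<eta>. \<theta> \<in> A \<Longrightarrow> \<eta> \<in> B \<Longrightarrow> \<theta> + \<eta> \<in> wts \<Longrightarrow> \<theta> + \<eta> \<in> T \<or> \<theta> = 0 \<and> \<eta> = 0"
  shows "br x y \<in> wspan T"
proof (rule span_br_closed2[OF _ assms(3,4)])
  fix u v assume "u \<in> (\<Union>\<phi>\<in>A. rs \<phi>)" "v \<in> (\<Union>\<phi>\<in>B. rs \<phi>)"
  then obtain \<theta> \<eta> where r: "\<theta> \<in> A" "u \<in> rs \<theta>" "\<eta> \<in> B" "v \<in> rs \<eta>" by blast
  have b: "br u v \<in> rs (\<theta> + \<eta>)" using r rs_br by blast
  consider "\<theta> + \<eta> \<in> T" | "\<theta> = 0" "\<eta> = 0" | "\<theta> + \<eta> \<notin> wts" using T[OF r(1,3)] by blast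
  then show "br u v \<in> wspan T"
  proof cases
    case 1 then show ?thesis using b by (intro span_base UN_I)
  next
    case 2 then show ?thesis using r rs_0 h_abelian by (simp add: span_zero)
  next
    case 3
    have "\<theta> + \<eta> \<in> dual" using r assms(1,2) dual_add by blast
    then have "br u v = 0" using 3 b roots_iff[of "\<theta> + \<eta>"] by auto
    then show ?thesis by (simp add: span_zero)
  qed
qed

lemma wspan_0: "wspan {0} = h"
  using rs_0 h_subspace by simp

lemma wspan_stable:
  assumes "A \<subseteq> dual" shows "h_stable (wspan A)"
proof -
  have "br x y \<in> wspan A" if "x \<in> h" "y \<in> wspan A" for x y
    by (rule wspan_br[of "{0}" A]) (use that assms dual_0 in \<open>simp_all only: wspan_0, auto\<close>)
  then show ?thesis by (simp add: acts_on_def)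
qed

lemma wspan_disjoint:
  assumes "A \<subseteq> dual" "B \<subseteq> dual" "A \<inter> B = {}" "v \<in> wspan A" "v \<in> wspan B"
  shows "v = 0"
proof -
  obtain F w where F: "finite F" "F \<subseteq> A" "\<And>\<phi>. \<phi> \<in> F \<Longrightarrow> w \<phi> \<in> rs \<phi>" "v = (\<Sum>\<phi>\<in>F. w \<phi>)"
    using mem_span_UN[OF _ assms(4)] rs_subspace by metis
  have "w \<phi> = 0" if \<phi>: "\<phi> \<in> F" for \<phi>
  proof (rule ccontr)
    assume nz: "w \<phi> \<noteq> 0"
    have d: "\<phi> \<in> dual" using \<phi> F(2) assms(1) by blast
    have "w \<phi> \<in> wspan B"
      by (rule wt_component[OF F(1) _ _ _ F(3) _ \<phi>])
        (use wspan_stable[OF assms(2)] F(2,4) assms(1,5) in \<open>auto simp: acts_on_def\<close>)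
    then have "\<phi> \<in> B" by (rule rs_disjoint[OF F(3)[OF \<phi>] d assms(2) _ nz])
    then show False using \<phi> F(2) assms(3) by blast
  qed
  then show ?thesis by (simp add: F(4))
qed

lemma span_wts: "wspan wts = UNIV"
proof -
  have "v \<in> wspan wts" for v
  proof -
    obtain w where w: "\<And>\<phi>. w \<phi> \<in> rs \<phi>" "v = (\<Sum>\<phi>\<in>wts. w \<phi>)" using wt_decomp by blast
    show ?thesis unfolding w(2) using w(1) by (intro span_sum span_base UN_I)
  qed
  then show ?thesis by blast
qed

text \<open>The commutator of two operators on \<open>span G\<close> has trace zero; here it is the action of an
  element of \<open>h\<close>, so that this gives a linear relation between weights.\<close>

lemma trace_zero:
  assumes "G \<subseteq> (\<Union>\<phi>\<in>F. rs \<phi>)" "\<forall>g\<in>G. br e g \<in> span G" "\<forall>g\<in>G. br f g \<in> span G"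
    and "br e f \<in> h" and "S \<subseteq> G" "independent S"
  shows "\<exists>B wt. S \<subseteq> B \<and> B \<subseteq> G \<and> finite B \<and> independent B \<and> span B = span G \<and>
    (\<forall>b\<in>B. wt b \<in> F \<and> b \<in> rs (wt b)) \<and> (\<Sum>b\<in>B. wt b (br e f)) = 0"
proof -
  \<comment> \<open>The basis is taken inside \<open>G\<close>, so that it consists of weight
    vectors; extending \<open>S\<close> allows the caller to force given vectors into the
    count.\<close>
  obtain B where SB: "S \<subseteq> B" and B: "B \<subseteq> G" "independent B" "G \<subseteq> span B"
    by (rule maximal_independent_subset_extend[OF assms(5,6)])
  have span: "span B = span G" using span_mono[OF B(1)] span_minimal[OF B(3)] by auto
  have "\<forall>b\<in>B. \<exists>\<phi>. \<phi> \<in> F \<and> b \<in> rs \<phi>" using B assms(1) by auto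
  then obtain wt where wt: "\<forall>b\<in>B. wt b \<in> F \<and> b \<in> rs (wt b)" by metis
  have "tr B (br (br e f)) = (\<Sum>b\<in>B. wt b (br e f))"
    by (rule tr_diag) (use B wt assms(4) in \<open>auto simp: rs_iff\<close>)
  moreover have "tr B (br (br e f)) = tr B (\<lambda>v. br e (br f v)) - tr B (\<lambda>v. br f (br e v))"
  proof -
    have "br (br e f) = (\<lambda>v. br e (br f v) - br f (br e v))"
      using jacobi[of e f] by (auto simp: algebra_simps)
    moreover have "br e (br f b) \<in> span B" "br f (br e b) \<in> span B" if "b \<in> B" for b
      using that assms(2,3) B span_br_closed[of G _ G] by (auto simp: span)
    ultimately show ?thesis using B by (simp add: tr_diff)
  qed
  moreover have "tr B (\<lambda>v. br e (br f v)) = tr B (\<lambda>v. br f (br e v))"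
    by (rule tr_comm) (use B assms span in \<open>auto simp: br_hom\<close>)
  ultimately have "(\<Sum>b\<in>B. wt b (br e f)) = 0" by simp
  then show ?thesis using B SB span wt finiteI_independent[of B] by blast
qed

text \<open>The source of positivity: \<open>kil x x\<close> becomes a sum of squares as soon as the
  weight values at \<open>x\<close> are real.\<close>

lemma weight_basis:
  "\<exists>B wt. finite B \<and> independent B \<and> span B = UNIV \<and>
    (\<forall>b\<in>B. wt b \<in> wts \<and> b \<in> rs (wt b) \<and> b \<noteq> 0) \<and>
    (\<forall>x\<in>h. \<forall>y\<in>h. kil x y = (\<Sum>b\<in>B. wt b x * wt b y))"
proof -
  obtain B wt where B: "finite B" "independent B" "span B = UNIV"
    "\<And>b. b \<in> B \<Longrightarrow> wt b \<in> wts \<and> b \<in> rs (wt b)"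
    \<comment> \<open>With \<open>e = f = 0\<close> the trace relation is void; only the basis of
      weight vectors is taken from it.\<close>
    using trace_zero[of "\<Union>\<phi>\<in>wts. rs \<phi>" wts 0 0 "{}"] subspace_0[OF h_subspace]
    unfolding span_wts br_zero using independent_empty by blast
  have "b \<noteq> 0" if "b \<in> B" for b using that B(2) dependent_zero by auto
  moreover have "kil x y = (\<Sum>b\<in>B. wt b x * wt b y)" if "x \<in> h" "y \<in> h" for x y
  proof -
    have "kil x y = tr B (\<lambda>z. br x (br y z))"
      unfolding kil_tr by (rule tr_indep) (use B in \<open>auto simp: independent_Basis span_Basis br2_hom\<close>)
    also have "\<dots> = (\<Sum>b\<in>B. wt b x * wt b y)"
      by (rule tr_diag) (use B that in \<open>auto simp: rs_iff br_scale mult.commute\<close>)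
    finally show ?thesis .
  qed
  ultimately show ?thesis using B by blast
qed

section \<open>Traces along root strings\<close>

definition string :: "'g weight \<Rightarrow> 'g weight \<Rightarrow> int \<Rightarrow> 'g weight" where
  "string \<psi> \<phi> k = (\<lambda>x. \<psi> x + of_int k * \<phi> x)"

lemma string_0: "string \<psi> \<phi> 0 = \<psi>" and string_1: "string \<psi> \<phi> 1 = \<psi> + \<phi>"
  by (auto simp: string_def)

lemma string_br: "e \<in> rs \<phi> \<Longrightarrow> v \<in> rs (string \<psi> \<phi> k) \<Longrightarrow> br e v \<in> rs (string \<psi> \<phi> (k + 1))"
  "f \<in> rs (- \<phi>) \<Longrightarrow> v \<in> rs (string \<psi> \<phi> k) \<Longrightarrow> br f v \<in> rs (string \<psi> \<phi> (k - 1))"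
proof -
  assume "e \<in> rs \<phi>" "v \<in> rs (string \<psi> \<phi> k)"
  then have "br e v \<in> rs (\<phi> + string \<psi> \<phi> k)" by (rule rs_br)
  moreover have "\<phi> + string \<psi> \<phi> k = string \<psi> \<phi> (k + 1)" by (auto simp: string_def algebra_simps)
  ultimately show "br e v \<in> rs (string \<psi> \<phi> (k + 1))" by simp
next
  assume "f \<in> rs (- \<phi>)" "v \<in> rs (string \<psi> \<phi> k)"
  then have "br f v \<in> rs (- \<phi> + string \<psi> \<phi> k)" by (rule rs_br)
  moreover have "- \<phi> + string \<psi> \<phi> k = string \<psi> \<phi> (k - 1)" by (auto simp: string_def algebra_simps)
  ultimately show "br f v \<in> rs (string \<psi> \<phi> (k - 1))" by simp
qed

lemma br_opposite: "e \<in> rs \<phi> \<Longrightarrow> f \<in> rs (- \<phi>) \<Longrightarrow> br e f \<in> h"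
  using rs_br[of e \<phi> f "- \<phi>"] by (simp add: rs_0)

text \<open>Both forms of \<open>K\<close> give a stable span: \<open>f\<close> lowers the level,
  and \<open>e\<close> can leave \<open>{..m}\<close> only from level \<open>m\<close>, where it is
  assumed to act as zero.\<close>

lemma string_trace:
  assumes "e \<in> rs \<phi>" "f \<in> rs (- \<phi>)" "K = UNIV \<or> (K = {..m} \<and> (\<forall>v\<in>rs (string \<psi> \<phi> m). br e v = 0))"
    and "S \<subseteq> (\<Union>k\<in>K. rs (string \<psi> \<phi> k))" "independent S"
  shows "\<exists>B k. S \<subseteq> B \<and> finite B \<and> independent B \<and> span B = span (\<Union>k\<in>K. rs (string \<psi> \<phi> k)) \<and>
    (\<forall>b\<in>B. k b \<in> K \<and> b \<in> rs (string \<psi> \<phi> (k b))) \<and>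
    (\<Sum>b\<in>B. \<psi> (br e f) + of_int (k b) * \<phi> (br e f)) = 0"
proof -
  let ?G = "\<Union>k\<in>K. rs (string \<psi> \<phi> k)"
  have e: "\<forall>g\<in>?G. br e g \<in> span ?G"
  proof
    fix g assume "g \<in> ?G"
    obtain k where k: "k \<in> K" "g \<in> rs (string \<psi> \<phi> k)" using \<open>g \<in> ?G\<close> by blast
    consider "k + 1 \<in> K" | "br e g = 0" using assms(3) k by (cases "k = m") auto
    then show "br e g \<in> span ?G"
    proof cases
      case 1
      then have "br e g \<in> ?G" using string_br(1)[OF assms(1) k(2)] by blast
      then show ?thesis by (rule span_base)
    qed (simp add: span_zero)
  qed
  have f: "\<forall>g\<in>?G. br f g \<in> span ?G"
  proof
    fix g assume "g \<in> ?G"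
    obtain k where k: "k \<in> K" "g \<in> rs (string \<psi> \<phi> k)" using \<open>g \<in> ?G\<close> by blast
    then have "k - 1 \<in> K" using assms(3) by auto
    then have "br f g \<in> ?G" using string_br(2)[OF assms(2) k(2)] by blast
    then show "br f g \<in> span ?G" by (rule span_base)
  qed
  have "?G \<subseteq> (\<Union>\<phi>\<in>string \<psi> \<phi> ` K. rs \<phi>)" by auto
  from trace_zero[OF this e f br_opposite[OF assms(1,2)] assms(4,5)]
  obtain B wt where SB: "S \<subseteq> B" and B: "finite B" "independent B" "span B = span ?G"
    "\<forall>b\<in>B. wt b \<in> string \<psi> \<phi> ` K \<and> b \<in> rs (wt b)" "(\<Sum>b\<in>B. wt b (br e f)) = 0"
    by blast
  have "\<forall>b\<in>B. \<exists>k. k \<in> K \<and> wt b = string \<psi> \<phi> k" using B(4) by blast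
  then obtain k where k: "\<forall>b\<in>B. k b \<in> K \<and> wt b = string \<psi> \<phi> (k b)" by metis
  have "(\<Sum>b\<in>B. wt b (br e f)) = (\<Sum>b\<in>B. \<psi> (br e f) + of_int (k b) * \<phi> (br e f))"
    by (rule sum.cong) (use k in \<open>auto simp: string_def\<close>)
  then have "(\<Sum>b\<in>B. \<psi> (br e f) + of_int (k b) * \<phi> (br e f)) = 0" using B(5) by simp
  moreover have "\<forall>b\<in>B. k b \<in> K \<and> b \<in> rs (string \<psi> \<phi> (k b))" using B(4) k by metis
  ultimately show ?thesis using SB B(1,2,3) by blast
qed

text \<open>For \<open>t = [e, f]\<close>, trace zero on the whole string says that the dimension
  times \<psi>(t) plus the sum of the levels times \<phi>(t) vanishes. The weight \<psi> may be 0,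
  hence the hypothesis on its space instead of \<open>\<psi> \<in> roots L\<close>.\<close>

lemma weight_ratio:
  assumes "e \<in> rs \<phi>" "f \<in> rs (- \<phi>)" "rs \<psi> \<noteq> {0}"
  obtains q :: real where "\<psi> (br e f) = of_real q * \<phi> (br e f)"
proof -
  obtain B k where B: "finite B" "independent B" "span B = span (\<Union>k\<in>UNIV. rs (string \<psi> \<phi> k))"
    "(\<Sum>b\<in>B. \<psi> (br e f) + of_int (k b) * \<phi> (br e f)) = 0"
    using string_trace[OF assms(1,2), of UNIV 0 \<psi> "{}"] independent_empty by blast
  have "B \<noteq> {}"
  proof
    assume "B = {}"
    then have "span (\<Union>k. rs (string \<psi> \<phi> k)) = {0}" using B(3) by simp
    then have "(\<Union>k. rs (string \<psi> \<phi> k)) \<subseteq> {0}" by (metis span_superset)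
    then have "rs (string \<psi> \<phi> 0) \<subseteq> {0}" by blast
    then show False using assms(3) subspace_0[OF rs_subspace, of \<psi>] by (auto simp: string_0)
  qed
  then have c: "of_nat (card B) \<noteq> (0::complex)" using B(1) by simp
  have "of_nat (card B) * \<psi> (br e f) + (\<Sum>b\<in>B. of_int (k b)) * \<phi> (br e f) = 0"
    using B(4) by (simp add: sum.distrib sum_distrib_right)
  then have "\<psi> (br e f) = of_real (- (\<Sum>b\<in>B. of_int (k b)) / of_nat (card B)) * \<phi> (br e f)"
    using c by (simp add: field_simps eq_neg_iff_add_eq_0)
  then show ?thesis by (rule that)
qed

lemma semisimple: "ideal_of L UNIV I \<Longrightarrow> solvable L I \<Longrightarrow> I = {0}"
  using td by (simp add: triangular_datum_def semisimple_def)

text \<open>\<open>x\<close> would span an abelian ideal.\<close>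

lemma central_zero:
  assumes "\<And>y. br x y = 0" shows "x = 0"
proof -
  have z: "br z y = 0" if "z \<in> span {x}" for z y
    using that assms by (auto simp: span_singleton br_simps)
  have z': "br y z = 0" if "z \<in> span {x}" for z y
    using z[OF that, of y] br_anti[of y z] by simp
  have "brk_span L (span {x}) (span {x}) \<subseteq> {0}"
    by (rule brk_span_subset) (use z in auto)
  then have "brk_span L (span {x}) (span {x}) = {0}"
    using subspace_0[OF brk_span_subspace] by blast
  then have "solvable L (span {x})" unfolding solvable_def by (intro exI[of _ 1]) simp
  moreover have "ideal_of L UNIV (span {x})" using z' by (simp add: ideal_of_def span_zero)
  ultimately show ?thesis using semisimple span_base[of x "{x}"] by auto
qed

text \<open>By \<open>weight_ratio\<close>, \<open>kil t t\<close> for \<open>t = [e, f]\<close> is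
  the square of \<phi>(t) times a sum of real squares. If it vanishes, every weight vanishes at
  \<open>t\<close>, so \<open>t\<close> is central.\<close>

lemma self_orthogonal_zero:
  assumes "e \<in> rs \<phi>" "f \<in> rs (- \<phi>)" "kil (br e f) (br e f) = 0"
  shows "br e f = 0"
proof -
  let ?t = "br e f"
  obtain B wt where B: "finite B" "independent B" "span B = UNIV"
    "\<forall>b\<in>B. wt b \<in> wts \<and> b \<in> rs (wt b) \<and> b \<noteq> 0"
    "\<forall>x\<in>h. \<forall>y\<in>h. kil x y = (\<Sum>b\<in>B. wt b x * wt b y)"
    using weight_basis by blast
  have t: "?t \<in> h" using assms br_opposite by blast
  have "\<exists>q::real. wt b ?t = of_real q * \<phi> ?t" if "b \<in> B" for b
    by (rule weight_ratio[OF assms(1,2), of "wt b"]) (use bspec[OF B(4) that] in auto)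
  then obtain q :: "'g \<Rightarrow> real" where q: "\<And>b. b \<in> B \<Longrightarrow> wt b ?t = of_real (q b) * \<phi> ?t" by metis
  have "kil ?t ?t = (\<Sum>b\<in>B. (\<phi> ?t)\<^sup>2 * of_real ((q b)\<^sup>2))"
    using B(5) t q by (simp add: power2_eq_square mult_ac)
  then have "(\<phi> ?t)\<^sup>2 * of_real (\<Sum>b\<in>B. (q b)\<^sup>2) = 0" using assms(3) by (simp add: sum_distrib_left)
  then have "\<phi> ?t = 0 \<or> (\<Sum>b\<in>B. (q b)\<^sup>2) = 0" by (metis mult_eq_0_iff of_real_eq_0_iff power_eq_0_iff)
  then have "\<phi> ?t = 0 \<or> (\<forall>b\<in>B. q b = 0)" using B(1) by (simp add: sum_nonneg_eq_0_iff)
  then have z: "wt b ?t = 0" if "b \<in> B" for b unfolding q[OF that] using that by auto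
  have "br ?t b = 0" if "b \<in> B" for b
  proof -
    have "br ?t b = wt b ?t \<cdot> b" using B(4) that t unfolding rs_iff by blast
    then show ?thesis by (simp add: z[OF that])
  qed
  then have "br ?t y \<in> span {}" for y by (intro span_br_closed[of B ?t "{}" y]) (simp_all add: B(3))
  then have "br ?t y = 0" for y by simp
  then show ?thesis by (rule central_zero)
qed

lemma kil_rs:
  assumes "u \<in> rs \<phi>" "v \<in> rs \<psi>" "x \<in> h" "\<phi> x + \<psi> x \<noteq> 0"
  shows "kil u v = 0"
proof -
  have "kil (br x u) v = - kil u (br x v)"
    using kil_inv[of u x v] br_anti[of x u] by (simp add: kil_simps)
  then have "(\<phi> x + \<psi> x) * kil u v = 0"
    using assms(1-3) by (simp add: rs_iff kil_simps algebra_simps)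
  then show ?thesis using assms(4) by simp
qed

lemma kil_rs_neq:
  assumes "u \<in> rs \<phi>" "v \<in> rs \<psi>" "\<phi> \<in> dual" "\<psi> \<in> dual" "\<psi> \<noteq> - \<phi>"
  shows "kil u v = 0"
proof -
  obtain x where "x \<in> h" "\<psi> x \<noteq> (- \<phi>) x" using dual_sep[of \<psi> "- \<phi>"] assms dual_uminus by auto
  then show ?thesis using kil_rs[OF assms(1,2), of x] by (auto simp: eq_neg_iff_add_eq_0 add.commute)
qed

end

section \<open>Engel's theorem and Cartan's criterion\<close>

context fd_lie_algebra
begin

lemma derived_subset_central:
  assumes "subalgebra L K"
  shows "((\<lambda>d. brk_span L d d) ^^ n) K \<subseteq> ((\<lambda>c. brk_span L K c) ^^ n) K \<and> ((\<lambda>d. brk_span L d d) ^^ n) K \<subseteq> K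
    \<and> subspace (((\<lambda>d. brk_span L d d) ^^ n) K)"
proof (induction n)
  case 0
  then show ?case using assms by (simp add: subalgebra_def)
next
  case (Suc n)
  let ?D = "((\<lambda>d. brk_span L d d) ^^ n) K"
  have "brk_span L ?D ?D \<subseteq> brk_span L K (((\<lambda>c. brk_span L K c) ^^ n) K)"
    by (rule brk_span_mono) (use Suc in auto)
  moreover have "brk_span L ?D ?D \<subseteq> K"
    by (rule brk_span_subset) (use assms Suc in \<open>auto simp: subalgebra_def\<close>)
  ultimately show ?case by (simp add: brk_span_subspace)
qed

lemma nilpotent_imp_solvable:
  assumes "subalgebra L K" "nilpotent L K" shows "solvable L K"
proof -
  obtain n where "((\<lambda>c. brk_span L K c) ^^ n) K = {0}" using assms(2) by (auto simp: nilpotent_def)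
  then have "((\<lambda>d. brk_span L d d) ^^ n) K = {0}"
    using derived_subset_central[OF assms(1), of n] subspace_0[of "((\<lambda>d. brk_span L d d) ^^ n) K"] by auto
  then show ?thesis by (auto simp: solvable_def)
qed

lemma derived_subalgebra: "subalgebra L K \<Longrightarrow> subalgebra L (brk_span L K K)"
proof -
  assume K: "subalgebra L K"
  have "brk_span L K K \<subseteq> K" by (rule brk_span_subset) (use K in \<open>auto simp: subalgebra_def\<close>)
  then show ?thesis by (auto simp: subalgebra_def brk_span_subspace intro!: brk_spanI)
qed

lemma solvable_derived: "solvable L (brk_span L K K) \<Longrightarrow> solvable L K"
  unfolding solvable_def by (metis funpow_Suc_right o_apply)

lemma derived_mono:
  assumes "K \<subseteq> K'" shows "((\<lambda>d. brk_span L d d) ^^ n) K \<subseteq> ((\<lambda>d. brk_span L d d) ^^ n) K'"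
proof (induction n)
  case (Suc n) then show ?case using brk_span_mono by simp
qed (use assms in simp)

lemma solvable_mono:
  assumes "subalgebra L K" "K \<subseteq> K'" "solvable L K'" shows "solvable L K"
proof -
  obtain n where "((\<lambda>d. brk_span L d d) ^^ n) K' = {0}" using assms(3) by (auto simp: solvable_def)
  then have "((\<lambda>d. brk_span L d d) ^^ n) K = {0}"
    using derived_mono[OF assms(2), of n] derived_subset_central[OF assms(1), of n]
      subspace_0[of "((\<lambda>d. brk_span L d d) ^^ n) K"] by auto
  then show ?thesis by (auto simp: solvable_def)
qed

lemma brk_span_ideal:
  assumes "ideal_of L UNIV I" shows "ideal_of L UNIV (brk_span L I I)"
proof -
  have "br x y \<in> brk_span L I I" if "y \<in> brk_span L I I" for x y
  proof -
    have *: "br x g \<in> span {br u v |u v. u \<in> I \<and> v \<in> I}" if g: "g \<in> {br u v |u v. u \<in> I \<and> v \<in> I}" for g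
    proof -
      obtain u v where uv: "g = br u v" "u \<in> I" "v \<in> I" using g by blast
      then have "br x u \<in> I" "br x v \<in> I" using assms by (auto simp: ideal_of_def)
      then have "br (br x u) v \<in> brk_span L I I" "br u (br x v) \<in> brk_span L I I"
        using uv by (auto intro: brk_spanI)
      then show ?thesis unfolding uv(1) jacobi[of x u v] by (simp add: brk_span_def span_add)
    qed
    show ?thesis unfolding brk_span_def
      by (rule span_br_closed[OF *]) (use that in \<open>simp_all add: brk_span_def\<close>)
  qed
  then show ?thesis by (simp add: ideal_of_def brk_span_subspace)
qed

text \<open>The conclusion of Engel's theorem for all subquotients of the adjoint module.\<close>

definition engel :: "'g set \<Rightarrow> bool" where
  "engel M \<longleftrightarrow> (\<forall>A B. acts_on M A \<and> acts_on M B \<and> A \<subset> B \<longrightarrow> (\<exists>v\<in>B - A. \<forall>m\<in>M. br m v \<in> A))"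

lemma br_left_subspace: "subspace A \<Longrightarrow> subspace {y. br y u \<in> A}"
  by (rule subspaceI) (auto simp: br_simps subspace_0 subspace_add subspace_scale)

lemma br_right_subspace: "subspace A \<Longrightarrow> subspace {y. br u y \<in> A}"
  by (rule subspaceI) (auto simp: br_simps subspace_0 subspace_add subspace_scale)

lemma span_insert_subset: "subspace A \<Longrightarrow> x \<in> A \<Longrightarrow> M \<subseteq> A \<Longrightarrow> span (insert x M) \<subseteq> A"
  by (rule span_minimal) auto

text \<open>\<open>x\<close> preserves \<open>B0\<close>, the vectors of \<open>B\<close> that
  \<open>M\<close> maps into \<open>A\<close>, because it normalises \<open>M\<close>. Starting from
  a vector of \<open>B0\<close> outside \<open>A\<close>, the last power of \<open>br x\<close> that
  stays outside \<open>A\<close> gives a vector sent into \<open>A\<close> by \<open>M\<close> and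
  by \<open>x\<close>.\<close>

lemma engel_insert:
  assumes "engel M" "\<And>m. m \<in> M \<Longrightarrow> br m x \<in> M" "\<And>v. \<exists>N. (br x ^^ N) v = 0"
  shows "engel (span (insert x M))"
  unfolding engel_def
proof (intro allI impI, elim conjE)
  fix A B assume AB: "acts_on (span (insert x M)) A" "acts_on (span (insert x M)) B" "A \<subset> B"
  have sub: "insert x M \<subseteq> span (insert x M)" by (rule span_superset)
  have M: "acts_on M A" "acts_on M B" using AB sub by (auto simp: acts_on_def)
  have x: "br x a \<in> A" if "a \<in> A" for a using AB(1) sub that by (auto simp: acts_on_def)
  have xB: "br x a \<in> B" if "a \<in> B" for a using AB(2) sub that by (auto simp: acts_on_def)
  define B0 where "B0 = {v\<in>B. \<forall>m\<in>M. br m v \<in> A}"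
  obtain v where v: "v \<in> B" "v \<notin> A" "\<forall>m\<in>M. br m v \<in> A"
    using assms(1) M AB(3) unfolding engel_def by blast
  have step: "br x u \<in> B0" if u: "u \<in> B0" for u
  proof -
    have "br m (br x u) \<in> A" if "m \<in> M" for m
    proof -
      have "br (br m x) u \<in> A" "br x (br m u) \<in> A" using assms(2)[OF that] u x that by (auto simp: B0_def)
      then show ?thesis using M(1) by (simp add: jacobi[of m x u] acts_on_def subspace_add)
    qed
    then show ?thesis using u xB by (simp add: B0_def)
  qed
  have pow: "(br x ^^ k) v \<in> B0" for k
  proof (induction k)
    case 0 then show ?case using v by (simp add: B0_def)
  qed (use step in simp)
  obtain N where "(br x ^^ N) v = 0" using assms(3) by blast
  then have ex: "\<exists>N. (br x ^^ N) v \<in> A" using M(1) subspace_0[of A] by (intro exI[of _ N]) (simp add: acts_on_def)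
  define n where "n = (LEAST N. (br x ^^ N) v \<in> A)"
  have n: "(br x ^^ n) v \<in> A" unfolding n_def using ex by (rule LeastI_ex)
  then have "n \<noteq> 0" using v(2) by (intro notI) simp
  then obtain k where k: "n = Suc k" using not0_implies_Suc by blast
  define u where "u = (br x ^^ k) v"
  have u: "u \<notin> A" "br x u \<in> A" "u \<in> B0"
    using n k not_less_Least[of k "\<lambda>N. (br x ^^ N) v \<in> A"] pow by (auto simp: u_def n_def[symmetric])
  have "span (insert x M) \<subseteq> {y. br y u \<in> A}"
    using u M(1) by (intro span_insert_subset br_left_subspace) (auto simp: B0_def acts_on_def)
  then show "\<exists>v\<in>B - A. \<forall>m\<in>span (insert x M). br m v \<in> A"
    using u by (intro bexI[of _ u]) (auto simp: B0_def)
qed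

lemma dim_less: "subspace A \<Longrightarrow> subspace B \<Longrightarrow> A \<subset> B \<Longrightarrow> dim A < dim B"
  by (metis dim_psubset span_eq_iff)

lemma max_dim_exists: "P A \<Longrightarrow> \<exists>M. P M \<and> (\<forall>A. P A \<longrightarrow> dim A \<le> dim M)"
  using ex_has_greatest_nat[of P A dim "Suc dimension"] dim_subset_UNIV by (simp add: less_Suc_eq_le)

text \<open>Choose a proper submodule \<open>A\<close> of maximal dimension. Engel's conclusion
  gives a \<open>v\<close> outside \<open>A\<close> that \<open>J\<close> maps into
  \<open>A\<close>; by maximality \<open>A\<close> and \<open>v\<close> span \<open>C\<close>, so
  \<open>J\<close> maps all of \<open>C\<close> into \<open>A\<close>.\<close>

lemma engel_central_less:
  assumes "engel J" "acts_on J C" "C \<noteq> {0}"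
  shows "brk_span L J C \<subset> C"
proof -
  let ?P = "\<lambda>A. acts_on J A \<and> A \<subset> C"
  have "?P {0}" using assms(2,3) subspace_0 by (auto simp: acts_on_def br_zero)
  from max_dim_exists[of ?P, OF this]
  obtain A where A: "?P A" and max: "\<forall>A'. ?P A' \<longrightarrow> dim A' \<le> dim A" by blast
  obtain v where v: "v \<in> C" "v \<notin> A" "\<forall>m\<in>J. br m v \<in> A"
    using assms(1,2) A unfolding engel_def by blast
  let ?A = "span (insert v A)"
  have subA: "A \<subseteq> ?A" "v \<in> ?A" using span_superset[of "insert v A"] by blast+
  have sC: "?A \<subseteq> C" using A v assms(2) by (intro span_insert_subset) (auto simp: acts_on_def)
  have inA: "br m a \<in> A" if "m \<in> J" "a \<in> ?A" for m a
  proof -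
    have "?A \<subseteq> {a. br m a \<in> A}"
      using A v that(1) by (intro span_insert_subset br_right_subspace) (auto simp: acts_on_def)
    then show ?thesis using that(2) by blast
  qed
  have "acts_on J ?A" using inA subA by (auto simp: acts_on_def)
  moreover have "dim A < dim ?A" using A subA v by (intro dim_less) (auto simp: acts_on_def)
  ultimately have "?A = C" using max sC by (meson leD psubsetI)
  then have "brk_span L J C \<subseteq> A" using A inA by (intro brk_span_subset) (auto simp: acts_on_def)
  then show ?thesis using A by blast
qed

text \<open>The dimension drops in each step of the lower central series until it is 0, so
  \<open>Suc (dim J)\<close> steps suffice.\<close>

lemma engel_nilpotent:
  assumes "engel J" "subalgebra L J"
  shows "nilpotent L J"
proof -
  let ?C = "\<lambda>n. ((\<lambda>c. brk_span L J c) ^^ n) J"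
  have acts: "acts_on J (?C n) \<and> ?C n \<subseteq> J" for n
  proof (induction n)
    case 0
    then show ?case using assms(2) by (auto simp: subalgebra_def acts_on_def)
  next
    case (Suc n)
    have "brk_span L J (?C n) \<subseteq> ?C n"
      using Suc by (intro brk_span_subset) (auto simp: acts_on_def)
    then show ?case using Suc by (auto simp: acts_on_def brk_span_subspace intro!: brk_spanI)
  qed
  have "?C n = {0} \<or> dim (?C n) + n \<le> dim J" for n
  proof (induction n)
    case (Suc n)
    show ?case
    proof (cases "?C n = {0}")
      case True
      then have "?C (Suc n) \<subseteq> {0}" using brk_span_subset[of "{0}" J "{0}"] by (simp add: br_zero)
      then show ?thesis using subspace_0[OF brk_span_subspace, of J "?C n"] by auto
    next
      case False
      have "brk_span L J (?C n) \<subset> ?C n" using engel_central_less assms(1) acts False by blast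
      then have "dim (?C (Suc n)) < dim (?C n)"
        using dim_less[of "brk_span L J (?C n)" "?C n"] acts[of n] brk_span_subspace by (simp add: acts_on_def)
      then show ?thesis using Suc False by linarith
    qed
  qed simp
  from this[of "Suc (dim J)"] have "?C (Suc (dim J)) = {0}" by linarith
  then show ?thesis unfolding nilpotent_def by blast
qed

end

context triangular
begin

text \<open>Powers of \<open>br x\<close> move a weight along an arithmetic progression with nonzero
  step \<psi>, which leaves the finite set of weights. The sum of the exponents found for the
  components of \<open>v\<close> serves all of them.\<close>

lemma root_ad_nilpotent:
  assumes "x \<in> rs \<psi>" "\<psi> \<in> dual" "\<psi> \<noteq> 0"
  shows "\<exists>N. (br x ^^ N) v = 0"
proof -
  have zero_mono: "(br x ^^ m) u = 0" if "(br x ^^ n) u = 0" "n \<le> m" for u n m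
  proof -
    have "(br x ^^ m) u = (br x ^^ (m - n)) ((br x ^^ n) u)"
      using that(2) by (metis funpow_add le_add_diff_inverse2 o_apply)
    also have "\<dots> = (br x ^^ (m - n)) 0" by (simp add: that(1))
    also have "(br x ^^ k) 0 = 0" for k by (induction k) (simp_all add: br_zero)
    finally show ?thesis .
  qed
  define sh where "sh \<phi> k = (\<lambda>y. \<phi> y + of_nat k * \<psi> y)" for \<phi> :: "'g weight" and k :: nat
  have sh_dual: "sh \<phi> k \<in> dual" if "\<phi> \<in> dual" for \<phi> k
    using that assms(2) by (auto simp: dual_cartan_def sh_def algebra_simps)
  have pow: "(br x ^^ k) u \<in> rs (sh \<phi> k)" if "u \<in> rs \<phi>" for \<phi> u k
  proof (induction k)
    case 0 then show ?case using that by (simp add: sh_def)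
  next
    case (Suc k)
    have "\<psi> + sh \<phi> k = sh \<phi> (Suc k)" by (auto simp: sh_def algebra_simps)
    then show ?case using rs_br[OF assms(1) Suc] by simp
  qed
  have "\<exists>n. (br x ^^ n) u = 0" if u: "u \<in> rs \<phi>" "\<phi> \<in> dual" for u \<phi>
  proof -
    obtain y where y: "\<psi> y \<noteq> 0" using assms(3) by (metis ext zero_fun_apply)
    have "inj (sh \<phi>)"
    proof (rule injI)
      fix a b assume "sh \<phi> a = sh \<phi> b"
      then have "sh \<phi> a y = sh \<phi> b y" by simp
      then show "a = b" using y by (simp add: sh_def)
    qed
    then have "infinite (range (sh \<phi>))" by (simp add: finite_image_iff)
    then obtain k where k: "sh \<phi> k \<notin> wts"
      using finite_roots by (metis finite_insert finite_subset image_subsetI)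
    then have "rs (sh \<phi> k) = {0}" using roots_iff[of "sh \<phi> k"] sh_dual[OF u(2)] by auto
    then show ?thesis using pow[OF u(1)] by blast
  qed
  moreover obtain w where w: "\<And>\<phi>. w \<phi> \<in> rs \<phi>" "v = (\<Sum>\<phi>\<in>wts. w \<phi>)" using wt_decomp by blast
  ultimately have "\<forall>\<phi>\<in>wts. \<exists>n. (br x ^^ n) (w \<phi>) = 0" using wts_dual by blast
  then obtain n where n: "\<forall>\<phi>\<in>wts. (br x ^^ n \<phi>) (w \<phi>) = 0" by (rule bchoice[THEN exE])
  define N where "N = (\<Sum>\<phi>\<in>wts. n \<phi>)"
  have "(br x ^^ N) (w \<phi>) = 0" if "\<phi> \<in> wts" for \<phi>
  proof (rule zero_mono)
    show "n \<phi> \<le> N" unfolding N_def using that finite_roots by (intro member_le_sum) auto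
  qed (use n that in blast)
  moreover have "(br x ^^ N) (\<Sum>\<phi>\<in>wts. w \<phi>) = (\<Sum>\<phi>\<in>wts. (br x ^^ N) (w \<phi>))" for N
    by (induction N) (simp_all only: funpow.simps id_apply o_apply br_sum)
  ultimately have "(br x ^^ N) v = 0" unfolding w(2) by (simp del: sum.insert)
  then show ?thesis ..
qed

text \<open>Engel's theorem in Jacobson's form, for the weakly closed set of homogeneous elements.\<close>

lemma engel_graded:
  assumes J: "subalgebra L J" "h_stable J" "J \<inter> h = {0}"
  shows "engel J"
proof -
  let ?P = "\<lambda>M. subalgebra L M \<and> h_stable M \<and> M \<subseteq> J \<and> engel M"
  have "?P {0}" using J(3) unfolding engel_def acts_on_def subalgebra_def
    using subspace_0 by (auto simp: br_zero)
  from max_dim_exists[of ?P, OF this]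
  obtain M where M: "?P M" and max: "\<forall>A'. ?P A' \<longrightarrow> dim A' \<le> dim M" by blast
  have subM: "subspace M" using M by (simp add: subalgebra_def)
  show ?thesis
  proof (cases "M = J")
    case False
    then have "M \<subset> J" using M by blast
    moreover have "acts_on M M" "acts_on M J" using M J(1) by (auto simp: acts_on_def subalgebra_def)
    ultimately obtain v where v: "v \<in> J" "v \<notin> M" "\<forall>m\<in>M. br m v \<in> M"
      using M unfolding engel_def by blast
    obtain w where w: "\<forall>\<phi>\<in>wts. w \<phi> \<in> rs \<phi> \<inter> J" "v = (\<Sum>\<phi>\<in>wts. w \<phi>)"
      using stable_comp[OF J(2) v(1)] by blast
    \<comment> \<open>Some weight component of \<open>v\<close> lies outside \<open>M\<close>;
      unlike \<open>v\<close> itself it is a weight vector, and so ad-nilpotent once its weight is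
      nonzero.\<close>
    obtain \<phi> where \<phi>: "\<phi> \<in> wts" "w \<phi> \<notin> M"
      using v(2) w(2) subspace_sum[OF subM] by metis
    define x where "x = w \<phi>"
    have "\<phi> \<noteq> 0"
    proof
      assume "\<phi> = 0"
      then have "w \<phi> \<in> J \<inter> h" using w \<phi> rs_0 by blast
      then show False using J(3) \<phi> subspace_0[OF subM] by auto
    qed
    then have x: "x \<in> rs \<phi>" "\<phi> \<in> dual" "x \<in> J" "x \<notin> M" using w \<phi> wts_dual by (auto simp: x_def)
    \<comment> \<open>The bracket of a weight component of \<open>m\<close> with \<open>v\<close>
      lies in \<open>M\<close>, and its weight components are the brackets with the components of
      \<open>v\<close>; so these lie in \<open>M\<close> as well.\<close>
    have norm: "br m x \<in> M" if m: "m \<in> M" for m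
    proof -
      obtain m' where m': "\<forall>\<psi>\<in>wts. m' \<psi> \<in> rs \<psi> \<inter> M" "m = (\<Sum>\<psi>\<in>wts. m' \<psi>)"
        using stable_comp m M by blast
      have "br (m' \<psi>) x \<in> M" if \<psi>: "\<psi> \<in> wts" for \<psi>
      proof -
        have "\<forall>\<phi>\<in>wts. br (m' \<psi>) (w \<phi>) \<in> M"
        proof (rule eigen_component[where X = h and e = "\<lambda>\<phi>. \<psi> + \<phi>"])
          show "(\<Sum>\<phi>\<in>wts. br (m' \<psi>) (w \<phi>)) \<in> M"
            using v(3) m'(1) \<psi> unfolding w(2) br_sum by blast
          show "br y (br (m' \<psi>) (w \<phi>)) = (\<psi> + \<phi>) y \<cdot> br (m' \<psi>) (w \<phi>)" if "\<phi> \<in> wts" "y \<in> h" for \<phi> y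
          proof -
            have "m' \<psi> \<in> rs \<psi>" "w \<phi> \<in> rs \<phi>" using m'(1) \<psi> w(1) that(1) by blast+
            then have "br (m' \<psi>) (w \<phi>) \<in> rs (\<psi> + \<phi>)" by (rule rs_br)
            then show ?thesis using that(2) unfolding rs_iff by blast
          qed
          show "\<exists>y\<in>h. (\<psi> + i) y \<noteq> (\<psi> + j) y" if "i \<in> wts" "j \<in> wts" "i \<noteq> j" for i j
            using dual_sep[of i j] that wts_dual by auto
        qed (use finite_roots subM M in \<open>auto simp: acts_on_def\<close>)
        then show ?thesis using \<phi>(1) unfolding x_def by blast
      qed
      then show ?thesis unfolding m'(2) br_sum using subM by (intro subspace_sum) auto
    qed
    let ?M = "span (insert x M)"
    have sub: "M \<subseteq> ?M" "x \<in> ?M" using span_superset[of "insert x M"] by blast+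
    have "engel ?M" by (rule engel_insert) (use M norm root_ad_nilpotent[OF x(1,2) \<open>\<phi> \<noteq> 0\<close>] in auto)
    moreover have MJ: "?M \<subseteq> J" using x M J(1) by (intro span_insert_subset) (auto simp: subalgebra_def)
    moreover have "subalgebra L ?M"
    proof -
      have "br a b \<in> ?M" if a: "a \<in> insert x M" and b: "b \<in> insert x M" for a b
      proof -
        consider "a = x" "b = x" | "a = x" "b \<in> M" | "a \<in> M" "b = x" | "a \<in> M" "b \<in> M" using a b by blast
        then show ?thesis
        proof cases
          case 1 then show ?thesis by (simp add: br_self span_zero)
        next
          case 2
          then have "- br b x \<in> M" using norm subM subspace_neg by blast
          then show ?thesis using 2 sub br_anti[of x b] by auto
        next
          case 3 then show ?thesis using norm sub by blast
        next
          case 4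
          then have "br a b \<in> M" using M by (simp add: subalgebra_def)
          then show ?thesis using sub by blast
        qed
      qed
      then have "br a b \<in> ?M" if "a \<in> ?M" "b \<in> ?M" for a b
        using span_br_closed2[OF _ that, of "insert x M"] by blast
      then show ?thesis by (simp add: subalgebra_def)
    qed
    moreover have "h_stable ?M"
    proof -
      have "br y a \<in> ?M" if "y \<in> h" "a \<in> ?M" for y a
      proof (rule span_br_closed[OF _ that(2)])
        show "br y g \<in> ?M" if g: "g \<in> insert x M" for g
        proof (cases "g = x")
          case True
          then have "br y g = \<phi> y \<cdot> x" using x(1) \<open>y \<in> h\<close> by (simp add: rs_iff)
          then show ?thesis using sub by (simp add: span_scale)
        next
          case False
          then have "br y g \<in> M" using M g \<open>y \<in> h\<close> by (auto simp: acts_on_def)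
          then show ?thesis using sub by blast
        qed
      qed
      then show ?thesis by (simp add: acts_on_def)
    qed
    ultimately have "dim ?M \<le> dim M" using max by blast
    moreover have "dim M < dim ?M" using subM sub x(4) by (intro dim_less) auto
    ultimately show ?thesis by linarith
  qed (use M in auto)
qed

lemma graded_nilpotent:
  assumes "subalgebra L J" "h_stable J" "J \<inter> h = {0}" shows "nilpotent L J"
  using engel_graded engel_nilpotent assms by blast

text \<open>The commutator ideal of the radical of the Killing form has no zero weight by
  \<open>self_orthogonal_zero\<close>, hence it is nilpotent by Engel's theorem.\<close>

lemma kil_nondegenerate:
  assumes "\<And>y. kil x y = 0" shows "x = 0"
proof -
  define I where "I = {x. \<forall>y. kil x y = 0}"
  have subI: "subspace I" by (rule subspaceI) (simp_all add: I_def kil_simps)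
  have brI: "br y x \<in> I \<and> br x y \<in> I" if "x \<in> I" for x y
  proof -
    have "br x y \<in> I" using that by (simp add: I_def kil_inv)
    moreover from this have "br y x \<in> I" using subspace_neg[OF subI] br_anti[of y x] by simp
    ultimately show ?thesis by blast
  qed
  have ideal: "ideal_of L UNIV I" using subI brI by (simp add: ideal_of_def)
  have stI: "h_stable I" using subI brI by (simp add: acts_on_def)
  have opp: "br e f = 0" if "e \<in> I" "e \<in> rs \<phi>" "f \<in> rs (- \<phi>)" for e f \<phi>
  proof (rule self_orthogonal_zero[OF that(2,3)])
    show "kil (br e f) (br e f) = 0" using brI[OF that(1), of f] by (simp add: I_def)
  qed
  let ?P = "brk_span L I I"
  have P: "ideal_of L UNIV ?P" using ideal by (rule brk_span_ideal)
  let ?U = "wspan (dual - {0})"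
  \<comment> \<open>Brackets of components of opposite weights are Killing-orthogonal to themselves
    and therefore vanish; nothing of weight zero remains in the commutator.\<close>
  have PU: "?P \<subseteq> ?U"
  proof (rule brk_span_subset)
    fix x y assume x: "x \<in> I" and y: "y \<in> I"
    obtain v where v: "\<forall>\<phi>\<in>wts. v \<phi> \<in> rs \<phi> \<inter> I" "x = (\<Sum>\<phi>\<in>wts. v \<phi>)" using stable_comp[OF stI x] by blast
    obtain w where w: "\<forall>\<phi>\<in>wts. w \<phi> \<in> rs \<phi> \<inter> I" "y = (\<Sum>\<phi>\<in>wts. w \<phi>)" using stable_comp[OF stI y] by blast
    have "br (v \<phi>) (w \<psi>) \<in> ?U" if "\<phi> \<in> wts" "\<psi> \<in> wts" for \<phi> \<psi>
    proof (cases "\<phi> + \<psi> = 0")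
      case True
      then have "\<psi> = - \<phi>" by (simp add: eq_neg_iff_add_eq_0 add.commute)
      then have "br (v \<phi>) (w \<psi>) = 0" using opp[of "v \<phi>" \<phi> "w \<psi>"] v w that by blast
      then show ?thesis by (simp add: span_zero)
    next
      case False
      have "br (v \<phi>) (w \<psi>) \<in> rs (\<phi> + \<psi>)" using v w that rs_br by blast
      moreover have "\<phi> + \<psi> \<in> dual - {0}" using False that wts_dual dual_add by blast
      ultimately have "br (v \<phi>) (w \<psi>) \<in> (\<Union>\<phi>\<in>dual - {0}. rs \<phi>)" by (rule UN_I[rotated])
      then show ?thesis by (rule span_base)
    qed
    then show "br x y \<in> ?U" unfolding v(2) w(2) br_sum by (intro span_sum)
  qed simp
  have "v = 0" if "v \<in> ?P" "v \<in> h" for v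
    by (rule wspan_disjoint[of "dual - {0}" "{0}"]) (use that PU dual_0 wspan_0 in auto)
  then have "?P \<inter> h = {0}"
    using subspace_0[OF h_subspace] subspace_0[OF brk_span_subspace, of I I] by auto
  moreover have subP: "subalgebra L ?P" "h_stable ?P" using P by (auto simp: ideal_of_def subalgebra_def acts_on_def)
  ultimately have "solvable L ?P" using graded_nilpotent nilpotent_imp_solvable by blast
  then have "I = {0}" using ideal semisimple solvable_derived by blast
  moreover have "x \<in> I" using assms by (simp add: I_def)
  ultimately show ?thesis by blast
qed

end

section \<open>Roots\<close>

context triangular
begin

lemma kil_h_root: "x \<in> h \<Longrightarrow> v \<in> rs \<phi> \<Longrightarrow> \<phi> \<in> roots L \<Longrightarrow> kil x v = 0"
  by (rule kil_rs_neq[of x 0 v \<phi>]) (auto simp: rs_0 dual_0 roots_iff)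

lemma kil_h_nondegenerate:
  assumes "x \<in> h" "\<And>y. y \<in> h \<Longrightarrow> kil x y = 0" shows "x = 0"
proof (rule kil_nondegenerate)
  fix y
  obtain w where w: "\<And>\<phi>. w \<phi> \<in> rs \<phi>" "y = (\<Sum>\<phi>\<in>wts. w \<phi>)" using wt_decomp by blast
  have "kil x (w \<phi>) = 0" if "\<phi> \<in> wts" for \<phi>
  proof (cases "\<phi> = 0")
    case True
    then show ?thesis using assms(2)[of "w \<phi>"] w(1)[of \<phi>] rs_0 by simp
  next
    case False
    then show ?thesis using that kil_h_root[OF assms(1) w(1)] by blast
  qed
  then show "kil x y = 0" by (simp add: w(2) kil_simps del: sum.insert)
qed

text \<open>By nondegeneracy some \<open>y\<close> pairs with \<open>e\<close>, and only its
  component of weight \<open>- \<phi>\<close> can contribute.\<close>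

lemma opposite_root_vector:
  assumes "\<phi> \<in> roots L" "e \<in> rs \<phi>" "e \<noteq> 0"
  shows "\<exists>f\<in>rs (- \<phi>). kil e f = 1"
proof -
  obtain y where y: "kil e y \<noteq> 0" using kil_nondegenerate assms(3) by blast
  obtain w where w: "\<And>\<phi>. w \<phi> \<in> rs \<phi>" "y = (\<Sum>\<phi>\<in>wts. w \<phi>)" using wt_decomp by blast
  have "(\<Sum>\<phi>\<in>wts. kil e (w \<phi>)) \<noteq> 0" using y by (simp add: w(2) kil_simps del: sum.insert)
  then obtain \<psi> where \<psi>: "\<psi> \<in> wts" "kil e (w \<psi>) \<noteq> 0" by (meson sum.neutral)
  then have "\<psi> = - \<phi>" using kil_rs_neq[OF assms(2) w(1)] assms(1) roots_dual wts_dual by blast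
  then have "(1 / kil e (w \<psi>)) \<cdot> w \<psi> \<in> rs (- \<phi>)" using w(1)[of \<psi>] subspace_scale[OF rs_subspace] by blast
  moreover have "kil e ((1 / kil e (w \<psi>)) \<cdot> w \<psi>) = 1" using \<psi> by (simp add: kil_simps)
  ultimately show ?thesis by blast
qed

lemma roots_nonzero: "0 \<notin> roots L"
  by (simp add: roots_iff)

lemma roots_uminus: "\<phi> \<in> roots L \<Longrightarrow> - \<phi> \<in> roots L"
proof -
  assume \<phi>: "\<phi> \<in> roots L"
  then obtain e where "e \<in> rs \<phi>" "e \<noteq> 0" using subspace_0[OF rs_subspace, of \<phi>] by (auto simp: roots_iff)
  then obtain f where "f \<in> rs (- \<phi>)" "kil e f = 1" using opposite_root_vector[OF \<phi>] by blast
  moreover from this have "f \<noteq> 0" by (auto simp: kil_simps)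
  ultimately show ?thesis using \<phi> dual_uminus by (auto simp: roots_iff)
qed

abbreviation (input) "E \<equiv> rootvec L"

lemma rootvec: "\<phi> \<in> roots L \<Longrightarrow> E \<phi> \<in> rs \<phi>" "\<phi> \<in> roots L \<Longrightarrow> E \<phi> \<noteq> 0"
  using td by (auto simp: triangular_datum_def)

text \<open>A relation in place of the described \<open>dual_vec\<close>: Killing duals are
  exhibited where they occur, for roots as a bracket by \<open>represents_br\<close>, for
  combinations by linearity.\<close>

definition represents :: "'g \<Rightarrow> 'g weight \<Rightarrow> bool" where
  "represents a \<eta> \<longleftrightarrow> a \<in> h \<and> (\<forall>x\<in>h. kil a x = \<eta> x)"

lemma represents_dual_vec: "represents a \<eta> \<Longrightarrow> dual_vec L \<eta> = a"
  unfolding dual_vec_def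
proof (rule the_equality)
  assume a: "represents a \<eta>"
  then show "a \<in> h \<and> (\<forall>x\<in>h. kil a x = \<eta> x)" by (simp add: represents_def)
  fix b assume b: "b \<in> h \<and> (\<forall>x\<in>h. kil b x = \<eta> x)"
  have "b - a = 0"
    by (rule kil_h_nondegenerate) (use a b subspace_diff[OF h_subspace] in \<open>auto simp: represents_def kil_simps\<close>)
  then show "b = a" by simp
qed

lemma represents_0: "represents 0 0"
  by (simp add: represents_def subspace_0[OF h_subspace] kil_simps)

lemma represents_add: "represents a \<eta> \<Longrightarrow> represents b \<mu> \<Longrightarrow> represents (a + b) (\<eta> + \<mu>)"
  by (simp add: represents_def subspace_add[OF h_subspace] kil_simps)

lemma represents_scale: "represents a \<eta> \<Longrightarrow> represents (c \<cdot> a) (\<lambda>x. c * \<eta> x)"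
  by (simp add: represents_def subspace_scale[OF h_subspace] kil_simps)

lemma represents_uminus: "represents a \<eta> \<Longrightarrow> represents (- a) (- \<eta>)"
  by (simp add: represents_def subspace_neg[OF h_subspace] kil_simps)

lemma represents_br:
  assumes "e \<in> rs \<phi>" "f \<in> rs (- \<phi>)"
  shows "represents (br e f) (\<lambda>x. kil e f * \<phi> x)"
proof -
  have "kil (br e f) x = kil e f * \<phi> x" if "x \<in> h" for x
  proof -
    have "br f x = \<phi> x \<cdot> f" using assms(2) that br_anti[of f x] by (simp add: rs_iff)
    then show ?thesis by (simp add: kil_inv kil_simps)
  qed
  then show ?thesis using br_opposite[OF assms] by (simp add: represents_def)
qed

abbreviation (input) "t \<equiv> dual_vec L"

lemma represents_root: "\<phi> \<in> roots L \<Longrightarrow> represents (t \<phi>) \<phi>"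
proof -
  assume \<phi>: "\<phi> \<in> roots L"
  obtain f where "f \<in> rs (- \<phi>)" "kil (E \<phi>) f = 1" using opposite_root_vector[OF \<phi> rootvec[OF \<phi>]] by blast
  then have "represents (br (E \<phi>) f) \<phi>" using represents_br[OF rootvec(1)[OF \<phi>], of f] by simp
  then show ?thesis using represents_dual_vec by simp
qed

lemma br_opposite_eq:
  assumes "\<phi> \<in> roots L" "e \<in> rs \<phi>" "f \<in> rs (- \<phi>)"
  shows "br e f = kil e f \<cdot> t \<phi>"
proof -
  have "represents (kil e f \<cdot> t \<phi>) (\<lambda>x. kil e f * \<phi> x)" by (rule represents_scale[OF represents_root[OF assms(1)]])
  then show ?thesis using represents_br[OF assms(2,3)] represents_dual_vec by metis
qed

lemma t_in_h: "\<phi> \<in> roots L \<Longrightarrow> t \<phi> \<in> h"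
  using represents_root by (auto simp: represents_def)

abbreviation (input) "ip \<equiv> dual_form L"

lemma ip_eq: "represents a \<eta> \<Longrightarrow> represents b \<mu> \<Longrightarrow> ip \<eta> \<mu> = kil a b"
  using represents_dual_vec by (simp add: dual_form_def)

lemma ip_sym: "ip \<eta> \<mu> = ip \<mu> \<eta>"
  by (simp add: dual_form_def kil_sym)

lemma ip_eval: "represents a \<eta> \<Longrightarrow> represents b \<mu> \<Longrightarrow> ip \<eta> \<mu> = \<eta> b"
  using ip_eq[of a \<eta> b \<mu>] by (simp add: represents_def)

lemma ip_root: "\<phi> \<in> roots L \<Longrightarrow> represents a \<eta> \<Longrightarrow> ip \<phi> \<eta> = \<eta> (t \<phi>)"
  using ip_eval[of a \<eta> "t \<phi>" \<phi>] represents_root ip_sym by metis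

text \<open>This plays the part of the real span of the roots, on which the induced form is real and
  positive definite.\<close>

definition rational_vector :: "'g weight \<Rightarrow> bool" where
  "rational_vector \<eta> \<longleftrightarrow> (\<exists>a. represents a \<eta> \<and> (\<forall>\<psi>\<in>roots L. \<psi> a \<in> \<real>))"

lemma sl2_triple:
  assumes "\<phi> \<in> roots L" "e \<in> rs \<phi>" "e \<noteq> 0"
  obtains f where "f \<in> rs (- \<phi>)" "kil e f = 1" "br e f = t \<phi>"
  using opposite_root_vector[OF assms] br_opposite_eq[OF assms(1,2)] by (metis scale_one)

lemma t_nonzero: "\<phi> \<in> roots L \<Longrightarrow> t \<phi> \<noteq> 0"
proof
  assume \<phi>: "\<phi> \<in> roots L" and "t \<phi> = 0"
  then have "\<phi> x = 0" for x
    using represents_root[OF \<phi>] roots_dual[OF \<phi>] by (cases "x \<in> h") (auto simp: represents_def kil_simps dual_cartan_def)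
  then have "\<phi> = 0" by auto
  then show False using \<phi> roots_nonzero by auto
qed

text \<open>With \<open>N = \<phi> (t \<phi>)\<close>, the sum of squares gives
  \<open>N = N^2 * Q\<close> for a real \<open>Q \<ge> 0\<close>. Since \<open>t \<phi>\<close> is
  not orthogonal to itself, \<open>N\<close> is nonzero, hence \<open>N = 1 / Q\<close>.\<close>

lemma root_norm_pos:
  assumes "\<phi> \<in> roots L"
  shows "\<phi> (t \<phi>) \<in> \<real>" "Re (\<phi> (t \<phi>)) > 0"
proof -
  obtain f where f: "f \<in> rs (- \<phi>)" "kil (E \<phi>) f = 1" "br (E \<phi>) f = t \<phi>"
    using sl2_triple[OF assms rootvec[OF assms]] by blast
  obtain B wt where B: "finite B" "independent B" "span B = UNIV"
    "\<forall>b\<in>B. wt b \<in> wts \<and> b \<in> rs (wt b) \<and> b \<noteq> 0"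
    "\<forall>x\<in>h. \<forall>y\<in>h. kil x y = (\<Sum>b\<in>B. wt b x * wt b y)"
    using weight_basis by blast
  have "\<exists>q::real. wt b (t \<phi>) = of_real q * \<phi> (t \<phi>)" if "b \<in> B" for b
    by (rule weight_ratio[OF rootvec(1)[OF assms] f(1), of "wt b"]) (use f(3) bspec[OF B(4) that] in auto)
  then obtain q :: "'g \<Rightarrow> real" where q: "\<And>b. b \<in> B \<Longrightarrow> wt b (t \<phi>) = of_real (q b) * \<phi> (t \<phi>)" by metis
  define Q where "Q = (\<Sum>b\<in>B. (q b)\<^sup>2)"
  have th: "t \<phi> \<in> h" by (rule t_in_h[OF assms])
  have "kil (t \<phi>) (t \<phi>) = (\<Sum>b\<in>B. wt b (t \<phi>) * wt b (t \<phi>))" using B(5) th by blast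
  also have "\<dots> = (\<Sum>b\<in>B. (\<phi> (t \<phi>))\<^sup>2 * of_real ((q b)\<^sup>2))"
    by (rule sum.cong) (simp_all add: q power2_eq_square mult_ac)
  also have "\<dots> = (\<phi> (t \<phi>))\<^sup>2 * of_real Q" by (simp add: Q_def sum_distrib_left)
  finally have k: "kil (t \<phi>) (t \<phi>) = (\<phi> (t \<phi>))\<^sup>2 * of_real Q" .
  have kt: "kil (t \<phi>) (t \<phi>) = \<phi> (t \<phi>)" using represents_root[OF assms] th by (simp add: represents_def)
  have "kil (t \<phi>) (t \<phi>) \<noteq> 0"
    using self_orthogonal_zero[OF rootvec(1)[OF assms] f(1)] t_nonzero[OF assms] f(3) by auto
  then have nz: "\<phi> (t \<phi>) \<noteq> 0" using kt by simp
  then have "1 = \<phi> (t \<phi>) * of_real Q" using k kt by (simp add: power2_eq_square)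
  then have "Q \<noteq> 0" by auto
  with \<open>1 = \<phi> (t \<phi>) * of_real Q\<close> have "\<phi> (t \<phi>) = of_real (1 / Q)" by (simp add: field_simps)
  moreover have "Q > 0" using \<open>Q \<noteq> 0\<close> by (simp add: Q_def sum_nonneg order_less_le)
  ultimately show "\<phi> (t \<phi>) \<in> \<real>" "Re (\<phi> (t \<phi>)) > 0" by (auto simp del: of_real_divide)
qed

lemma root_real: "\<phi> \<in> roots L \<Longrightarrow> \<psi> \<in> roots L \<Longrightarrow> \<psi> (t \<phi>) \<in> \<real>"
proof -
  assume \<phi>: "\<phi> \<in> roots L" and \<psi>: "\<psi> \<in> roots L"
  obtain f where f: "f \<in> rs (- \<phi>)" "br (E \<phi>) f = t \<phi>" using sl2_triple[OF \<phi> rootvec[OF \<phi>]] by blast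
  obtain q :: real where "\<psi> (br (E \<phi>) f) = of_real q * \<phi> (br (E \<phi>) f)"
    using weight_ratio[OF rootvec(1)[OF \<phi>] f(1)] \<psi> roots_iff by metis
  then show ?thesis using f(2) root_norm_pos(1)[OF \<phi>] by simp
qed

lemma dual_at_0: "\<phi> \<in> dual \<Longrightarrow> \<phi> 0 = 0"
proof -
  assume "\<phi> \<in> dual"
  then have "\<phi> (0 \<cdot> 0) = 0 * \<phi> 0"
    using subspace_0[OF h_subspace] unfolding dual_cartan_def by blast
  then show ?thesis by simp
qed

lemma rational_0: "rational_vector 0"
  unfolding rational_vector_def using represents_0 dual_at_0 roots_dual by (intro exI[of _ 0]) (metis Reals_0)

lemma rational_root: "\<phi> \<in> roots L \<Longrightarrow> rational_vector \<phi>"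
  using represents_root root_real by (auto simp: rational_vector_def)

lemma rational_add: "rational_vector \<eta> \<Longrightarrow> rational_vector \<mu> \<Longrightarrow> rational_vector (\<eta> + \<mu>)"
proof -
  assume "rational_vector \<eta>" "rational_vector \<mu>"
  then obtain a b where ab: "represents a \<eta>" "\<forall>\<psi>\<in>roots L. \<psi> a \<in> \<real>" "represents b \<mu>" "\<forall>\<psi>\<in>roots L. \<psi> b \<in> \<real>"
    unfolding rational_vector_def by blast
  have "\<psi> (a + b) \<in> \<real>" if "\<psi> \<in> roots L" for \<psi>
  proof -
    have "\<psi> (a + b) = \<psi> a + \<psi> b" using roots_dual[OF that] ab by (simp add: dual_cartan_def represents_def)
    then show ?thesis using ab that by simp
  qed
  then show ?thesis unfolding rational_vector_def using represents_add[OF ab(1,3)] by blast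
qed

lemma rational_uminus: "rational_vector \<eta> \<Longrightarrow> rational_vector (- \<eta>)"
proof -
  assume "rational_vector \<eta>"
  then obtain a where a: "represents a \<eta>" "\<forall>\<psi>\<in>roots L. \<psi> a \<in> \<real>"
    unfolding rational_vector_def by blast
  have "\<psi> (- a) \<in> \<real>" if "\<psi> \<in> roots L" for \<psi>
  proof -
    have "\<psi> ((-1) \<cdot> a) = (-1) * \<psi> a" using roots_dual[OF that] a(1) unfolding dual_cartan_def represents_def by blast
    then show ?thesis using a that by simp
  qed
  then show ?thesis unfolding rational_vector_def using represents_uminus[OF a(1)] by blast
qed

lemma represents_rational: "rational_vector \<eta> \<Longrightarrow> represents (t \<eta>) \<eta>"
  using represents_dual_vec by (auto simp: rational_vector_def)

lemma ip_add:
  assumes "rational_vector \<eta>" "rational_vector \<mu>" "rational_vector \<theta>"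
  shows "ip (\<eta> + \<mu>) \<theta> = ip \<eta> \<theta> + ip \<mu> \<theta>" "ip \<theta> (\<eta> + \<mu>) = ip \<theta> \<eta> + ip \<theta> \<mu>"
proof -
  show "ip (\<eta> + \<mu>) \<theta> = ip \<eta> \<theta> + ip \<mu> \<theta>"
    using ip_eval[OF represents_rational represents_rational] assms rational_add by simp
  then show "ip \<theta> (\<eta> + \<mu>) = ip \<theta> \<eta> + ip \<theta> \<mu>" by (simp add: ip_sym)
qed

lemma ip_uminus:
  assumes "rational_vector \<eta>" "rational_vector \<theta>"
  shows "ip (- \<eta>) \<theta> = - ip \<eta> \<theta>" "ip \<theta> (- \<eta>) = - ip \<theta> \<eta>"
proof -
  show "ip (- \<eta>) \<theta> = - ip \<eta> \<theta>"
    using ip_eval[OF represents_rational represents_rational] assms rational_uminus by simp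
  then show "ip \<theta> (- \<eta>) = - ip \<theta> \<eta>" by (simp add: ip_sym)
qed

lemma ip_zero: "rational_vector \<theta> \<Longrightarrow> ip 0 \<theta> = 0" "rational_vector \<theta> \<Longrightarrow> ip \<theta> 0 = 0"
  using ip_eval[OF represents_0 represents_rational] ip_sym by (metis zero_fun_apply)+

lemma ip_rational_real:
  assumes "rational_vector \<eta>" "rational_vector \<theta>"
  shows "ip \<eta> \<theta> \<in> \<real>"
proof -
  obtain B wt where B: "finite B" "independent B" "span B = UNIV"
    "\<forall>b\<in>B. wt b \<in> wts \<and> b \<in> rs (wt b) \<and> b \<noteq> 0"
    "\<forall>x\<in>h. \<forall>y\<in>h. kil x y = (\<Sum>b\<in>B. wt b x * wt b y)"
    using weight_basis by blast
  obtain a c where a: "represents a \<eta>" "\<forall>\<psi>\<in>roots L. \<psi> a \<in> \<real>" and c: "represents c \<theta>" "\<forall>\<psi>\<in>roots L. \<psi> c \<in> \<real>"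
    using assms unfolding rational_vector_def by blast
  have "wt b a * wt b c \<in> \<real>" if "b \<in> B" for b
    using B(4) that a(2) c(2) by auto
  moreover have "ip \<eta> \<theta> = (\<Sum>b\<in>B. wt b a * wt b c)"
    using ip_eq[OF a(1) c(1)] B(5) a(1) c(1) by (simp add: represents_def)
  ultimately show ?thesis by simp
qed

text \<open>The form is a sum of squares of the real numbers \<open>wt b a\<close>. Vanishing is
  concluded only on the Cartan subalgebra, as \<open>represents\<close> constrains \<eta> only
  there.\<close>

lemma ip_pos_def:
  assumes "rational_vector \<eta>"
  shows "Re (ip \<eta> \<eta>) \<ge> 0" "Re (ip \<eta> \<eta>) = 0 \<Longrightarrow> \<forall>x\<in>h. \<eta> x = 0"
proof -
  obtain B wt where B: "finite B" "independent B" "span B = UNIV"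
    "\<forall>b\<in>B. wt b \<in> wts \<and> b \<in> rs (wt b) \<and> b \<noteq> 0"
    "\<forall>x\<in>h. \<forall>y\<in>h. kil x y = (\<Sum>b\<in>B. wt b x * wt b y)"
    using weight_basis by blast
  obtain a where a: "represents a \<eta>" "\<forall>\<psi>\<in>roots L. \<psi> a \<in> \<real>"
    using assms unfolding rational_vector_def by blast
  have ah: "a \<in> h" using a(1) by (simp add: represents_def)
  have real: "wt b a = of_real (Re (wt b a))" if "b \<in> B" for b
    using B(4) that a(2) by (auto simp: of_real_Re)
  have "kil a a = (\<Sum>b\<in>B. wt b a * wt b a)" using B(5) ah by blast
  also have "\<dots> = (\<Sum>b\<in>B. of_real ((Re (wt b a))\<^sup>2))"
    by (rule sum.cong[OF refl]) (metis real of_real_power power2_eq_square)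
  finally have ip: "Re (ip \<eta> \<eta>) = (\<Sum>b\<in>B. (Re (wt b a))\<^sup>2)"
    using ip_eq[OF a(1) a(1)] by simp
  then show "Re (ip \<eta> \<eta>) \<ge> 0" by (simp add: sum_nonneg)
  assume "Re (ip \<eta> \<eta>) = 0"
  then have "\<forall>b\<in>B. Re (wt b a) = 0" using ip B(1) by (simp add: sum_nonneg_eq_0_iff)
  then have z: "wt b a = 0" if "b \<in> B" for b using real[OF that] that by simp
  have "kil a x = 0" if "x \<in> h" for x
    using B(5) ah that by (simp add: z)
  then show "\<forall>x\<in>h. \<eta> x = 0" using a(1) by (simp add: represents_def)
qed

lemma root_space_string_dual: "\<psi> \<in> dual \<Longrightarrow> \<phi> \<in> dual \<Longrightarrow> string \<psi> \<phi> k \<in> dual"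
  by (auto simp: string_def dual_cartan_def algebra_simps)

lemma string_inj: "\<phi> \<noteq> 0 \<Longrightarrow> string \<psi> \<phi> j = string \<psi> \<phi> k \<Longrightarrow> j = k"
  by (auto simp: string_def fun_eq_iff)

section \<open>Multiplicity one and sums of roots\<close>

lemma wspan_rootvec:
  assumes "\<phi> \<in> roots L" "A \<subseteq> dual" "E \<phi> \<in> wspan A" shows "\<phi> \<in> A"
  by (rule rs_disjoint[OF rootvec(1)[OF assms(1)] roots_dual[OF assms(1)] assms(2,3) rootvec(2)[OF assms(1)]])

lemma weight_value_unique:
  assumes "b \<in> rs \<phi>" "b \<in> rs \<psi>" "b \<noteq> 0" "x \<in> h" shows "\<phi> x = \<psi> x"
proof -
  have "\<phi> x \<cdot> b = \<psi> x \<cdot> b" using assms unfolding rs_iff by metis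
  then show ?thesis using assms(3) by simp
qed

text \<open>Otherwise a second vector, together with the first, would contribute
  \<open>2 * \<phi> (t \<phi>)\<close> to the trace of \<^term>\<open>t \<phi>\<close> on the span of \<open>f\<close>, \<open>t \<phi>\<close> and the root spaces of positive multiples of
  \<open>\<phi>\<close>, where only \<open>f\<close> contributes negatively.\<close>

lemma root_space_one_dim:
  assumes \<phi>: "\<phi> \<in> roots L" shows "rs \<phi> = span {E \<phi>}"
proof
  show "span {E \<phi>} \<subseteq> rs \<phi>" using rootvec(1)[OF \<phi>] rs_subspace by (intro span_minimal) auto
  let ?e = "E \<phi>"
  note e = rootvec[OF \<phi>]
  obtain f where f: "f \<in> rs (- \<phi>)" "kil ?e f = 1" "br ?e f = t \<phi>"
    using sl2_triple[OF \<phi> e] by blast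
  show "rs \<phi> \<subseteq> span {?e}"
  proof (rule ccontr)
    assume "\<not> rs \<phi> \<subseteq> span {?e}"
    then obtain v where v: "v \<in> rs \<phi>" "v \<notin> span {?e}" by blast
    define F where "F = insert (string 0 \<phi> (-1)) (string 0 \<phi> ` {0..})"
    define P where "P = (\<Union>k\<in>{1..}. rs (string 0 \<phi> k))"
    let ?G = "{f, t \<phi>} \<union> P"
    have s1: "string 0 \<phi> 1 = \<phi>" and sm1: "string 0 \<phi> (-1) = - \<phi>" by (auto simp: string_def)
    have th: "t \<phi> \<in> rs (string 0 \<phi> 0)" using t_in_h[OF \<phi>] rs_0 by (simp add: string_0)
    have GF: "?G \<subseteq> (\<Union>\<phi>\<in>F. rs \<phi>)"
      using th f(1) unfolding F_def P_def sm1 by auto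
    have sup: "g \<in> ?G \<Longrightarrow> g \<in> span ?G" for g by (rule span_base)
    have rsP: "u \<in> span ?G" if "u \<in> rs (string 0 \<phi> k)" "k \<ge> 1" for u k
      using that by (intro sup) (auto simp: P_def)
    have eG: "\<forall>g\<in>?G. br ?e g \<in> span ?G"
    proof
      fix g assume "g \<in> ?G"
      then consider "g = f" | "g = t \<phi>" | k where "k \<ge> 1" "g \<in> rs (string 0 \<phi> k)" by (auto simp: P_def)
      then show "br ?e g \<in> span ?G"
      proof cases
        case 1 then show ?thesis using f(3) sup by auto
      next
        case 2
        have "br ?e (t \<phi>) \<in> rs (string 0 \<phi> (0 + 1))" by (rule string_br(1)[OF e(1) th])
        then show ?thesis using 2 rsP by simp
      next
        case 3 then show ?thesis using string_br(1)[OF e(1)] rsP[of _ "k + 1"] by simp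
      qed
    qed
    have fG: "\<forall>g\<in>?G. br f g \<in> span ?G"
    proof
      fix g assume "g \<in> ?G"
      then consider "g = f" | "g = t \<phi>" | k where "k \<ge> 2" "g \<in> rs (string 0 \<phi> k)" | "g \<in> rs \<phi>"
        using s1 unfolding P_def by (smt (verit, best) UN_E Un_iff atLeast_iff insert_iff empty_iff)
      then show "br f g \<in> span ?G"
      proof cases
        case 1 then show ?thesis by (simp add: br_self span_zero)
      next
        case 2
        have "br f (t \<phi>) = \<phi> (t \<phi>) \<cdot> f" using f(1) t_in_h[OF \<phi>] br_anti[of f "t \<phi>"] by (simp add: rs_iff)
        then show ?thesis using 2 sup[of f] by (simp add: span_scale)
      next
        case 3 then show ?thesis using string_br(2)[OF f(1)] rsP[of _ "k - 1"] by simp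
      next
        case 4
        have "br f g = (- kil g f) \<cdot> t \<phi>" using br_opposite_eq[OF \<phi> 4 f(1)] br_anti[of f g] by simp
        then show ?thesis using sup[of "t \<phi>"] by (simp add: span_scale span_neg)
      qed
    qed
    \<comment> \<open>Both vectors are forced into the basis, so that the weight \<phi> is counted
      twice.\<close>
    have S: "{?e, v} \<subseteq> ?G" using e(1) v(1) s1 by (force simp: P_def)
    have ind: "independent {?e, v}"
      using v(2) e(2) independent_insertI[of v "{?e}"] by (simp add: insert_commute)
    have "br ?e f \<in> h" using f(3) t_in_h[OF \<phi>] by simp
    from trace_zero[OF GF eG fG this S ind] obtain B wt where B: "{?e, v} \<subseteq> B" "B \<subseteq> ?G" "finite B" "independent B"
      "\<forall>b\<in>B. wt b \<in> F \<and> b \<in> rs (wt b)" "(\<Sum>b\<in>B. wt b (br ?e f)) = 0" by blast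
    \<comment> \<open>The weight of \<open>b\<close> measured in units of \<phi>, that is, its level
      in the string through 0.\<close>
    define \<kappa> where "\<kappa> b = Re (wt b (t \<phi>) / \<phi> (t \<phi>))" for b
    have pos: "Re (\<phi> (t \<phi>)) > 0" and real: "\<phi> (t \<phi>) \<in> \<real>" using root_norm_pos[OF \<phi>] by auto
    then have nz: "\<phi> (t \<phi>) \<noteq> 0" by auto
    have "(\<Sum>b\<in>B. \<kappa> b) = Re ((\<Sum>b\<in>B. wt b (t \<phi>)) / \<phi> (t \<phi>))" by (simp add: \<kappa>_def sum_divide_distrib)
    then have sum0: "(\<Sum>b\<in>B. \<kappa> b) = 0" using B(6) f(3) by simp
    have kstring: "\<kappa> b = of_int k" if "wt b = string 0 \<phi> k" for b k
      using that nz by (simp add: \<kappa>_def string_def)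
    have nonneg: "\<kappa> b \<ge> 0" if b: "b \<in> B" "b \<noteq> f" for b
    proof -
      consider k where "k \<ge> 0" "wt b = string 0 \<phi> k" | "wt b = - \<phi>" using B(5) b sm1 by (auto simp: F_def)
      then show ?thesis
      proof cases
        case 1 then show ?thesis using kstring by simp
      next
        case 2
        \<comment> \<open>The weight assigned to \<open>b\<close> need not be the one by which
          \<open>b\<close> was put into \<open>?G\<close>. As \<open>b\<close> is nonzero, both
          agree at \<open>t \<phi>\<close>, which excludes the level \<open>- 1\<close>.\<close>
        have b0: "b \<noteq> 0" using b B(4) dependent_zero by auto
        have "b = t \<phi> \<or> b \<in> P" using b B(2) by blast
        then have "\<exists>k\<ge>0. b \<in> rs (string 0 \<phi> k)"
        proof
          assume "b \<in> P"
          then obtain k where "k \<ge> 1" "b \<in> rs (string 0 \<phi> k)" by (auto simp: P_def)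
          then show ?thesis by (intro exI[of _ k]) simp
        qed (use th in \<open>auto intro: exI[of _ 0]\<close>)
        then obtain k where k: "k \<ge> 0" "b \<in> rs (string 0 \<phi> k)" by blast
        have "b \<in> rs (- \<phi>)" using 2 B(5) b by auto
        then have "(- \<phi>) (t \<phi>) = string 0 \<phi> k (t \<phi>)"
          using weight_value_unique k(2) b0 t_in_h[OF \<phi>] by blast
        then have "(- 1) * \<phi> (t \<phi>) = of_int k * \<phi> (t \<phi>)" by (simp add: string_def)
        then have "(- 1 :: complex) = of_int k" using nz by (simp only: mult_cancel_right simp_thms)
        then have "(of_int (- 1) :: complex) = of_int k" by simp
        then show ?thesis using k(1) unfolding of_int_eq_iff by linarith
      qed
    qed
    have one: "\<kappa> b = 1" if b: "b \<in> {?e, v}" for b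
    proof -
      have b0: "b \<noteq> 0" using b e(2) v(2) span_zero by auto
      have "b \<in> rs \<phi>" "b \<in> rs (wt b)" using b e(1) v(1) B(1,5) by auto
      then have "\<phi> (t \<phi>) \<cdot> b = wt b (t \<phi>) \<cdot> b" using t_in_h[OF \<phi>] unfolding rs_iff by metis
      then show ?thesis using b0 nz by (simp add: \<kappa>_def)
    qed
    have "\<kappa> f \<ge> - 1" if "f \<in> B"
    proof -
      have "wt f \<in> F" using B(5) that by blast
      then consider "wt f = string 0 \<phi> (-1)" | k where "k \<ge> 0" "wt f = string 0 \<phi> k" by (auto simp: F_def)
      then show ?thesis using kstring[of f] by cases auto
    qed
    moreover have ne: "?e \<noteq> f" "v \<noteq> f" "?e \<noteq> v"
    proof -
      have "f = 0" if "f \<in> rs \<phi>"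
      proof (rule ccontr)
        assume "f \<noteq> 0"
        then have "\<phi> (t \<phi>) = (- \<phi>) (t \<phi>)" using weight_value_unique that f(1) t_in_h[OF \<phi>] by blast
        then show False using nz by simp
      qed
      moreover have "f \<noteq> 0" using f(2) by (auto simp: kil_simps)
      ultimately show "?e \<noteq> f" "v \<noteq> f" using e(1) v(1) by auto
      show "?e \<noteq> v" using v(2) span_base[of ?e "{?e}"] by auto
    qed
    \<comment> \<open>At least \<open>- 1\<close> from \<open>f\<close> and 2 from \<open>?e\<close>
      and \<open>v\<close>: the total cannot be 0.\<close>
    moreover have "(\<Sum>b\<in>B. \<kappa> b) \<ge> (if f \<in> B then \<kappa> f else 0) + 2"
    proof -
      have "(\<Sum>b\<in>{?e, v}. \<kappa> b) \<le> (\<Sum>b\<in>B - {f}. \<kappa> b)"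
        using B(1,3) ne nonneg by (intro sum_mono2) auto
      moreover have "(\<Sum>b\<in>{?e, v}. \<kappa> b) = 2" using ne one by simp
      moreover have "(\<Sum>b\<in>B. \<kappa> b) = (if f \<in> B then \<kappa> f else 0) + (\<Sum>b\<in>B - {f}. \<kappa> b)"
        using B(3) by (simp add: sum.remove)
      ultimately show ?thesis by linarith
    qed
    ultimately show False using sum0 by (auto split: if_splits)
  qed
qed

lemma rs_multiple: "\<phi> \<in> roots L \<Longrightarrow> v \<in> rs \<phi> \<Longrightarrow> \<exists>c. v = c \<cdot> E \<phi>"
  using root_space_one_dim[of \<phi>] by (auto simp: span_singleton)

text \<open>Under the assumption the part of the \<open>\<phi>\<close>-string up to \<open>\<psi>\<close> is stable, so that its trace and
  hence that of the complementary upper part vanish; but all terms of the latter are positive.\<close>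

lemma lower_string_trace:
  assumes \<phi>: "\<phi> \<in> roots L" and \<psi>: "\<psi> \<in> roots L"
    and "\<forall>v\<in>rs \<psi>. br (E \<phi>) v = 0"
  shows "Re (\<psi> (t \<phi>)) \<ge> 0" and "\<phi> + \<psi> \<notin> roots L"
proof -
  let ?e = "E \<phi>"
  note e = rootvec[OF \<phi>]
  obtain f where f: "f \<in> rs (- \<phi>)" "kil ?e f = 1" "br ?e f = t \<phi>" using sl2_triple[OF \<phi> e] by blast
  have pos: "Re (\<phi> (t \<phi>)) > 0" using root_norm_pos[OF \<phi>] by auto
  have phi0: "\<phi> \<noteq> 0" using \<phi> roots_nonzero by auto
  have t0: "\<forall>v\<in>rs (string \<psi> \<phi> 0). br ?e v = 0" using assms(3) by (simp add: string_0)
  obtain B k where B: "finite B" "independent B" "span B = span (\<Union>k\<in>{..0}. rs (string \<psi> \<phi> k))"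
    "\<forall>b\<in>B. k b \<in> {..0} \<and> b \<in> rs (string \<psi> \<phi> (k b))"
    "(\<Sum>b\<in>B. \<psi> (t \<phi>) + of_int (k b) * \<phi> (t \<phi>)) = 0"
    using string_trace[OF e(1) f(1), of "{..0}" 0 \<psi> "{}"] t0 independent_empty unfolding f(3) by blast
  have Bne: "B \<noteq> {}"
  proof
    assume "B = {}"
    then have "span (\<Union>k\<in>{..0}. rs (string \<psi> \<phi> k)) = {0}" using B(3) by simp
    then have "(\<Union>k\<in>{..0}. rs (string \<psi> \<phi> k)) \<subseteq> {0}" by (metis span_superset)
    moreover have "E \<psi> \<in> (\<Union>k\<in>{..0}. rs (string \<psi> \<phi> k))"
      using rootvec(1)[OF \<psi>] by (intro UN_I[of 0]) (auto simp: string_0)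
    ultimately show False using rootvec(2)[OF \<psi>] by blast
  qed
  show nonneg: "Re (\<psi> (t \<phi>)) \<ge> 0"
  proof (rule ccontr)
    assume neg: "\<not> Re (\<psi> (t \<phi>)) \<ge> 0"
    have "Re (\<psi> (t \<phi>) + of_int (k b) * \<phi> (t \<phi>)) < 0" if "b \<in> B" for b
    proof -
      have "of_int (k b) * Re (\<phi> (t \<phi>)) \<le> 0" using B(4) that pos by (intro mult_nonpos_nonneg) auto
      then show ?thesis using neg by simp
    qed
    then have "(\<Sum>b\<in>B. Re (\<psi> (t \<phi>) + of_int (k b) * \<phi> (t \<phi>))) < (\<Sum>b\<in>B. 0)"
      using B(1) Bne by (intro sum_strict_mono) auto
    moreover have "(\<Sum>b\<in>B. Re (\<psi> (t \<phi>) + of_int (k b) * \<phi> (t \<phi>))) = 0"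
      using arg_cong[OF B(5), of Re] by simp
    ultimately show False by simp
  qed
  show "\<phi> + \<psi> \<notin> roots L"
  proof
    assume sum: "\<phi> + \<psi> \<in> roots L"
    \<comment> \<open>The basis \<open>B\<close> of the lower part is extended to a basis
      \<open>C\<close> of the whole string; the added vectors have level at least 1.\<close>
    have BU: "B \<subseteq> (\<Union>k\<in>UNIV. rs (string \<psi> \<phi> k))" using B(4) by blast
    obtain C j where C: "B \<subseteq> C" "finite C" "independent C" "span C = span (\<Union>k\<in>UNIV. rs (string \<psi> \<phi> k))"
      "\<forall>b\<in>C. j b \<in> UNIV \<and> b \<in> rs (string \<psi> \<phi> (j b))"
      "(\<Sum>b\<in>C. \<psi> (t \<phi>) + of_int (j b) * \<phi> (t \<phi>)) = 0"
      using string_trace[OF e(1) f(1), of UNIV 0 \<psi> B] BU B(2) unfolding f(3) by blast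
    \<comment> \<open>The levels \<open>j\<close> and \<open>k\<close> come from separate choices;
      on \<open>B\<close> it suffices that they produce the same weight value at
      \<open>t \<phi>\<close>.\<close>
    have jk: "string \<psi> \<phi> (j b) (t \<phi>) = string \<psi> \<phi> (k b) (t \<phi>)" if "b \<in> B" for b
      by (rule weight_value_unique[of b]) (use that B C t_in_h[OF \<phi>] dependent_zero in auto)
    have j1: "j b \<ge> 1" if b: "b \<in> C - B" for b
    proof (rule ccontr)
      assume "\<not> j b \<ge> 1"
      then have "b \<in> (\<Union>k\<in>{..0}. rs (string \<psi> \<phi> k))" using C(5) b by (intro UN_I[of "j b"]) auto
      then have "b \<in> span B" unfolding B(3) by (rule span_base)
      then have "b \<in> span (C - {b})" using span_mono[of B "C - {b}"] C(1) b by blast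
      then show False using C(3) b unfolding dependent_def by blast
    qed
    have "(\<Sum>b\<in>C. \<psi> (t \<phi>) + of_int (j b) * \<phi> (t \<phi>)) =
      (\<Sum>b\<in>C - B. \<psi> (t \<phi>) + of_int (j b) * \<phi> (t \<phi>)) + (\<Sum>b\<in>B. \<psi> (t \<phi>) + of_int (j b) * \<phi> (t \<phi>))"
      using C(1,2) by (simp add: sum.subset_diff)
    also have "(\<Sum>b\<in>B. \<psi> (t \<phi>) + of_int (j b) * \<phi> (t \<phi>)) = (\<Sum>b\<in>B. \<psi> (t \<phi>) + of_int (k b) * \<phi> (t \<phi>))"
      by (rule sum.cong) (use jk in \<open>auto simp: string_def\<close>)
    finally have "(\<Sum>b\<in>C - B. \<psi> (t \<phi>) + of_int (j b) * \<phi> (t \<phi>)) = 0" using C(6) B(5) by simp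
    then have zero: "(\<Sum>b\<in>C - B. Re (\<psi> (t \<phi>) + of_int (j b) * \<phi> (t \<phi>))) = 0" using Re_sum by (metis zero_complex.sel(1))
    have "Re (\<psi> (t \<phi>) + of_int (j b) * \<phi> (t \<phi>)) > 0" if "b \<in> C - B" for b
    proof -
      have "of_int (j b) * Re (\<phi> (t \<phi>)) > 0" using j1[OF that] pos by (intro mult_pos_pos) auto
      then show ?thesis using nonneg by simp
    qed
    moreover have "C - B \<noteq> {}"
    proof
      assume "C - B = {}"
      then have "C = B" using C(1) by blast
      let ?v = "E (\<phi> + \<psi>)"
      have v: "?v \<in> rs (\<phi> + \<psi>)" "?v \<noteq> 0" using rootvec[OF sum] by auto
      then have "?v \<in> (\<Union>k. rs (string \<psi> \<phi> k))" by (intro UN_I[of 1]) (auto simp: string_1 add.commute)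
      then have "?v \<in> span C" unfolding C(4) by (rule span_base)
      then have "?v \<in> span (\<Union>\<theta>\<in>string \<psi> \<phi> ` {..0}. rs \<theta>)" using \<open>C = B\<close> B(3) by simp
      then have "\<phi> + \<psi> \<in> string \<psi> \<phi> ` {..0}"
        by (rule rs_disjoint[OF v(1) _ _ _ v(2), rotated 2])
          (use roots_dual sum \<phi> \<psi> root_space_string_dual in auto)
      then obtain k where "k \<le> 0" "string \<psi> \<phi> 1 = string \<psi> \<phi> k" by (auto simp: string_1 add.commute)
      then show False using string_inj[OF phi0] by force
    qed
    ultimately have "(\<Sum>b\<in>C - B. Re (\<psi> (t \<phi>) + of_int (j b) * \<phi> (t \<phi>))) > 0"
      using C(2) by (intro sum_pos) auto
    then show False using zero by simp
  qed
qed

lemma ip_roots: "\<phi> \<in> roots L \<Longrightarrow> \<psi> \<in> roots L \<Longrightarrow> ip \<phi> \<psi> = \<psi> (t \<phi>)"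
  using ip_root represents_root by blast

lemma br_root_nonzero:
  assumes "\<phi> \<in> roots L" "\<psi> \<in> roots L" "\<phi> + \<psi> \<in> roots L"
  shows "br (E \<phi>) (E \<psi>) \<noteq> 0"
proof
  assume "br (E \<phi>) (E \<psi>) = 0"
  then have "\<forall>v\<in>rs \<psi>. br (E \<phi>) v = 0" using rs_multiple[OF assms(2)] br_scale scale_zero_right by metis
  then show False using lower_string_trace(2) assms by blast
qed

text \<open>If \<open>\<phi> + \<psi>\<close> were not a weight, \<open>E \<phi>\<close> would
  annihilate \<open>rs \<psi>\<close>, and the trace on the lower string would make the product
  nonnegative. In this form root strings enter the combinatorics of roots.\<close>

lemma neg_ip_sum_root:
  assumes "\<phi> \<in> roots L" "\<psi> \<in> roots L" "Re (ip \<phi> \<psi>) < 0"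
  shows "\<phi> + \<psi> = 0 \<or> \<phi> + \<psi> \<in> roots L"
proof (rule ccontr)
  assume no: "\<not> ?thesis"
  have "br (E \<phi>) v = 0" if "v \<in> rs \<psi>" for v
  proof -
    have "\<phi> + \<psi> \<in> dual" using assms roots_dual dual_add by blast
    then have "rs (\<phi> + \<psi>) = {0}" using no roots_iff by blast
    then show ?thesis using rs_br[OF rootvec(1)[OF assms(1)] that] by blast
  qed
  then show False using lower_string_trace(1)[OF assms(1,2)] assms ip_roots by fastforce
qed

lemma br_root_multiple:
  assumes "\<phi> \<in> roots L" "\<psi> \<in> roots L" "\<phi> + \<psi> \<in> roots L"
  obtains c where "c \<noteq> 0" "E (\<phi> + \<psi>) = c \<cdot> br (E \<phi>) (E \<psi>)"
proof -
  have "br (E \<phi>) (E \<psi>) \<in> rs (\<phi> + \<psi>)" using rs_br rootvec assms by blast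
  then obtain c where c: "br (E \<phi>) (E \<psi>) = c \<cdot> E (\<phi> + \<psi>)" using rs_multiple[OF assms(3)] by blast
  then have "c \<noteq> 0" using br_root_nonzero[OF assms] by auto
  then show ?thesis using that[of "inverse c"] c by simp
qed

lemma ip_root_pos: "\<phi> \<in> roots L \<Longrightarrow> Re (ip \<phi> \<phi>) > 0"
  using ip_roots root_norm_pos by simp

end

section \<open>The Borel subalgebra\<close>

context triangular
begin

abbreviation (input) "pos \<equiv> pos_roots L"

lemma unscale: "subspace S \<Longrightarrow> a \<cdot> v \<in> S \<Longrightarrow> a \<noteq> 0 \<Longrightarrow> v \<in> S"
  using subspace_scale[of S "a \<cdot> v" "inverse a"] by simp

lemma kil_opposite_nonzero:
  assumes "\<phi> \<in> roots L" shows "kil (E \<phi>) (E (- \<phi>)) \<noteq> 0"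
proof -
  obtain f where f: "f \<in> rs (- \<phi>)" "kil (E \<phi>) f = 1" using sl2_triple[OF assms rootvec[OF assms]] by blast
  then obtain c where "f = c \<cdot> E (- \<phi>)" using rs_multiple roots_uminus[OF assms] by blast
  then show ?thesis using f(2) by (auto simp: kil_simps)
qed

lemma br_opposite_rootvec:
  assumes "\<phi> \<in> roots L" shows "br (E \<phi>) (E (- \<phi>)) = kil (E \<phi>) (E (- \<phi>)) \<cdot> t \<phi>"
  by (rule br_opposite_eq) (use assms rootvec roots_uminus in auto)

text \<open>\<open>E \<phi>\<close>, \<open>E (- \<phi>)\<close> and \<open>t \<phi>\<close> are
  brackets of one another up to nonzero factors, so they survive in every derived algebra.\<close>

lemma sl2_not_solvable:
  assumes "\<phi> \<in> roots L" "subalgebra L K" "E \<phi> \<in> K" "E (- \<phi>) \<in> K"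
  shows "\<not> solvable L K"
proof
  assume "solvable L K"
  then obtain n where n: "((\<lambda>d. brk_span L d d) ^^ n) K = {0}" by (auto simp: solvable_def)
  let ?D = "\<lambda>n. ((\<lambda>d. brk_span L d d) ^^ n) K"
  have sub: "subspace (?D n)" for n using derived_subset_central[OF assms(2)] by blast
  have th: "t \<phi> \<in> h" by (rule t_in_h[OF assms(1)])
  have nz: "\<phi> (t \<phi>) \<noteq> 0" using root_norm_pos[OF assms(1)] by auto
  have c: "kil (E \<phi>) (E (- \<phi>)) \<noteq> 0" by (rule kil_opposite_nonzero[OF assms(1)])
  have te: "br (t \<phi>) (E \<phi>) = \<phi> (t \<phi>) \<cdot> E \<phi>" using rootvec(1)[OF assms(1)] th by (simp add: rs_iff)
  have tf: "br (t \<phi>) (E (- \<phi>)) = (- \<phi> (t \<phi>)) \<cdot> E (- \<phi>)"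
    using rootvec(1)[OF roots_uminus[OF assms(1)]] th by (simp add: rs_iff)
  have "E \<phi> \<in> ?D n \<and> E (- \<phi>) \<in> ?D n \<and> t \<phi> \<in> ?D n"
  proof (induction n)
    case 0
    have "br (E \<phi>) (E (- \<phi>)) \<in> K" using assms by (simp add: subalgebra_def)
    moreover have "subspace K" using assms(2) by (simp add: subalgebra_def)
    ultimately have "t \<phi> \<in> K" using unscale c unfolding br_opposite_rootvec[OF assms(1)] by blast
    then show ?case using assms unfolding funpow.simps id_apply by blast
  next
    case (Suc n)
    let ?S = "brk_span L (?D n) (?D n)"
    have S: "br x y \<in> ?S" if "x \<in> ?D n" "y \<in> ?D n" for x y using that by (rule brk_spanI)
    have "\<phi> (t \<phi>) \<cdot> E \<phi> \<in> ?S" using Suc S unfolding te[symmetric] by blast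
    then have "E \<phi> \<in> ?S" by (rule unscale[OF brk_span_subspace _ nz])
    moreover have "(- \<phi> (t \<phi>)) \<cdot> E (- \<phi>) \<in> ?S" using Suc S unfolding tf[symmetric] by blast
    then have "E (- \<phi>) \<in> ?S" by (rule unscale[OF brk_span_subspace]) (use nz in simp)
    moreover have "kil (E \<phi>) (E (- \<phi>)) \<cdot> t \<phi> \<in> ?S"
      using Suc S unfolding br_opposite_rootvec[OF assms(1), symmetric] by blast
    then have "t \<phi> \<in> ?S" by (rule unscale[OF brk_span_subspace _ c])
    ultimately show ?case unfolding funpow.simps o_apply by blast
  qed
  then show False using n rootvec(2)[OF assms(1)] by blast
qed

section \<open>Root sets of solvable algebras containing the Cartan subalgebra\<close>

definition closed_asym :: "'g weight set \<Rightarrow> bool" where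
  "closed_asym P \<longleftrightarrow> P \<subseteq> roots L \<and> (\<forall>\<phi>\<in>P. - \<phi> \<notin> P) \<and>
     (\<forall>\<phi>\<in>P. \<forall>\<psi>\<in>P. \<phi> + \<psi> \<in> roots L \<longrightarrow> \<phi> + \<psi> \<in> P)"

abbreviation (input) "borel_alg P \<equiv> wspan (insert 0 P)"

text \<open>A part in the Cartan subalgebra could only come from opposite roots or from two of its
  own elements; the former do not occur in \<open>P\<close> and the latter commute.\<close>

lemma borel_alg_br:
  assumes "closed_asym P" "x \<in> borel_alg P" "y \<in> borel_alg P"
  shows "br x y \<in> wspan P"
proof (rule wspan_br[OF _ _ assms(2,3)])
  have P: "P \<subseteq> roots L" using assms(1) by (simp add: closed_asym_def)
  then show "insert 0 P \<subseteq> dual" "insert 0 P \<subseteq> dual" using roots_dual dual_0 by auto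
  fix \<theta> \<eta> assume t: "\<theta> \<in> insert 0 P" "\<eta> \<in> insert 0 P" "\<theta> + \<eta> \<in> wts"
  have "\<eta> = - \<theta>" if "\<theta> + \<eta> = 0" using that by (simp add: eq_neg_iff_add_eq_0 add.commute)
  then have "\<theta> + \<eta> \<noteq> 0 \<or> \<theta> = 0 \<and> \<eta> = 0"
    using t(1,2) assms(1) roots_nonzero P unfolding closed_asym_def
    by (metis insert_iff add_0 add.right_neutral)
  then show "\<theta> + \<eta> \<in> P \<or> \<theta> = 0 \<and> \<eta> = 0"
    using t assms(1) unfolding closed_asym_def by (metis insert_iff add_0 add.right_neutral)
qed

lemma wspan_insert: "wspan P \<subseteq> borel_alg P" "h \<subseteq> borel_alg P"
proof -
  show "wspan P \<subseteq> borel_alg P" by (rule span_mono) blast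
  have "wspan {0} \<subseteq> borel_alg P" by (rule span_mono) blast
  then show "h \<subseteq> borel_alg P" by (simp only: wspan_0)
qed

lemma wspan_subalgebra:
  assumes "closed_asym P" shows "subalgebra L (wspan P)" "subalgebra L (borel_alg P)"
proof -
  note sub = subsetD[OF wspan_insert(1)]
  show "subalgebra L (wspan P)"
    unfolding subalgebra_def by (intro conjI ballI subspace_span borel_alg_br[OF assms] sub)
  show "subalgebra L (borel_alg P)"
    unfolding subalgebra_def by (intro conjI ballI subspace_span sub[OF borel_alg_br[OF assms]])
qed

lemma wspan_nilpotent:
  assumes "closed_asym P" shows "nilpotent L (wspan P)"
proof (rule graded_nilpotent[OF wspan_subalgebra(1)[OF assms]])
  have P: "P \<subseteq> dual" "0 \<notin> P" using assms roots_dual roots_nonzero by (auto simp: closed_asym_def)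
  show "h_stable (wspan P)" by (rule wspan_stable[OF P(1)])
  have "v = 0" if "v \<in> wspan P" "v \<in> h" for v
    by (rule wspan_disjoint[of P "{0}"]) (use that P dual_0 wspan_0 in auto)
  then show "wspan P \<inter> h = {0}" using subspace_0[OF h_subspace] span_zero by auto
qed

lemma borel_alg_solvable:
  assumes "closed_asym P" shows "solvable L (borel_alg P)"
proof (rule solvable_derived, rule solvable_mono)
  show "subalgebra L (brk_span L (borel_alg P) (borel_alg P))"
    by (rule derived_subalgebra[OF wspan_subalgebra(2)[OF assms]])
  show "brk_span L (borel_alg P) (borel_alg P) \<subseteq> wspan P"
    by (rule brk_span_subset[OF subspace_span borel_alg_br[OF assms]])
  show "solvable L (wspan P)"
    by (rule nilpotent_imp_solvable[OF wspan_subalgebra(1)[OF assms] wspan_nilpotent[OF assms]])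
qed

lemma borel: "subalgebra L (borel L)" "solvable L (borel L)" "h \<subseteq> borel L"
    "\<And>k. subalgebra L k \<Longrightarrow> solvable L k \<Longrightarrow> borel L \<subseteq> k \<Longrightarrow> k = borel L"
  using td by (auto simp: triangular_datum_def borel_subalgebra_def)

abbreviation "bor_roots \<equiv> {\<phi> \<in> roots L. E \<phi> \<in> borel L}"

text \<open>Opposite roots would put an \<open>sl2\<close> into a solvable algebra. Closure holds
  because \<open>E (\<phi> + \<psi>)\<close> is a multiple of a bracket.\<close>

lemma bor_roots_closed: "closed_asym bor_roots"
  unfolding closed_asym_def
proof (intro conjI ballI impI)
  have b: "subspace (borel L)" "\<And>x y. x \<in> borel L \<Longrightarrow> y \<in> borel L \<Longrightarrow> br x y \<in> borel L"
    using borel(1) by (auto simp: subalgebra_def)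
  show "- \<phi> \<notin> bor_roots" if "\<phi> \<in> bor_roots" for \<phi>
    using sl2_not_solvable[of \<phi> "borel L"] borel that by auto
  fix \<phi> \<psi> assume that: "\<phi> \<in> bor_roots" "\<psi> \<in> bor_roots" and sum: "\<phi> + \<psi> \<in> roots L"
  have 1: "\<phi> \<in> roots L" "\<psi> \<in> roots L" using that by auto
  obtain c where "E (\<phi> + \<psi>) = c \<cdot> br (E \<phi>) (E \<psi>)" using br_root_multiple[OF 1 sum] by blast
  then show "\<phi> + \<psi> \<in> bor_roots" using that sum b subspace_scale by auto
qed auto

lemma rs_subset: "subspace W \<Longrightarrow> \<phi> \<in> roots L \<Longrightarrow> E \<phi> \<in> W \<Longrightarrow> rs \<phi> \<subseteq> W"
  using rs_multiple subspace_scale by blast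

lemma borel_eq: "borel L = borel_alg bor_roots"
proof
  have b: "subspace (borel L)" using borel(1) by (simp add: subalgebra_def)
  show "borel_alg bor_roots \<subseteq> borel L"
    using borel(3) b rs_0 rs_subset[OF b] by (intro span_minimal) auto
  show "borel L \<subseteq> borel_alg bor_roots"
  proof
    fix v assume v: "v \<in> borel L"
    have "h_stable (borel L)" using b borel(1,3) by (auto simp: acts_on_def subalgebra_def)
    then obtain w where w: "\<forall>\<phi>\<in>wts. w \<phi> \<in> rs \<phi> \<inter> borel L" "v = (\<Sum>\<phi>\<in>wts. w \<phi>)"
      using stable_comp v by blast
    have "w \<phi> \<in> borel_alg bor_roots" if \<phi>: "\<phi> \<in> wts" for \<phi>
    proof (cases "w \<phi> = 0 \<or> \<phi> = 0")
      case True
      then show ?thesis using w(1) \<phi> by (auto intro: span_base simp: span_zero)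
    next
      case False
      then have r: "\<phi> \<in> roots L" using \<phi> by blast
      have "w \<phi> \<in> rs \<phi>" "w \<phi> \<in> borel L" using w(1) \<phi> by blast+
      moreover from this obtain k where "w \<phi> = k \<cdot> E \<phi>" using rs_multiple[OF r] by blast
      ultimately have "E \<phi> \<in> borel L" using unscale[OF b, of k "E \<phi>"] False by auto
      then have "\<phi> \<in> insert 0 bor_roots" using r by blast
      then show ?thesis using \<open>w \<phi> \<in> rs \<phi>\<close> by (intro span_base UN_I)
    qed
    then show "v \<in> borel_alg bor_roots" unfolding w(2) by (rule span_sum)
  qed
qed

text \<open>The cone generated by \<open>P\<close> is pointed; lists stand for combinations with
  natural coefficients.\<close>

definition no_zero_sum :: "'g weight set \<Rightarrow> bool" where
  "no_zero_sum P \<longleftrightarrow> (\<forall>xs. xs \<noteq> [] \<and> set xs \<subseteq> P \<longrightarrow> sum_list xs \<noteq> 0)"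

lemma rational_sum_list: "set xs \<subseteq> roots L \<Longrightarrow> rational_vector (sum_list xs)"
  by (induction xs) (simp_all add: rational_0 rational_add rational_root)

lemma ip_sum_list:
  "rational_vector \<theta> \<Longrightarrow> set xs \<subseteq> roots L \<Longrightarrow> ip \<theta> (sum_list xs) = (\<Sum>\<phi>\<leftarrow>xs. ip \<theta> \<phi>)"
  by (induction xs) (simp_all add: ip_zero ip_add rational_root rational_sum_list)

text \<open>In a vanishing sum the products of the head \<phi> with the other members add up to
  \<open>- ip \<phi> \<phi>\<close>, so one member \<psi> has a negative product. Then
  \<open>\<phi> + \<psi>\<close> lies in \<open>P\<close>, and replacing the two by it shortens the
  list.\<close>

lemma closed_asym_no_zero_sum:
  assumes "closed_asym P" shows "no_zero_sum P"
proof -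
  have P: "P \<subseteq> roots L" using assms(1) by (simp add: closed_asym_def)
  have "sum_list xs \<noteq> 0" if "xs \<noteq> []" "set xs \<subseteq> P" for xs
    using that
  proof (induction "length xs" arbitrary: xs rule: less_induct)
    case less
    obtain \<phi> ys where xs: "xs = \<phi> # ys" using less.prems by (cases xs) auto
    have \<phi>: "\<phi> \<in> P" "\<phi> \<in> roots L" and ys: "set ys \<subseteq> P" "set ys \<subseteq> roots L" using less.prems P xs by auto
    show ?case
    proof
      assume "sum_list xs = 0"
      then have s: "sum_list ys = - \<phi>" using xs by (simp add: eq_neg_iff_add_eq_0 add.commute)
      have "(\<Sum>\<psi>\<leftarrow>ys. ip \<phi> \<psi>) = - ip \<phi> \<phi>"
        using ip_sum_list[OF rational_root[OF \<phi>(2)] ys(2)] s ip_uminus rational_root[OF \<phi>(2)] by simp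
      then have "Re (\<Sum>\<psi>\<leftarrow>ys. ip \<phi> \<psi>) < 0" using ip_root_pos[OF \<phi>(2)] by simp
      moreover have "Re (\<Sum>\<psi>\<leftarrow>zs. ip \<phi> \<psi>) \<ge> 0" if "\<forall>\<psi>\<in>set zs. Re (ip \<phi> \<psi>) \<ge> 0" for zs
        using that by (induction zs) auto
      ultimately obtain \<psi> where \<psi>: "\<psi> \<in> set ys" "Re (ip \<phi> \<psi>) < 0" by (meson not_le)
      have "\<phi> + \<psi> \<noteq> 0"
      proof
        assume "\<phi> + \<psi> = 0"
        then have "\<psi> = - \<phi>" by (simp add: eq_neg_iff_add_eq_0 add.commute)
        then show False using \<psi> ys \<phi> assms by (auto simp: closed_asym_def)
      qed
      then have "\<phi> + \<psi> \<in> roots L" using neg_ip_sum_root[OF \<phi>(2), of \<psi>] \<psi> ys(2) by blast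
      then have "\<phi> + \<psi> \<in> P" using assms \<phi> \<psi> ys unfolding closed_asym_def by blast
      then have "set ((\<phi> + \<psi>) # remove1 \<psi> ys) \<subseteq> P" using ys set_remove1_subset[of \<psi> ys] by auto
      moreover have "length ((\<phi> + \<psi>) # remove1 \<psi> ys) < length xs"
        using \<psi>(1) length_pos_if_in_set[OF \<psi>(1)] by (simp add: xs length_remove1)
      ultimately have "sum_list ((\<phi> + \<psi>) # remove1 \<psi> ys) \<noteq> 0" using less.hyps by blast
      moreover have "sum_list ((\<phi> + \<psi>) # remove1 \<psi> ys) = sum_list xs"
        using sum_list_map_remove1[OF \<psi>(1), of "\<lambda>x. x"] by (simp add: xs add.assoc)
      ultimately show False using \<open>sum_list xs = 0\<close> by simp
    qed
  qed
  then show ?thesis by (auto simp: no_zero_sum_def)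
qed

definition root_cone :: "'g weight set \<Rightarrow> 'g weight set" where
  "root_cone P = {\<phi> \<in> roots L. \<exists>xs. xs \<noteq> [] \<and> set xs \<subseteq> P \<and> \<phi> = sum_list xs}"

lemma root_cone_superset: "P \<subseteq> roots L \<Longrightarrow> P \<subseteq> root_cone P"
proof
  fix \<phi> assume "P \<subseteq> roots L" "\<phi> \<in> P"
  then show "\<phi> \<in> root_cone P" unfolding root_cone_def by (auto intro!: exI[of _ "[\<phi>]"])
qed

lemma root_cone_closed:
  assumes "no_zero_sum P" shows "closed_asym (root_cone P)"
  unfolding closed_asym_def
proof (intro conjI ballI impI)
  fix \<phi> assume \<phi>: "\<phi> \<in> root_cone P"
  then obtain xs where xs: "xs \<noteq> []" "set xs \<subseteq> P" "\<phi> = sum_list xs" by (auto simp: root_cone_def)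
  show "- \<phi> \<notin> root_cone P"
  proof
    assume "- \<phi> \<in> root_cone P"
    then obtain ys where ys: "ys \<noteq> []" "set ys \<subseteq> P" "- \<phi> = sum_list ys" by (auto simp: root_cone_def)
    have "sum_list (xs @ ys) = 0" using xs(3) ys(3)[symmetric] by simp
    moreover have "xs @ ys \<noteq> []" "set (xs @ ys) \<subseteq> P" using xs ys by auto
    ultimately show False using assms unfolding no_zero_sum_def by blast
  qed
  fix \<psi> assume \<psi>: "\<psi> \<in> root_cone P" and sum: "\<phi> + \<psi> \<in> roots L"
  then obtain ys where ys: "ys \<noteq> []" "set ys \<subseteq> P" "\<psi> = sum_list ys" by (auto simp: root_cone_def)
  show "\<phi> + \<psi> \<in> root_cone P"
    unfolding root_cone_def using sum xs ys by (auto intro!: exI[of _ "xs @ ys"])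
qed (auto simp: root_cone_def)

lemma sum_list_split:
  "sum_list xs = (\<lambda>x. of_nat (length (filter ((=) \<phi>) xs)) * (\<phi> x :: complex)) + sum_list (filter ((\<noteq>) \<phi>) xs)"
  by (induction xs) (auto simp: fun_eq_iff algebra_simps)

lemma sum_list_concat_replicate:
  "sum_list (concat (replicate n xs)) x = of_nat n * (sum_list xs x :: complex)"
  by (induction n) (simp_all add: algebra_simps)

text \<open>Zero sums involving \<open>\<phi>\<close> and \<open>- \<phi>\<close> combine to one in which both cancel.\<close>

lemma no_zero_sum_extend:
  assumes P: "no_zero_sum P" and "\<phi> \<noteq> 0"
  shows "no_zero_sum (insert \<phi> P) \<or> no_zero_sum (insert (- \<phi>) P)"
proof (rule ccontr)
  assume no: "\<not> ?thesis"
  have split: "\<exists>k zs. k \<ge> 1 \<and> set zs \<subseteq> P \<and> (\<forall>x. of_nat k * \<psi> x + sum_list zs x = 0)"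
    if nz: "\<not> no_zero_sum (insert \<psi> P)" for \<psi>
  proof -
    obtain xs where xs: "xs \<noteq> []" "set xs \<subseteq> insert \<psi> P" "sum_list xs = 0"
      using nz unfolding no_zero_sum_def by blast
    let ?k = "length (filter ((=) \<psi>) xs)" and ?z = "filter ((\<noteq>) \<psi>) xs"
    have "\<psi> \<in> set xs" using P xs unfolding no_zero_sum_def by blast
    then have "filter ((=) \<psi>) xs \<noteq> []" by (auto simp: filter_empty_conv)
    then have "?k \<ge> 1" by (simp add: Suc_le_eq)
    moreover have "set ?z \<subseteq> P" using xs(2) by auto
    moreover have "of_nat ?k * \<psi> x + sum_list ?z x = 0" for x
      using fun_cong[OF trans[OF sum_list_split[of xs \<psi>, symmetric] xs(3)], of x] by simp
    ultimately show ?thesis by blast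
  qed
  obtain k zs where k: "k \<ge> 1" "set zs \<subseteq> P" "\<And>x. of_nat k * \<phi> x + sum_list zs x = 0"
    using split[of \<phi>] no by blast
  obtain l ys where l: "l \<ge> 1" "set ys \<subseteq> P" "\<And>x. of_nat l * (- \<phi>) x + sum_list ys x = 0"
    using split[of "- \<phi>"] no by blast
  \<comment> \<open>\<open>zs\<close> sums to \<open>- k\<close> times \<phi> and \<open>ys\<close>
    to \<open>l\<close> times \<phi>, so \<open>l\<close> copies of the former cancel
    \<open>k\<close> copies of the latter.\<close>
  let ?w = "concat (replicate l zs) @ concat (replicate k ys)"
  have "zs \<noteq> []"
  proof
    assume "zs = []"
    then have "\<phi> x = 0" for x using k(1) k(3)[of x] by simp
    then have "\<phi> = 0" by auto
    then show False using assms(2) by simp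
  qed
  then have "?w \<noteq> []" using l(1) by (auto simp: Suc_le_eq)
  moreover have "set ?w \<subseteq> P" using k(2) l(2) by (auto simp: set_replicate_conv_if split: if_splits)
  moreover have "sum_list ?w = 0"
  proof
    fix x
    have "sum_list zs x = - of_nat k * \<phi> x" "sum_list ys x = of_nat l * \<phi> x"
      using k(3)[of x] l(3)[of x] by (simp_all add: algebra_simps eq_neg_iff_add_eq_0)
    then show "sum_list ?w x = 0 x" by (simp add: sum_list_concat_replicate)
  qed
  ultimately show False using P unfolding no_zero_sum_def by blast
qed

text \<open>If \<psi> can be added without creating a zero sum, the roots in the enlarged cone give
  a solvable algebra containing the Borel subalgebra, so \<psi> belongs to it by maximality. One of
  \<phi> and \<open>- \<phi>\<close> can always be added.\<close>

lemma bor_roots_total: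
  assumes "\<phi> \<in> roots L" shows "\<phi> \<in> bor_roots \<or> - \<phi> \<in> bor_roots"
proof (rule ccontr)
  assume no: "\<not> ?thesis"
  have "\<psi> \<in> bor_roots" if \<psi>: "\<psi> \<in> roots L" "no_zero_sum (insert \<psi> bor_roots)" for \<psi>
  proof -
    let ?C = "root_cone (insert \<psi> bor_roots)"
    have C: "insert \<psi> bor_roots \<subseteq> ?C" using \<psi>(1) by (intro root_cone_superset) auto
    have "borel_alg bor_roots \<subseteq> borel_alg ?C" using C by (intro span_mono) blast
    then have "borel L \<subseteq> borel_alg ?C" by (simp only: borel_eq[symmetric])
    then have eq: "borel_alg ?C = borel L"
      using borel(4) borel_alg_solvable wspan_subalgebra(2) root_cone_closed[OF \<psi>(2)] by blast
    have "\<psi> \<in> insert 0 ?C" using C by blast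
    then have "E \<psi> \<in> borel_alg ?C" using rootvec(1)[OF \<psi>(1)] by (intro span_base UN_I)
    then show ?thesis using eq \<psi>(1) by simp
  qed
  moreover have "no_zero_sum (insert \<phi> bor_roots) \<or> no_zero_sum (insert (- \<phi>) bor_roots)"
    by (rule no_zero_sum_extend[OF closed_asym_no_zero_sum[OF bor_roots_closed]]) (use assms roots_nonzero in auto)
  ultimately show False using no assms roots_uminus[OF assms] by blast
qed

text \<open>Positivity is defined through the nilradical. The root spaces in the Borel subalgebra
  span a nilpotent ideal of it, so all of them lie in the nilradical.\<close>

lemma pos_eq: "pos = bor_roots"
proof -
  have "nil_plus L \<subseteq> borel L"
    unfolding nil_plus_def nilradical_def using borel(1) by (intro span_minimal) (auto simp: ideal_of_def subalgebra_def)
  moreover have "E \<phi> \<in> nil_plus L" if "\<phi> \<in> bor_roots" for \<phi>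
  proof -
    let ?I = "wspan bor_roots"
    have "ideal_of L (borel_alg bor_roots) ?I"
      unfolding ideal_of_def using borel_alg_br[OF bor_roots_closed] wspan_insert(1)[of bor_roots] subspace_span by blast
    then have "ideal_of L (borel L) ?I" by (simp only: borel_eq[symmetric])
    moreover have "nilpotent L ?I" by (rule wspan_nilpotent[OF bor_roots_closed])
    moreover have "E \<phi> \<in> ?I" using that rootvec(1) by (intro span_base UN_I) auto
    ultimately have "E \<phi> \<in> \<Union>{I. ideal_of L (borel L) I \<and> nilpotent L I}" by blast
    then show ?thesis unfolding nil_plus_def nilradical_def by (rule span_base)
  qed
  ultimately show ?thesis unfolding pos_roots_def by blast
qed

lemma pos_roots: "\<phi> \<in> pos \<Longrightarrow> \<phi> \<in> roots L"
  by (simp add: pos_roots_def)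

lemma pos_total: "\<phi> \<in> roots L \<Longrightarrow> \<phi> \<in> pos \<or> - \<phi> \<in> pos"
  unfolding pos_eq by (rule bor_roots_total)

lemma pos_asym: "\<phi> \<in> pos \<Longrightarrow> - \<phi> \<notin> pos"
  using bor_roots_closed unfolding pos_eq closed_asym_def by blast

lemma pos_no_zero_sum: "set xs \<subseteq> pos \<Longrightarrow> xs \<noteq> [] \<Longrightarrow> sum_list xs \<noteq> 0"
  using closed_asym_no_zero_sum[OF bor_roots_closed] unfolding pos_eq no_zero_sum_def by blast

lemma finite_pos: "finite pos"
  using finite_roots pos_roots by (meson finite_subset subsetI)

lemma borel_pos: "borel L = wspan (insert 0 pos)"
  using borel_eq unfolding pos_eq .

section \<open>The opposite nilradical and scaling of the coadjoint action\<close>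

lemma nil_minus_subspace: "subspace (nil_minus L)"
  unfolding nil_minus_def by simp

lemma nil_minus_rootvec: "\<phi> \<in> pos \<Longrightarrow> E (- \<phi>) \<in> nil_minus L"
  unfolding nil_minus_def by (rule span_base) blast

lemma nil_minus_eq: "nil_minus L = wspan (uminus ` pos)"
proof
  have neg: "- \<phi> \<in> roots L" if "\<phi> \<in> pos" for \<phi> using that roots_uminus pos_roots by blast
  show "nil_minus L \<subseteq> wspan (uminus ` pos)"
    unfolding nil_minus_def
  proof (rule span_minimal)
    show "{E (- \<phi>) |\<phi>. \<phi> \<in> pos} \<subseteq> wspan (uminus ` pos)"
      using rootvec(1)[OF neg] span_superset by fast
  qed (rule subspace_span)
  show "wspan (uminus ` pos) \<subseteq> nil_minus L"
    using rs_subset[OF nil_minus_subspace neg nil_minus_rootvec] nil_minus_subspace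
    by (intro span_minimal) auto
qed

lemma nil_minus_borel_disjoint:
  assumes "v \<in> nil_minus L" "v \<in> borel L" shows "v = 0"
proof (rule wspan_disjoint)
  show "v \<in> wspan (uminus ` pos)" "v \<in> wspan (insert 0 pos)" using assms nil_minus_eq borel_pos by auto
  show "uminus ` pos \<subseteq> dual" "insert 0 pos \<subseteq> dual" using roots_uminus pos_roots roots_dual dual_0 by auto
  show "uminus ` pos \<inter> insert 0 pos = {}" using pos_asym pos_roots roots_nonzero by auto
qed

lemma proj_minus_eqI:
  assumes "y \<in> nil_minus L" "z - y \<in> borel L" shows "proj_minus L z = y"
  unfolding proj_minus_def
proof (rule the_equality)
  fix y' assume y': "y' \<in> nil_minus L \<and> z - y' \<in> borel L"
  have b: "subspace (borel L)" using borel(1) by (simp add: subalgebra_def)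
  have "y' - y \<in> nil_minus L" using y' assms subspace_diff[OF nil_minus_subspace] by blast
  moreover have "(z - y) - (z - y') \<in> borel L"
    using y' assms subspace_diff[OF b] by blast
  then have "y' - y \<in> borel L" by simp
  ultimately show "y' = y" using nil_minus_borel_disjoint by fastforce
qed (use assms in blast)

lemma proj_minus_exists: "\<exists>y. y \<in> nil_minus L \<and> z - y \<in> borel L"
proof -
  obtain w where w: "\<And>\<phi>. w \<phi> \<in> rs \<phi>" "z = (\<Sum>\<phi>\<in>wts. w \<phi>)" using wt_decomp by blast
  let ?N = "uminus ` pos"
  have "(\<Sum>\<phi>\<in>?N. w \<phi>) \<in> nil_minus L"
    unfolding nil_minus_eq using w(1) by (intro span_sum span_base UN_I)
  moreover have "z - (\<Sum>\<phi>\<in>?N. w \<phi>) = (\<Sum>\<phi>\<in>wts - ?N. w \<phi>)"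
    unfolding w(2) using roots_uminus pos_roots finite_roots by (subst sum_diff) auto
  moreover have "\<phi> \<in> insert 0 pos" if "\<phi> \<in> wts - ?N" for \<phi>
    using that pos_total[of \<phi>] by (force simp: image_iff)
  then have "(\<Sum>\<phi>\<in>wts - ?N. w \<phi>) \<in> borel L"
    unfolding borel_pos using w(1) by (intro span_sum span_base UN_I)
  ultimately show ?thesis by metis
qed

lemma proj_minus_scale: "proj_minus L (c \<cdot> z) = c \<cdot> proj_minus L z"
proof -
  obtain y where y: "y \<in> nil_minus L" "z - y \<in> borel L" using proj_minus_exists by blast
  have "c \<cdot> (z - y) \<in> borel L" using y(2) borel(1) by (intro subspace_scale) (auto simp: subalgebra_def)
  then have "proj_minus L (c \<cdot> z) = c \<cdot> y"
    using y(1) subspace_scale[OF nil_minus_subspace] by (intro proj_minus_eqI) (auto simp: scale_right_diff_distrib)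
  then show ?thesis using proj_minus_eqI[OF y] by simp
qed

lemma proj_minus_id: "v \<in> nil_minus L \<Longrightarrow> proj_minus L v = v"
  using borel(1) subspace_0[of "borel L"] by (intro proj_minus_eqI) (auto simp: subalgebra_def)

lemma Ad_N_scale: "u \<in> Ad_N L \<Longrightarrow> u (c \<cdot> v) = c \<cdot> u v"
  by (induction u rule: Ad_N.induct) (simp_all add: exp_ad_scale)

lemma Coad_scale: "u \<in> Ad_N L \<Longrightarrow> Coad L u (c \<cdot> v) = c \<cdot> Coad L u v"
  by (simp add: Coad_def Ad_N_scale proj_minus_scale)

end

section \<open>Simple roots and the cascade\<close>

text \<open>Highest roots are defined by coefficient functions; lists suit inductions and
  \<open>no_zero_sum\<close> better.\<close>

lemma nat_combination_list:
  fixes c :: "('a \<Rightarrow> complex) \<Rightarrow> nat"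
  assumes "finite S"
  shows "\<exists>xs. set xs \<subseteq> S \<and> (\<lambda>x. \<Sum>\<theta>\<in>S. of_nat (c \<theta>) * \<theta> x) = sum_list xs"
  using assms
proof (induction S rule: finite_induct)
  case empty
  show ?case by (rule exI[of _ "[]"]) (simp add: zero_fun_def)
next
  case (insert \<phi> S)
  then obtain xs where xs: "set xs \<subseteq> S" "(\<lambda>x. \<Sum>\<theta>\<in>S. of_nat (c \<theta>) * \<theta> x) = sum_list xs" by blast
  have rep: "sum_list (replicate n \<phi>) x = of_nat n * \<phi> x" for n x
    by (induction n) (simp_all add: algebra_simps)
  have "(\<lambda>x. \<Sum>\<theta>\<in>insert \<phi> S. of_nat (c \<theta>) * \<theta> x) = sum_list (replicate (c \<phi>) \<phi> @ xs)"
    using insert(1,2) by (simp add: fun_eq_iff rep flip: xs(2))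
  then show ?case using xs(1) by (intro exI[of _ "replicate (c \<phi>) \<phi> @ xs"]) auto
qed

lemma sum_list_count:
  fixes xs :: "('a \<Rightarrow> complex) list"
  assumes "finite S" "set xs \<subseteq> S"
  shows "sum_list xs = (\<lambda>x. \<Sum>\<theta>\<in>S. of_nat (count (mset xs) \<theta>) * \<theta> x)"
  using assms(2)
proof (induction xs)
  case (Cons \<phi> xs)
  show ?case
  proof
    fix x
    have "(\<Sum>\<theta>\<in>S. of_nat (count (mset (\<phi> # xs)) \<theta>) * \<theta> x)
      = (\<Sum>\<theta>\<in>S. (if \<theta> = \<phi> then \<phi> x else 0) + of_nat (count (mset xs) \<theta>) * \<theta> x)"
      by (rule sum.cong) (auto simp: algebra_simps)
    also have "\<dots> = \<phi> x + sum_list xs x"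
      using Cons assms(1) by (simp add: sum.distrib sum.delta)
    finally show "sum_list (\<phi> # xs) x = (\<Sum>\<theta>\<in>S. of_nat (count (mset (\<phi> # xs)) \<theta>) * \<theta> x)" by simp
  qed
qed (simp add: zero_fun_def)

context triangular
begin

section \<open>Expansion in simple roots\<close>

abbreviation (input) "simp_rts \<equiv> simple_roots L"

lemma simple_roots_iff: "\<alpha> \<in> simp_rts \<longleftrightarrow> \<alpha> \<in> pos \<and> \<not> (\<exists>\<phi>\<in>pos. \<exists>\<psi>\<in>pos. \<alpha> = \<phi> + \<psi>)"
  by (simp add: simple_roots_def plus_fun_def)

lemma simple_pos: "simp_rts \<subseteq> pos"
  by (auto simp: simple_roots_iff)

text \<open>Otherwise \<open>\<alpha> - \<beta>\<close> is a root, and according to its sign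
  \<alpha> or \<beta> decomposes.\<close>

lemma simple_ip_nonpos:
  assumes "\<alpha> \<in> simp_rts" "\<beta> \<in> simp_rts" "\<alpha> \<noteq> \<beta>" shows "Re (ip \<alpha> \<beta>) \<le> 0"
proof (rule ccontr)
  assume c: "\<not> Re (ip \<alpha> \<beta>) \<le> 0"
  have r: "\<alpha> \<in> roots L" "\<beta> \<in> roots L" using assms simple_pos pos_roots by blast+
  have "Re (ip \<alpha> (- \<beta>)) < 0" using c ip_uminus(2)[OF rational_root rational_root] r by simp
  moreover have "\<alpha> + - \<beta> \<noteq> 0" using assms(3) by simp
  ultimately have root: "\<alpha> - \<beta> \<in> roots L" using neg_ip_sum_root[OF r(1) roots_uminus[OF r(2)]] by simp
  then show False using pos_total[OF root]
  proof (elim disjE)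
    assume "\<alpha> - \<beta> \<in> pos"
    moreover have "\<alpha> = (\<alpha> - \<beta>) + \<beta>" by simp
    ultimately show False using assms simple_roots_iff by blast
  next
    assume "- (\<alpha> - \<beta>) \<in> pos"
    moreover have "\<beta> = - (\<alpha> - \<beta>) + \<alpha>" by simp
    ultimately show False using assms simple_roots_iff by blast
  qed
qed

text \<open>Common members are cancelled by induction. For disjoint lists the product of the common
  sum with itself is a sum of nonpositive terms, so the sum vanishes and pointedness makes both
  lists empty.\<close>

lemma simple_lists_unique:
  assumes "set xs \<subseteq> simp_rts" "set ys \<subseteq> simp_rts" "sum_list xs = sum_list ys"
  shows "mset xs = mset ys"
  using assms
proof (induction "length xs" arbitrary: xs ys rule: less_induct)
  case less
  show ?case
  proof (cases "set xs \<inter> set ys = {}")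
    case False
    then obtain \<alpha> where \<alpha>: "\<alpha> \<in> set xs" "\<alpha> \<in> set ys" by blast
    have "sum_list xs = \<alpha> + sum_list (remove1 \<alpha> xs)" "sum_list ys = \<alpha> + sum_list (remove1 \<alpha> ys)"
      using sum_list_map_remove1[OF \<alpha>(1), of "\<lambda>x. x"] sum_list_map_remove1[OF \<alpha>(2), of "\<lambda>x. x"] by simp_all
    then have "sum_list (remove1 \<alpha> xs) = sum_list (remove1 \<alpha> ys)" using less.prems(3) by simp
    moreover have "length (remove1 \<alpha> xs) < length xs"
      using \<alpha>(1) length_pos_if_in_set[OF \<alpha>(1)] by (simp add: length_remove1)
    moreover have "set (remove1 \<alpha> xs) \<subseteq> simp_rts" "set (remove1 \<alpha> ys) \<subseteq> simp_rts"
      using less.prems set_remove1_subset[of \<alpha> xs] set_remove1_subset[of \<alpha> ys] by auto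
    ultimately have "mset (remove1 \<alpha> xs) = mset (remove1 \<alpha> ys)" using less.hyps by blast
    then have "mset xs - {#\<alpha>#} = mset ys - {#\<alpha>#}" by simp
    then show ?thesis using \<alpha> by (metis insert_DiffM set_mset_mset)
  next
    case True
    have pos': "set xs \<subseteq> pos" "set ys \<subseteq> pos" using less.prems simple_pos by blast+
    then have r: "set xs \<subseteq> roots L" "set ys \<subseteq> roots L" using pos_roots by blast+
    have "Re (\<Sum>\<beta>\<leftarrow>zs. ip \<alpha> \<beta>) \<le> 0" if "\<alpha> \<in> set xs" "set zs \<subseteq> set ys" for \<alpha> zs
      using that(2)
    proof (induction zs)
      case (Cons \<beta> zs)
      have "\<alpha> \<noteq> \<beta>" using True that(1) Cons.prems by auto
      then have "Re (ip \<alpha> \<beta>) \<le> 0" using simple_ip_nonpos that(1) Cons.prems less.prems by auto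
      then show ?case using Cons by simp
    qed simp
    then have a: "Re (ip \<alpha> (sum_list ys)) \<le> 0" if "\<alpha> \<in> set xs" for \<alpha>
      using that ip_sum_list[OF rational_root r(2)] r(1) by fastforce
    have "Re (\<Sum>\<beta>\<leftarrow>zs. ip (sum_list ys) \<beta>) \<le> 0" if "set zs \<subseteq> set xs" for zs
      using that
    proof (induction zs)
      case (Cons \<beta> zs)
      then show ?case using a[of \<beta>] by (simp add: ip_sym)
    qed simp
    then have "Re (ip (sum_list ys) (sum_list xs)) \<le> 0"
      using ip_sum_list[OF rational_sum_list[OF r(2)] r(1)] by simp
    then have le: "Re (ip (sum_list xs) (sum_list xs)) \<le> 0" using less.prems(3) by simp
    have rat: "rational_vector (sum_list xs)" by (rule rational_sum_list[OF r(1)])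
    then have z: "\<forall>x\<in>h. sum_list xs x = 0" using ip_pos_def[OF rat] le by linarith
    have "sum_list zs \<in> dual" if "set zs \<subseteq> roots L" for zs
      using that by (induction zs) (auto simp: dual_0 dual_add roots_dual)
    then have "sum_list xs = 0"
      using dual_sep[of "sum_list xs" 0] z r(1) dual_0 by (metis zero_fun_apply)
    then have "xs = []" "ys = []" using pos_no_zero_sum pos' less.prems(3) by metis+
    then show ?thesis by simp
  qed
qed

text \<open>Symmetric sets of roots whose positive part spans a face of the cone of positive roots.\<close>

definition face :: "'g weight set \<Rightarrow> bool" where
  "face R \<longleftrightarrow> R \<subseteq> roots L \<and> (\<forall>\<phi>\<in>R. - \<phi> \<in> R) \<and>
     (\<forall>\<phi>\<in>pos. \<forall>\<psi>\<in>pos. \<phi> + \<psi> \<in> R \<longrightarrow> \<phi> \<in> R \<and> \<psi> \<in> R)"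

text \<open>The measure counts the positive roots strictly below \<phi>. Pointedness keeps \<phi>
  out of its own \<open>below\<close> set, so the count drops on passing to a summand.\<close>

lemma pos_induct [consumes 1, case_names simple sum]:
  assumes "\<phi> \<in> pos" "\<And>\<alpha>. \<alpha> \<in> simp_rts \<Longrightarrow> P \<alpha>"
    and "\<And>\<phi> \<psi>. \<phi> \<in> pos \<Longrightarrow> \<psi> \<in> pos \<Longrightarrow> \<phi> + \<psi> \<in> pos \<Longrightarrow> P \<phi> \<Longrightarrow> P \<psi> \<Longrightarrow> P (\<phi> + \<psi>)"
  shows "P \<phi>"
proof -
  define below where "below \<phi> = {\<psi>\<in>pos. \<exists>xs. xs \<noteq> [] \<and> set xs \<subseteq> pos \<and> \<phi> = \<psi> + sum_list xs}" for \<phi>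
  have below_less: "card (below \<phi>) < card (below (\<phi> + \<psi>))" if "\<phi> \<in> pos" "\<psi> \<in> pos" for \<phi> \<psi>
  proof (rule psubset_card_mono)
    show "finite (below (\<phi> + \<psi>))" using finite_pos by (simp add: below_def)
    have "\<phi> \<in> below (\<phi> + \<psi>)" using that by (auto simp: below_def intro!: exI[of _ "[\<psi>]"])
    moreover have "\<phi> \<notin> below \<phi>" using pos_no_zero_sum by (auto simp: below_def)
    moreover have "below \<phi> \<subseteq> below (\<phi> + \<psi>)"
    proof
      fix \<theta> assume "\<theta> \<in> below \<phi>"
      then obtain xs where "\<theta> \<in> pos" "set xs \<subseteq> pos" "\<phi> = \<theta> + sum_list xs" by (auto simp: below_def)
      then show "\<theta> \<in> below (\<phi> + \<psi>)" using that
        by (auto simp: below_def add.assoc intro!: exI[of _ "xs @ [\<psi>]"])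
    qed
    ultimately show "below \<phi> \<subset> below (\<phi> + \<psi>)" by blast
  qed
  show ?thesis using assms(1)
  proof (induction "card (below \<phi>)" arbitrary: \<phi> rule: less_induct)
    case less
    show ?case
    proof (cases "\<phi> \<in> simp_rts")
      case False
      then obtain \<zeta> \<psi> where s: "\<zeta> \<in> pos" "\<psi> \<in> pos" "\<phi> = \<zeta> + \<psi>" using less.prems simple_roots_iff by blast
      have "P \<zeta>" using less.hyps[of \<zeta>] below_less[of \<zeta> \<psi>] s by simp
      moreover have "P \<psi>" using less.hyps[of \<psi>] below_less[of \<psi> \<zeta>] s by (simp add: add.commute)
      ultimately show ?thesis using assms(3)[of \<zeta> \<psi>] s less.prems by simp
    qed (use assms(2) in blast)
  qed
qed

lemma simple_decomp:
  assumes "\<phi> \<in> pos" "\<phi> \<in> R" "face R"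
  shows "\<exists>xs. set xs \<subseteq> simp_rts \<inter> R \<and> \<phi> = sum_list xs"
  using assms(1,2)
proof (induction \<phi> rule: pos_induct)
  case (simple \<alpha>)
  then show ?case by (intro exI[of _ "[\<alpha>]"]) simp
next
  case (sum \<phi> \<psi>)
  then have "\<phi> + \<psi> \<in> R" by (simp add: plus_fun_def)
  then have "\<phi> \<in> R" "\<psi> \<in> R" using assms(3) sum.hyps unfolding face_def by blast+
  then obtain xs ys where "set xs \<subseteq> simp_rts \<inter> R" "\<phi> = sum_list xs" "set ys \<subseteq> simp_rts \<inter> R" "\<psi> = sum_list ys"
    using sum.IH by blast
  then show ?case by (intro exI[of _ "xs @ ys"]) (simp add: plus_fun_def)
qed

lemma face_roots: "face (roots L)"
  using roots_uminus pos_roots by (auto simp: face_def)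

lemma pos_simple_list: "\<phi> \<in> pos \<Longrightarrow> \<exists>xs. set xs \<subseteq> simp_rts \<and> \<phi> = sum_list xs"
  using simple_decomp[of \<phi> "roots L"] face_roots pos_roots by (metis Int_subset_iff)

text \<open>Every admissible coefficient function counts the members of some list, so
  \<open>simple_lists_unique\<close> settles the description operator in
  \<open>simple_coeffs\<close>.\<close>

lemma simple_support_eq:
  assumes "set xs \<subseteq> simp_rts"
  shows "simple_support L (sum_list xs) = set xs"
proof -
  have fin: "finite simp_rts" using finite_pos simple_pos by (rule finite_subset[rotated])
  have "simple_coeffs L (sum_list xs) = count (mset xs)"
    unfolding simple_coeffs_def
  proof (rule the_equality)
    show "(\<forall>\<alpha>. \<alpha> \<notin> simp_rts \<longrightarrow> count (mset xs) \<alpha> = 0) \<and>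
      sum_list xs = (\<lambda>x. \<Sum>\<alpha>\<in>simp_rts. of_nat (count (mset xs) \<alpha>) * \<alpha> x)"
      using sum_list_count[OF fin assms] assms by (auto simp: count_eq_zero_iff)
    fix n assume n: "(\<forall>\<alpha>. \<alpha> \<notin> simp_rts \<longrightarrow> n \<alpha> = 0) \<and>
      sum_list xs = (\<lambda>x. \<Sum>\<alpha>\<in>simp_rts. of_nat (n \<alpha>) * \<alpha> x)"
    have "finite {\<alpha>. n \<alpha> > 0}" by (rule finite_subset[OF _ fin]) (use n in auto)
    then have cnt: "count (Abs_multiset n) = n" by simp
    obtain ys where ys: "mset ys = Abs_multiset n" using ex_mset by blast
    have "set ys \<subseteq> simp_rts"
    proof
      fix \<alpha> assume "\<alpha> \<in> set ys"
      then have "n \<alpha> > 0" using ys cnt by (metis count_greater_zero_iff set_mset_mset)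
      then show "\<alpha> \<in> simp_rts" using n by (metis less_irrefl)
    qed
    moreover from this have "sum_list ys = sum_list xs"
      using sum_list_count[OF fin, of ys] ys cnt n by simp
    ultimately have "mset ys = mset xs" using simple_lists_unique assms by blast
    then show "n = count (mset xs)" using ys cnt by simp
  qed
  then show ?thesis using assms by (auto simp: simple_support_def)
qed

section \<open>Root sets of the algebras in the cascade\<close>

lemma roots_of_subset: "roots_of L k \<subseteq> roots L"
  by (auto simp: roots_of_def)

abbreviation (input) "supp_roots \<beta> \<equiv> roots_of L (supp_algebra L \<beta>)"
abbreviation (input) "perp_roots \<beta> \<equiv> roots_of L (perp_algebra L \<beta>)"

lemma supp_algebra_subalgebra: "subalgebra L (supp_algebra L \<phi>)"
proof -
  have "subspace (\<Inter>{k. subalgebra L k \<and> S \<subseteq> k})" for S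
    by (rule subspace_Inter) (auto simp: subalgebra_def)
  then show ?thesis by (auto simp: supp_algebra_def generated_def subalgebra_def)
qed

lemma supp_algebra_minimal:
  "subalgebra L k \<Longrightarrow> (\<And>\<alpha>. \<alpha> \<in> simple_support L \<phi> \<Longrightarrow> E \<alpha> \<in> k \<and> E (- \<alpha>) \<in> k) \<Longrightarrow> supp_algebra L \<phi> \<subseteq> k"
  unfolding supp_algebra_def generated_def by blast

lemma supp_algebra_gen:
  "\<alpha> \<in> simple_support L \<phi> \<Longrightarrow> E \<alpha> \<in> supp_algebra L \<phi> \<and> E (- \<alpha>) \<in> supp_algebra L \<phi>"
  unfolding supp_algebra_def generated_def by blast

text \<open>The roots in the lattice generated by \<open>A\<close>, with integer combinations
  written as differences of lists.\<close>

definition span_roots :: "'g weight set \<Rightarrow> 'g weight set" where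
  "span_roots A = {\<psi> \<in> roots L. \<exists>xs ys. set xs \<subseteq> A \<and> set ys \<subseteq> A \<and> \<psi> = sum_list xs - sum_list ys}"

lemma span_roots_uminus: "\<psi> \<in> span_roots A \<Longrightarrow> - \<psi> \<in> span_roots A"
proof -
  assume "\<psi> \<in> span_roots A"
  then obtain xs ys where "\<psi> \<in> roots L" "set xs \<subseteq> A" "set ys \<subseteq> A" "\<psi> = sum_list xs - sum_list ys"
    by (auto simp: span_roots_def)
  moreover from this have "- \<psi> = sum_list ys - sum_list xs" by simp
  ultimately show ?thesis unfolding span_roots_def using roots_uminus[of \<psi>] by blast
qed

text \<open>Moving \<open>ys\<close> to the other side leaves sums of simple roots on both sides,
  where the expansion is unique.\<close>

lemma span_roots_pos:
  assumes "A \<subseteq> simp_rts" "set zs \<subseteq> simp_rts" "sum_list zs \<in> span_roots A"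
  shows "set zs \<subseteq> A"
proof -
  obtain xs ys where xy: "set xs \<subseteq> A" "set ys \<subseteq> A" "sum_list zs = sum_list xs - sum_list ys"
    using assms(3) by (auto simp: span_roots_def)
  then have "sum_list (zs @ ys) = sum_list xs" by simp
  then have "mset (zs @ ys) = mset xs" using assms xy by (intro simple_lists_unique) auto
  then have "set (zs @ ys) = set xs" by (rule mset_eq_setD)
  then show ?thesis using xy by auto
qed

lemma span_roots_face: assumes "A \<subseteq> simp_rts" shows "face (span_roots A)"
proof -
  have "\<phi> \<in> span_roots A \<and> \<psi> \<in> span_roots A"
    if p: "\<phi> \<in> pos" "\<psi> \<in> pos" and sum: "\<phi> + \<psi> \<in> span_roots A" for \<phi> \<psi>
  proof -
    obtain us where u: "set us \<subseteq> simp_rts" "\<phi> = sum_list us" using pos_simple_list[OF p(1)] by blast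
    obtain vs where v: "set vs \<subseteq> simp_rts" "\<psi> = sum_list vs" using pos_simple_list[OF p(2)] by blast
    have "set (us @ vs) \<subseteq> A" using span_roots_pos[OF assms, of "us @ vs"] u v sum by simp
    moreover have "\<phi> = sum_list us - sum_list []" "\<psi> = sum_list vs - sum_list []" using u v by simp_all
    ultimately show ?thesis using p pos_roots unfolding span_roots_def
      by (metis (mono_tags, lifting) empty_subsetI le_sup_iff list.set(1) mem_Collect_eq set_append)
  qed
  moreover have "span_roots A \<subseteq> roots L" by (auto simp: span_roots_def)
  ultimately show ?thesis using span_roots_uminus unfolding face_def by blast
qed

text \<open>One inclusion builds root vectors of both signs by brackets, the support of a sum being
  the union of the supports. For the other, the spaces of the roots in \<open>span_roots\<close> and
  the Cartan subalgebra span a subalgebra containing the generators.\<close>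

lemma roots_of_supp_algebra:
  assumes "set xs \<subseteq> simp_rts" "\<beta> = sum_list xs"
  shows "supp_roots \<beta> = span_roots (set xs)"
proof
  let ?A = "set xs" and ?k = "supp_algebra L \<beta>"
  have supp: "simple_support L \<beta> = ?A" using simple_support_eq assms by simp
  note alg = supp_algebra_subalgebra[of \<beta>]
  define both where "both \<psi> \<longleftrightarrow> E \<psi> \<in> ?k \<and> E (- \<psi>) \<in> ?k" for \<psi>
  have pos_in: "set zs \<subseteq> ?A \<Longrightarrow> both \<psi>"
    if "\<psi> \<in> pos" "set zs \<subseteq> simp_rts" "\<psi> = sum_list zs" for \<psi> zs
    using that
  proof (induction \<psi> arbitrary: zs rule: pos_induct)
    case (simple \<alpha>)
    then have "mset zs = mset [\<alpha>]" by (intro simple_lists_unique) auto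
    then have "\<alpha> \<in> ?A" using simple by (metis list.set_intros(1) mset_eq_setD subsetD)
    then show ?case using supp_algebra_gen supp unfolding both_def by blast
  next
    case (sum \<phi> \<psi>)
    obtain us where u: "set us \<subseteq> simp_rts" "\<phi> = sum_list us" using pos_simple_list[OF sum.hyps(1)] by blast
    obtain vs where v: "set vs \<subseteq> simp_rts" "\<psi> = sum_list vs" using pos_simple_list[OF sum.hyps(2)] by blast
    have "\<phi> + \<psi> = sum_list zs" using sum.prems by (simp add: plus_fun_def)
    then have "mset (us @ vs) = mset zs" using u v sum.prems by (intro simple_lists_unique) auto
    then have "set (us @ vs) = set zs" by (rule mset_eq_setD)
    then have uv: "set us \<subseteq> ?A" "set vs \<subseteq> ?A" using sum.prems(1) by auto
    have k: "E \<phi> \<in> ?k" "E (- \<phi>) \<in> ?k" "E \<psi> \<in> ?k" "E (- \<psi>) \<in> ?k"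
      using sum.IH(1)[OF uv(1) u] sum.IH(2)[OF uv(2) v] unfolding both_def by blast+
    have r: "\<phi> \<in> roots L" "\<psi> \<in> roots L" "\<phi> + \<psi> \<in> roots L" using sum.hyps pos_roots by blast+
    have r': "- \<phi> + - \<psi> \<in> roots L" using roots_uminus[OF r(3)] by (simp add: add.commute)
    obtain c where c: "E (\<phi> + \<psi>) = c \<cdot> br (E \<phi>) (E \<psi>)" using br_root_multiple[OF r] by blast
    obtain d where d: "E (- \<phi> + - \<psi>) = d \<cdot> br (E (- \<phi>)) (E (- \<psi>))"
      using br_root_multiple[OF roots_uminus[OF r(1)] roots_uminus[OF r(2)] r'] by blast
    have neg: "- (\<phi> + \<psi>) = - \<phi> + - \<psi>" by simp
    have "both (\<phi> + \<psi>)"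
      unfolding both_def neg c d using k alg by (simp add: subalgebra_def subspace_scale)
    then show ?case by (simp add: plus_fun_def)
  qed
  show "span_roots ?A \<subseteq> roots_of L ?k"
  proof
    fix \<psi> assume \<psi>: "\<psi> \<in> span_roots ?A"
    then have r: "\<psi> \<in> roots L" by (simp add: span_roots_def)
    have *: "E \<theta> \<in> ?k \<and> E (- \<theta>) \<in> ?k" if t: "\<theta> \<in> pos" "\<theta> \<in> span_roots ?A" for \<theta>
    proof -
      obtain zs where z: "set zs \<subseteq> simp_rts" "\<theta> = sum_list zs"
        using pos_simple_list[OF t(1)] by blast
      then show ?thesis using pos_in[OF t(1) z] span_roots_pos[OF assms(1) z(1)] t(2) z(2) unfolding both_def by blast
    qed
    have "E \<psi> \<in> ?k"
      using pos_total[OF r] *[of \<psi>] *[of "- \<psi>"] \<psi> span_roots_uminus[OF \<psi>] by auto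
    then show "\<psi> \<in> roots_of L ?k" using r by (simp add: roots_of_def)
  qed
  show "roots_of L ?k \<subseteq> span_roots ?A"
  proof
    fix \<psi> assume "\<psi> \<in> roots_of L ?k"
    then have \<psi>: "\<psi> \<in> roots L" "E \<psi> \<in> ?k" by (auto simp: roots_of_def)
    let ?T = "span_roots ?A"
    have T: "insert 0 ?T \<subseteq> dual" using roots_dual dual_0 by (auto simp: span_roots_def)
    have lists: "\<exists>xs ys. set xs \<subseteq> ?A \<and> set ys \<subseteq> ?A \<and> \<zeta> = sum_list xs - sum_list ys" if "\<zeta> \<in> insert 0 ?T" for \<zeta>
    proof (cases "\<zeta> = 0")
      case True then show ?thesis by (intro exI[of _ "[]"]) simp
    next
      case False then show ?thesis using that by (auto simp: span_roots_def)
    qed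
    have "\<theta> + \<eta> \<in> insert 0 ?T" if t: "\<theta> \<in> insert 0 ?T" "\<eta> \<in> insert 0 ?T" "\<theta> + \<eta> \<in> wts" for \<theta> \<eta>
    proof -
      obtain xs ys xs' ys' where l: "set xs \<subseteq> ?A" "set ys \<subseteq> ?A" "\<theta> = sum_list xs - sum_list ys"
        "set xs' \<subseteq> ?A" "set ys' \<subseteq> ?A" "\<eta> = sum_list xs' - sum_list ys'"
        using lists t(1,2) by metis
      have "\<theta> + \<eta> = sum_list (xs @ xs') - sum_list (ys @ ys')" unfolding l(3,6) by simp
      moreover have "set (xs @ xs') \<subseteq> ?A" "set (ys @ ys') \<subseteq> ?A" using l by auto
      ultimately show ?thesis using t(3) unfolding span_roots_def by blast
    qed
    then have "br x y \<in> wspan (insert 0 ?T)" if "x \<in> wspan (insert 0 ?T)" "y \<in> wspan (insert 0 ?T)" for x y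
      using wspan_br[OF T T that] by blast
    then have "subalgebra L (wspan (insert 0 ?T))" by (simp add: subalgebra_def)
    moreover have "E \<alpha> \<in> wspan (insert 0 ?T) \<and> E (- \<alpha>) \<in> wspan (insert 0 ?T)" if "\<alpha> \<in> simple_support L \<beta>" for \<alpha>
    proof -
      have a: "\<alpha> \<in> ?A" using that supp by simp
      then have r: "\<alpha> \<in> roots L" using assms(1) simple_pos pos_roots by blast
      have "\<alpha> = sum_list [\<alpha>] - sum_list []" by simp
      moreover have "set [\<alpha>] \<subseteq> ?A" "set [] \<subseteq> ?A" using a by auto
      ultimately have "\<alpha> \<in> ?T" using r unfolding span_roots_def by blast
      then have "\<alpha> \<in> insert 0 ?T" "- \<alpha> \<in> insert 0 ?T" using span_roots_uminus by blast+
      then show ?thesis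
        using rootvec(1)[OF r] rootvec(1)[OF roots_uminus[OF r]] by (intro conjI span_base UN_I)
    qed
    ultimately have "?k \<subseteq> wspan (insert 0 ?T)" by (rule supp_algebra_minimal)
    then have "\<psi> \<in> insert 0 ?T" using wspan_rootvec[OF \<psi>(1) T] \<psi>(2) by blast
    then show "\<psi> \<in> ?T" using \<psi>(1) roots_nonzero by auto
  qed
qed

text \<open>The second part holds because the simple roots in the expansion of \<beta> lie in every
  face containing \<beta>, so that \<open>s\<close> contains the generators.\<close>

lemma roots_of_supp:
  assumes "\<beta> \<in> pos"
  shows "face (supp_roots \<beta>)"
    and "\<lbrakk>face R; \<beta> \<in> R; subalgebra L s; R = roots_of L s\<rbrakk> \<Longrightarrow> supp_roots \<beta> \<subseteq> R"
proof -
  obtain xs where xs: "set xs \<subseteq> simp_rts" "\<beta> = sum_list xs"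
    using pos_simple_list[OF assms] by blast
  show "face (supp_roots \<beta>)"
    unfolding roots_of_supp_algebra[OF xs] by (rule span_roots_face[OF xs(1)])
  assume R: "face R" "\<beta> \<in> R" "subalgebra L s" "R = roots_of L s"
  obtain ys where ys: "set ys \<subseteq> simp_rts \<inter> R" "\<beta> = sum_list ys"
    using simple_decomp[OF assms R(2,1)] by blast
  have "E \<alpha> \<in> s \<and> E (- \<alpha>) \<in> s" if "\<alpha> \<in> simple_support L \<beta>" for \<alpha>
  proof -
    have "\<alpha> \<in> R" using that simple_support_eq[of ys] ys by auto
    then show ?thesis using R(1,4) by (auto simp: face_def roots_of_def)
  qed
  then have "supp_algebra L \<beta> \<subseteq> s" by (rule supp_algebra_minimal[OF R(3)])
  then show "supp_roots \<beta> \<subseteq> R" unfolding R(4) roots_of_def by blast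
qed

text \<open>Everything is recovered by brackets with root vectors of \<open>m\<close>, up to nonzero
  factors: \<open>E (- \<phi>)\<close> takes \<open>E \<phi>\<close> to \<open>t \<phi>\<close> and
  \<open>t \<phi>\<close> to \<open>E (- \<phi>)\<close>, and \<open>E (- \<psi>)\<close> takes
  \<open>E (\<phi> + \<psi>)\<close> to \<open>E \<phi>\<close>.\<close>

lemma ideal_roots:
  assumes "face (roots_of L m)" "ideal_of L m s"
  shows "face (roots_of L s)" and "\<phi> \<in> roots_of L s \<Longrightarrow> t \<phi> \<in> s"
proof -
  have s: "subspace s" "s \<subseteq> m" and br: "\<And>x y. x \<in> m \<Longrightarrow> y \<in> s \<Longrightarrow> br x y \<in> s"
    using assms(2) by (auto simp: ideal_of_def)
  have sm: "roots_of L s \<subseteq> roots_of L m" using s(2) by (auto simp: roots_of_def)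
  have ts: "t \<phi> \<in> s" if \<phi>: "\<phi> \<in> roots_of L s" for \<phi>
  proof -
    have r: "\<phi> \<in> roots L" "E \<phi> \<in> s" using \<phi> by (auto simp: roots_of_def)
    have "- \<phi> \<in> roots_of L m" using sm \<phi> assms(1) by (auto simp: face_def)
    then have "br (E (- \<phi>)) (E \<phi>) \<in> s" using br r by (auto simp: roots_of_def)
    then have "br (E \<phi>) (E (- \<phi>)) \<in> s" using subspace_neg[OF s(1)] br_anti[of "E \<phi>" "E (- \<phi>)"] by simp
    then show ?thesis using br_opposite_rootvec[OF r(1)] kil_opposite_nonzero[OF r(1)] unscale[OF s(1)] by metis
  qed
  then show "\<phi> \<in> roots_of L s \<Longrightarrow> t \<phi> \<in> s" .
  have "- \<phi> \<in> roots_of L s" if \<phi>: "\<phi> \<in> roots_of L s" for \<phi>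
  proof -
    have r: "\<phi> \<in> roots L" using \<phi> by (auto simp: roots_of_def)
    have "- \<phi> \<in> roots_of L m" using sm \<phi> assms(1) by (auto simp: face_def)
    then have 1: "br (E (- \<phi>)) (t \<phi>) \<in> s" using br ts[OF \<phi>] by (auto simp: roots_of_def)
    have "br (t \<phi>) (E (- \<phi>)) = (- \<phi>) (t \<phi>) \<cdot> E (- \<phi>)"
      using rootvec(1)[OF roots_uminus[OF r]] t_in_h[OF r] unfolding rs_iff by blast
    then have "br (E (- \<phi>)) (t \<phi>) = \<phi> (t \<phi>) \<cdot> E (- \<phi>)" using br_anti[of "E (- \<phi>)" "t \<phi>"] by simp
    moreover have "\<phi> (t \<phi>) \<noteq> 0" using root_norm_pos[OF r] by auto
    ultimately have "E (- \<phi>) \<in> s" using unscale[OF s(1)] 1 by metis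
    then show ?thesis using roots_uminus[OF r] by (simp add: roots_of_def)
  qed
  moreover have "\<phi> \<in> roots_of L s" if p: "\<phi> \<in> pos" "\<psi> \<in> pos" and sum: "\<phi> + \<psi> \<in> roots_of L s" for \<phi> \<psi>
  proof -
    have "\<psi> \<in> roots_of L m" using sm assms(1) that unfolding face_def by blast
    then have "- \<psi> \<in> roots_of L m" using assms(1) by (auto simp: face_def)
    then have 1: "br (E (- \<psi>)) (E (\<phi> + \<psi>)) \<in> s" using br sum by (auto simp: roots_of_def)
    have eq: "- \<psi> + (\<phi> + \<psi>) = \<phi>" by simp
    have "- \<psi> \<in> roots L" "\<phi> + \<psi> \<in> roots L" "- \<psi> + (\<phi> + \<psi>) \<in> roots L"
      unfolding eq using p pos_roots roots_uminus sum roots_of_subset by blast+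
    then obtain c where "E (- \<psi> + (\<phi> + \<psi>)) = c \<cdot> br (E (- \<psi>)) (E (\<phi> + \<psi>))" using br_root_multiple by blast
    then have "E \<phi> \<in> s" using 1 s(1) subspace_scale unfolding eq by metis
    then show ?thesis using p pos_roots by (simp add: roots_of_def)
  qed
  ultimately show "face (roots_of L s)"
    unfolding face_def using roots_of_subset add.commute by metis
qed

section \<open>Highest roots, orthogonal algebras and chains\<close>

lemma highest_root_pos: "highest_root L s \<beta> \<Longrightarrow> \<beta> \<in> roots_of L s \<and> \<beta> \<in> pos"
  by (simp add: highest_root_def)

lemma highest_root_diff:
  assumes "highest_root L s \<beta>" "\<psi> \<in> roots_of L s"
  obtains xs where "set xs \<subseteq> pos" "\<beta> - \<psi> = sum_list xs"
proof -
  obtain c :: "'g weight \<Rightarrow> nat" where "\<beta> - \<psi> = (\<lambda>x. \<Sum>\<theta>\<in>roots_of L s \<inter> pos. of_nat (c \<theta>) * \<theta> x)"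
    using assms by (auto simp: highest_root_def)
  then show ?thesis using nat_combination_list[of "roots_of L s \<inter> pos" c] finite_pos that by auto
qed

lemma highest_root_unique:
  assumes "highest_root L s \<beta>" "highest_root L s \<gamma>" shows "\<beta> = \<gamma>"
proof -
  obtain xs where xs: "set xs \<subseteq> pos" "\<beta> - \<gamma> = sum_list xs"
    using highest_root_diff assms highest_root_pos by metis
  obtain ys where ys: "set ys \<subseteq> pos" "\<gamma> - \<beta> = sum_list ys"
    using highest_root_diff assms highest_root_pos by metis
  have "sum_list (xs @ ys) = 0" by (simp flip: xs(2) ys(2))
  then have "xs @ ys = []" using pos_no_zero_sum[of "xs @ ys"] xs ys by auto
  then show ?thesis using xs by simp
qed

text \<open>With a negative product \<open>\<phi> + \<beta>\<close> would be a root of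
  \<open>s\<close> above \<beta>.\<close>

lemma highest_root_dominant:
  assumes "highest_root L s \<beta>" "subalgebra L s" "\<phi> \<in> roots_of L s" "\<phi> \<in> pos"
  shows "Re (ip \<phi> \<beta>) \<ge> 0"
proof (rule ccontr)
  assume neg: "\<not> Re (ip \<phi> \<beta>) \<ge> 0"
  have \<beta>: "\<beta> \<in> roots_of L s" "\<beta> \<in> pos" using highest_root_pos[OF assms(1)] by auto
  have r: "\<phi> \<in> roots L" "\<beta> \<in> roots L" using assms(4) \<beta>(2) pos_roots by auto
  have "\<phi> + \<beta> \<noteq> 0" using pos_no_zero_sum[of "[\<phi>, \<beta>]"] assms(4) \<beta>(2) by simp
  then have sum: "\<phi> + \<beta> \<in> roots L" using neg_ip_sum_root[OF r] neg by simp
  obtain c where "E (\<phi> + \<beta>) = c \<cdot> br (E \<phi>) (E \<beta>)" using br_root_multiple[OF r sum] by blast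
  then have "E (\<phi> + \<beta>) \<in> s" using assms(2,3) \<beta>(1) by (auto simp: roots_of_def subalgebra_def subspace_scale)
  then have "\<phi> + \<beta> \<in> roots_of L s" using sum by (simp add: roots_of_def)
  then obtain xs where xs: "set xs \<subseteq> pos" "\<beta> - (\<phi> + \<beta>) = sum_list xs" using highest_root_diff[OF assms(1)] by metis
  have "sum_list (\<phi> # xs) = 0" by (simp flip: xs(2))
  then show False using pos_no_zero_sum[of "\<phi> # xs"] xs assms(4) by auto
qed

lemma roots_of_perp_algebra:
  assumes "\<beta> \<in> pos"
  shows "perp_roots \<beta> = {\<phi> \<in> supp_roots \<beta>. ip \<phi> \<beta> = 0}" (is "_ = ?Q")
proof
  have Q: "?Q \<subseteq> roots L" using roots_of_subset by blast
  have f: "face (supp_roots \<beta>)" by (rule roots_of_supp(1)[OF assms])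
  have neg: "- \<phi> \<in> ?Q" if "\<phi> \<in> ?Q" for \<phi>
    using that f ip_uminus(1)[of \<phi> \<beta>] rational_root Q assms pos_roots by (auto simp: face_def)
  show "?Q \<subseteq> perp_roots \<beta>"
  proof
    fix \<phi> assume \<phi>: "\<phi> \<in> ?Q"
    then have "E \<phi> \<in> perp_algebra L \<beta>" unfolding perp_algebra_def by (intro span_base) blast
    then show "\<phi> \<in> perp_roots \<beta>" using \<phi> Q by (auto simp: roots_of_def)
  qed
  show "perp_roots \<beta> \<subseteq> ?Q"
  proof
    fix \<psi> assume "\<psi> \<in> perp_roots \<beta>"
    then have \<psi>: "\<psi> \<in> roots L" "E \<psi> \<in> perp_algebra L \<beta>" by (auto simp: roots_of_def)
    let ?U = "\<Union>\<theta>\<in>insert 0 ?Q. rs \<theta>"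
    have gen: "E \<phi> \<in> ?U \<and> E (- \<phi>) \<in> ?U \<and> br (E \<phi>) (E (- \<phi>)) \<in> ?U" if \<phi>: "\<phi> \<in> ?Q" for \<phi>
    proof -
      have r: "\<phi> \<in> roots L" using \<phi> Q by blast
      have e: "E \<phi> \<in> rs \<phi>" "E (- \<phi>) \<in> rs (- \<phi>)" using rootvec(1) r roots_uminus by blast+
      then have "br (E \<phi>) (E (- \<phi>)) \<in> rs 0" using br_opposite rs_0 by blast
      then show ?thesis using e \<phi> neg[OF \<phi>] by blast
    qed
    have "perp_algebra L \<beta> \<subseteq> span ?U"
      unfolding perp_algebra_def using gen by (intro span_mono) blast
    moreover have "insert 0 ?Q \<subseteq> dual" using Q roots_dual dual_0 by blast
    ultimately have "\<psi> \<in> insert 0 ?Q" using wspan_rootvec[OF \<psi>(1)] \<psi>(2) by blast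
    then show "\<psi> \<in> ?Q" using \<psi>(1) roots_nonzero by auto
  qed
qed

text \<open>If \<open>\<phi> + \<psi>\<close> is orthogonal to \<beta>, the products of \<phi> and
  \<psi> with \<beta> are nonnegative by dominance and add up to 0, so both vanish.\<close>

lemma perp_algebra_roots:
  assumes "face (roots_of L s)" "subalgebra L s" "highest_root L s \<beta>"
  shows "face (perp_roots \<beta>)" and "perp_roots \<beta> \<subseteq> roots_of L s"
proof -
  have \<beta>: "\<beta> \<in> roots_of L s" "\<beta> \<in> pos" "\<beta> \<in> roots L" using highest_root_pos[OF assms(3)] pos_roots by auto
  note perp = roots_of_perp_algebra[OF \<beta>(2)]
  note f = roots_of_supp(1)[OF \<beta>(2)]
  have sub: "supp_roots \<beta> \<subseteq> roots_of L s"
    using roots_of_supp(2)[OF \<beta>(2) assms(1) \<beta>(1) assms(2) refl] .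
  then show "perp_roots \<beta> \<subseteq> roots_of L s" unfolding perp by blast
  have rat: "rational_vector \<beta>" by (rule rational_root[OF \<beta>(3)])
  have rt: "rational_vector \<phi>" if "\<phi> \<in> pos" for \<phi> using that pos_roots rational_root by blast
  have "- \<phi> \<in> perp_roots \<beta>" if "\<phi> \<in> perp_roots \<beta>" for \<phi>
    using that f ip_uminus(1)[OF rational_root rat, of \<phi>] roots_of_subset unfolding perp face_def by auto
  moreover have "\<phi> \<in> perp_roots \<beta>"
    if p: "\<phi> \<in> pos" "\<psi> \<in> pos" and sum: "\<phi> + \<psi> \<in> perp_roots \<beta>" for \<phi> \<psi>
  proof -
    have in_supp: "\<phi> \<in> supp_roots \<beta>" "\<psi> \<in> supp_roots \<beta>"
      using f p sum unfolding perp face_def by blast+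
    then have "Re (ip \<phi> \<beta>) \<ge> 0" "Re (ip \<psi> \<beta>) \<ge> 0"
      using highest_root_dominant[OF assms(3,2)] sub p by blast+
    moreover have "ip \<phi> \<beta> + ip \<psi> \<beta> = 0" using sum ip_add(1)[OF rt[OF p(1)] rt[OF p(2)] rat] unfolding perp by simp
    then have "Re (ip \<phi> \<beta>) + Re (ip \<psi> \<beta>) = 0" by (metis plus_complex.sel(1) zero_complex.sel(1))
    ultimately have "Re (ip \<phi> \<beta>) = 0" by linarith
    then have "ip \<phi> \<beta> = 0" using ip_rational_real[OF rt[OF p(1)] rat] by (metis complex_is_Real_iff complex_eqI zero_complex.sel)
    then show ?thesis unfolding perp using in_supp by blast
  qed
  ultimately show "face (perp_roots \<beta>)"
    unfolding face_def using roots_of_subset add.commute by metis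
qed

text \<open>Chains read from the front, with the starting algebra as a parameter, so that two chains
  can be followed together up to the point where they part.\<close>

inductive casc :: "'g set \<Rightarrow> 'g weight \<Rightarrow> bool" where
  cascI: "simple_component L m s \<Longrightarrow> highest_root L s \<beta> \<Longrightarrow> \<gamma> = \<beta> \<or> casc (perp_algebra L \<beta>) \<gamma> \<Longrightarrow> casc m \<gamma>"

lemma casc_chain:
  assumes "bs \<noteq> []" "\<exists>s. simple_component L m s \<and> highest_root L s (bs ! 0)"
    and "\<forall>j. Suc j < length bs \<longrightarrow>
        (\<exists>s. simple_component L (perp_algebra L (bs ! j)) s \<and> highest_root L s (bs ! Suc j))"
    and "\<beta> \<in> set bs"
  shows "casc m \<beta>"
  using assms
proof (induction bs arbitrary: m)
  case (Cons b bs)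
  obtain s where s: "simple_component L m s" "highest_root L s b" using Cons.prems(2) by auto
  show ?case
  proof (cases "\<beta> = b")
    case True then show ?thesis using s cascI by blast
  next
    case False
    then have in_bs: "\<beta> \<in> set bs" using Cons.prems(4) by simp
    then have ne: "bs \<noteq> []" by auto
    have "casc (perp_algebra L b) \<beta>"
    proof (rule Cons.IH[OF ne _ _ in_bs])
      show "\<exists>s. simple_component L (perp_algebra L b) s \<and> highest_root L s (bs ! 0)"
        using Cons.prems(3)[rule_format, of 0] ne by simp
      show "\<forall>j. Suc j < length bs \<longrightarrow>
        (\<exists>s. simple_component L (perp_algebra L (bs ! j)) s \<and> highest_root L s (bs ! Suc j))"
      proof (intro allI impI)
        fix j assume "Suc j < length bs"
        then show "\<exists>s. simple_component L (perp_algebra L (bs ! j)) s \<and> highest_root L s (bs ! Suc j)"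
          using Cons.prems(3)[rule_format, of "Suc j"] by simp
      qed
    qed
    then show ?thesis using s cascI by blast
  qed
qed simp

lemma cascade_casc: "\<beta> \<in> cascade L \<Longrightarrow> casc UNIV \<beta>"
  unfolding cascade_def chain_cascade_def using casc_chain by blast

lemma component:
  assumes "simple_component L m s" shows "ideal_of L m s" "subalgebra L s"
  using assms by (auto simp: simple_component_def simple_subalgebra_def)

lemma casc_root: "casc m \<gamma> \<Longrightarrow> face (roots_of L m) \<Longrightarrow> \<gamma> \<in> roots_of L m \<and> \<gamma> \<in> pos"
proof (induction rule: casc.induct)
  case (cascI m s \<beta> \<gamma>)
  note c = component[OF cascI.hyps(1)]
  have f: "face (roots_of L s)" by (rule ideal_roots(1)[OF cascI.prems c(1)])
  note p = perp_algebra_roots[OF f c(2) cascI.hyps(2)]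
  have "roots_of L s \<subseteq> roots_of L m" using c(1) by (auto simp: roots_of_def ideal_of_def)
  then show ?case using cascI.IH p highest_root_pos[OF cascI.hyps(2)] by blast
qed

text \<open>Distinct simple ideals meet in 0, and \<open>br (t \<phi>) (E \<psi>)\<close>, which is
  \<open>ip \<phi> \<psi>\<close> times \<open>E \<psi>\<close>, lies in both.\<close>

lemma components_orthogonal:
  assumes "simple_component L m s" "simple_component L m s'" "s \<noteq> s'" "face (roots_of L m)"
    and "\<phi> \<in> roots_of L s" "\<psi> \<in> roots_of L s'"
  shows "ip \<phi> \<psi> = 0"
proof -
  have id: "ideal_of L m s" "ideal_of L m s'" using assms component by auto
  have "ideal_of L s (s \<inter> s')" "ideal_of L s' (s \<inter> s')"
    using id by (auto simp: ideal_of_def intro: subspace_inter)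
  then have "s \<inter> s' = {0}"
    using assms(1-3) unfolding simple_component_def simple_subalgebra_def by blast
  moreover have "br (t \<phi>) (E \<psi>) \<in> s \<inter> s'"
  proof
    have ts: "t \<phi> \<in> s" by (rule ideal_roots(2)[OF assms(4) id(1) assms(5)])
    have es: "E \<psi> \<in> s'" using assms(6) by (simp add: roots_of_def)
    show "br (t \<phi>) (E \<psi>) \<in> s'" using ts es id by (auto simp: ideal_of_def)
    have "br (E \<psi>) (t \<phi>) \<in> s" using ts es id by (auto simp: ideal_of_def)
    then show "br (t \<phi>) (E \<psi>) \<in> s"
      using id(1) br_anti[of "t \<phi>" "E \<psi>"] by (simp add: ideal_of_def subspace_neg)
  qed
  ultimately have "br (t \<phi>) (E \<psi>) = 0" by blast
  moreover have r: "\<phi> \<in> roots L" "\<psi> \<in> roots L" using assms(5,6) by (auto simp: roots_of_def)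
  moreover have "br (t \<phi>) (E \<psi>) = \<psi> (t \<phi>) \<cdot> E \<psi>" using rootvec(1)[OF r(2)] t_in_h[OF r(1)] unfolding rs_iff by blast
  ultimately show ?thesis using rootvec(2) ip_roots by simp
qed

lemma casc_step:
  assumes "face (roots_of L m)" "simple_component L m s" "highest_root L s \<beta>"
    and "\<gamma> = \<beta> \<or> casc (perp_algebra L \<beta>) \<gamma>"
  shows "face (perp_roots \<beta>)" "\<gamma> \<in> roots_of L s" "\<gamma> = \<beta> \<or> ip \<gamma> \<beta> = 0"
proof -
  note c = component[OF assms(2)]
  have f: "face (roots_of L s)" by (rule ideal_roots(1)[OF assms(1) c(1)])
  note p = perp_algebra_roots[OF f c(2) assms(3)]
  have b: "\<beta> \<in> roots_of L s" "\<beta> \<in> pos" using highest_root_pos[OF assms(3)] by auto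
  show "face (perp_roots \<beta>)" by (rule p(1))
  show "\<gamma> \<in> roots_of L s" using assms(4) b(1) casc_root[OF _ p(1)] p(2) by blast
  show "\<gamma> = \<beta> \<or> ip \<gamma> \<beta> = 0" using assms(4) casc_root[OF _ p(1)] roots_of_perp_algebra[OF b(2)] by blast
qed

text \<open>Chains beginning in different components stay in orthogonal root sets. In the same
  component the heads coincide by uniqueness of the highest root; then one of the two roots is the
  head, orthogonal to all later ones, or both lie in the remaining chains.\<close>

lemma casc_orthogonal:
  assumes "casc m \<gamma>" "casc m \<delta>" "face (roots_of L m)"
  shows "\<gamma> = \<delta> \<or> ip \<gamma> \<delta> = 0"
  using assms
proof (induction arbitrary: \<delta> rule: casc.induct)
  case (cascI m s \<beta> \<gamma>)
  have g: "\<gamma> = \<beta> \<or> casc (perp_algebra L \<beta>) \<gamma>" using cascI.IH by blast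
  note \<gamma> = casc_step[OF cascI.prems(2) cascI.hyps g]
  obtain s' \<beta>' where s': "simple_component L m s'" "highest_root L s' \<beta>'" "\<delta> = \<beta>' \<or> casc (perp_algebra L \<beta>') \<delta>"
    using cascI.prems(1) by (auto elim: casc.cases)
  note \<delta> = casc_step[OF cascI.prems(2) s']
  show ?case
  proof (cases "s = s'")
    case True
    then have "\<beta>' = \<beta>" using highest_root_unique cascI.hyps(2) s'(2) by blast
    then show ?thesis using cascI.IH \<gamma>(1,3) \<delta>(3) s'(3) ip_sym by metis
  next
    case False
    then show ?thesis
      using components_orthogonal[OF cascI.hyps(1) s'(1) _ cascI.prems(2)] \<gamma>(2) \<delta>(2) by blast
  qed
qed

lemma roots_of_UNIV: "roots_of L UNIV = roots L"
  by (simp add: roots_of_def)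

lemma cascade_pos: "\<beta> \<in> cascade L \<Longrightarrow> \<beta> \<in> pos"
  using casc_root cascade_casc roots_of_UNIV face_roots by metis

lemma cascade_orthogonal: "\<beta> \<in> cascade L \<Longrightarrow> \<gamma> \<in> cascade L \<Longrightarrow> \<beta> \<noteq> \<gamma> \<Longrightarrow> ip \<beta> \<gamma> = 0"
  using casc_orthogonal cascade_casc roots_of_UNIV face_roots by metis

end

section \<open>Weight vectors on the orbit\<close>

lemma poly_zero_off_0:
  fixes p :: "complex poly"
  assumes "\<And>z. z \<noteq> 0 \<Longrightarrow> poly p z = 0" shows "p = 0"
proof (rule ccontr)
  assume "p \<noteq> 0"
  then have "finite {z. poly p z = 0}" by (rule poly_roots_finite)
  moreover have "UNIV - {0} \<subseteq> {z. poly p z = 0}" using assms by auto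
  ultimately have "finite (UNIV - {0} :: complex set)" by (rule finite_subset[rotated])
  then show False by (simp add: infinite_UNIV_char_0)
qed

context triangular
begin

section \<open>The torus in the orbit\<close>

abbreviation (input) "C \<equiv> cascade L"

lemma finite_cascade: "finite C"
  using cascade_pos finite_pos by (meson finite_subset subsetI)

lemma cascade_roots: "\<beta> \<in> C \<Longrightarrow> \<beta> \<in> roots L"
  using cascade_pos pos_roots by blast

lemma cascade_eval:
  assumes "\<beta> \<in> C" "\<gamma> \<in> C"
  shows "\<gamma> (t \<beta>) = (if \<gamma> = \<beta> then ip \<beta> \<beta> else 0)"
  using assms cascade_orthogonal ip_roots cascade_roots by auto

lemma cascade_ip_nonzero: "\<beta> \<in> C \<Longrightarrow> ip \<beta> \<beta> \<noteq> 0"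
  using ip_root_pos[OF cascade_roots] by fastforce

lemma cascade_sum_eval:
  assumes "\<beta> \<in> C"
  shows "(\<Sum>\<gamma>\<in>C. a \<gamma> * \<gamma> (t \<beta>)) = a \<beta> * ip \<beta> \<beta>"
proof -
  have "(\<Sum>\<gamma>\<in>C. a \<gamma> * \<gamma> (t \<beta>)) = (\<Sum>\<gamma>\<in>C. if \<gamma> = \<beta> then a \<beta> * ip \<beta> \<beta> else 0)"
    by (rule sum.cong) (simp_all add: cascade_eval assms)
  also have "\<dots> = a \<beta> * ip \<beta> \<beta>" using finite_cascade assms by simp
  finally show ?thesis .
qed

lemma torus_surjective:
  assumes "\<forall>\<beta>\<in>C. s \<beta> \<noteq> 0"
  shows "\<exists>x\<in>h. \<forall>\<beta>\<in>C. exp (\<beta> x) = s \<beta>"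
proof -
  \<comment> \<open>By orthogonality \<beta> sees only the summand at \<beta>, with factor
    \<open>ip \<beta> \<beta>\<close>; dividing by it leaves the logarithm.\<close>
  define x where "x = (\<Sum>\<gamma>\<in>C. (Ln (s \<gamma>) / ip \<gamma> \<gamma>) \<cdot> t \<gamma>)"
  have xh: "x \<in> h" unfolding x_def
    by (intro subspace_sum[OF h_subspace] subspace_scale[OF h_subspace] t_in_h cascade_roots)
  have "exp (\<beta> x) = s \<beta>" if \<beta>: "\<beta> \<in> C" for \<beta>
  proof -
    have tb: "t \<beta> \<in> h" using \<beta> t_in_h cascade_roots by blast
    have "\<beta> x = kil (t \<beta>) x" using represents_root[OF cascade_roots[OF \<beta>]] xh by (simp add: represents_def)
    also have "\<dots> = (\<Sum>\<gamma>\<in>C. Ln (s \<gamma>) / ip \<gamma> \<gamma> * kil (t \<beta>) (t \<gamma>))" by (simp add: x_def kil_simps)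
    also have "\<dots> = (\<Sum>\<gamma>\<in>C. Ln (s \<gamma>) / ip \<gamma> \<gamma> * \<gamma> (t \<beta>))"
    proof (rule sum.cong[OF refl])
      fix \<gamma> assume "\<gamma> \<in> C"
      then have "kil (t \<gamma>) (t \<beta>) = \<gamma> (t \<beta>)"
        using represents_root[OF cascade_roots] tb by (simp add: represents_def)
      then show "Ln (s \<gamma>) / ip \<gamma> \<gamma> * kil (t \<beta>) (t \<gamma>) = Ln (s \<gamma>) / ip \<gamma> \<gamma> * \<gamma> (t \<beta>)" by (simp add: kil_sym)
    qed
    also have "\<dots> = Ln (s \<beta>)" unfolding cascade_sum_eval[OF \<beta>] using cascade_ip_nonzero[OF \<beta>] by simp
    finally show ?thesis using assms \<beta> by simp
  qed
  then show ?thesis using xh by blast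
qed

lemma r_elem_nil_minus: "r_elem L s \<in> nil_minus L"
  unfolding r_elem_def
proof (rule subspace_sum[OF nil_minus_subspace])
  fix \<beta> assume "\<beta> \<in> C"
  then have "E (- \<beta>) \<in> nil_minus L"
    using nil_minus_rootvec cascade_pos by blast
  then show "s \<beta> \<cdot> E (- \<beta>) \<in> nil_minus L" by (rule subspace_scale[OF nil_minus_subspace])
qed

lemma r_elem_scale: "c \<cdot> r_elem L s = r_elem L (\<lambda>\<beta>. c * s \<beta>)"
  by (simp add: r_elem_def scale_sum_right)

lemma r_elem_orbit:
  assumes "\<forall>\<beta>\<in>C. s \<beta> \<noteq> 0" shows "r_elem L s \<in> orbit_X L"
proof -
  have "Coad L id (r_elem L s) = r_elem L s" by (simp add: Coad_def proj_minus_id r_elem_nil_minus)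
  moreover have "r_elem L s \<in> r_minus_times L" using assms by (auto simp: r_minus_times_def)
  ultimately show ?thesis using Ad_N_id[of L] unfolding orbit_X_def by (metis (mono_tags, lifting) mem_Collect_eq)
qed

lemma orbitE:
  assumes "v \<in> orbit_X L"
  obtains u s where "u \<in> Ad_N L" "\<forall>\<beta>\<in>C. s \<beta> \<noteq> 0" "v = Coad L u (r_elem L s)"
  using assms by (auto simp: orbit_X_def r_minus_times_def)

lemma orbit_scale:
  assumes "v \<in> orbit_X L" "c \<noteq> 0" shows "c \<cdot> v \<in> orbit_X L"
proof -
  obtain u s where u: "u \<in> Ad_N L" "\<forall>\<beta>\<in>C. s \<beta> \<noteq> 0" "v = Coad L u (r_elem L s)" using orbitE[OF assms(1)] by blast
  have "c \<cdot> v = Coad L u (r_elem L (\<lambda>\<beta>. c * s \<beta>))" using u by (simp add: Coad_scale flip: r_elem_scale)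
  moreover have "r_elem L (\<lambda>\<beta>. c * s \<beta>) \<in> r_minus_times L" using u(2) assms(2) by (auto simp: r_minus_times_def)
  ultimately show ?thesis using u(1) unfolding orbit_X_def by blast
qed

text \<open>Two signs cancel: \<open>- x\<close> acts on vectors of weight \<open>- \<beta>\<close>,
  so the eigenvalue is \<beta>(x).\<close>

lemma exp_ad_r_elem:
  assumes "x \<in> h"
  shows "exp_ad L (- x) (r_elem L s) = r_elem L (\<lambda>\<beta>. exp (\<beta> x) * s \<beta>)"
proof -
  have "br (- x) (s \<beta> \<cdot> E (- \<beta>)) = \<beta> x \<cdot> (s \<beta> \<cdot> E (- \<beta>))" if "\<beta> \<in> C" for \<beta>
  proof -
    have "E (- \<beta>) \<in> rs (- \<beta>)" using that rootvec(1) roots_uminus cascade_roots by blast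
    then have "br x (E (- \<beta>)) = (- \<beta>) x \<cdot> E (- \<beta>)" using assms unfolding rs_iff by blast
    then show ?thesis by (simp add: br_simps mult.commute)
  qed
  then have "exp_ad L (- x) (\<Sum>\<beta>\<in>C. s \<beta> \<cdot> E (- \<beta>)) = (\<Sum>\<beta>\<in>C. exp (\<beta> x) \<cdot> (s \<beta> \<cdot> E (- \<beta>)))"
    by (rule exp_ad_eigen)
  then show ?thesis by (simp add: r_elem_def)
qed

section \<open>Polynomial functions on lines and under scaling\<close>

lemma Sym_n_line:
  assumes "p \<in> Sym_n L" shows "\<exists>P. \<forall>z. p (v + z \<cdot> w) = poly P z"
  using assms
proof (induction p rule: Sym_n.induct)
  case (Sym_const c)
  show ?case by (rule exI[of _ "[:c:]"]) simp
next
  case (Sym_elem y)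
  show ?case by (rule exI[of _ "[:kil y v, kil y w:]"]) (simp add: kil_simps)
next
  case (Sym_add p q)
  then obtain P Q where "\<forall>z. p (v + z \<cdot> w) = poly P z" "\<forall>z. q (v + z \<cdot> w) = poly Q z" by blast
  then show ?case by (intro exI[of _ "P + Q"]) simp
next
  case (Sym_mult p q)
  then obtain P Q where "\<forall>z. p (v + z \<cdot> w) = poly P z" "\<forall>z. q (v + z \<cdot> w) = poly Q z" by blast
  then show ?case by (intro exI[of _ "P * Q"]) simp
qed

lemma Sym_n_sum: "finite A \<Longrightarrow> (\<And>a. a \<in> A \<Longrightarrow> f a \<in> Sym_n L) \<Longrightarrow> (\<lambda>v. \<Sum>a\<in>A. f a v) \<in> Sym_n L"
proof (induction A rule: finite_induct)
  case empty show ?case using Sym_const[of 0 L] by simp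
next
  case (insert a A) then show ?case using Sym_add[of "f a" L "\<lambda>v. \<Sum>a\<in>A. f a v"] by simp
qed

lemma Sym_n_homogeneous_components:
  assumes "p \<in> Sym_n L"
  shows "\<exists>N q. (\<forall>i. q i \<in> Sym_n L) \<and> (\<forall>i c v. q i (c \<cdot> v) = c ^ i * q i v) \<and> (\<forall>v. p v = (\<Sum>i\<le>N. q i v))"
proof -
  \<comment> \<open>The induction also records that components above \<open>N\<close> vanish, so
    that sums of different lengths can be padded to a common one.\<close>
  have "\<exists>N q. (\<forall>i. q i \<in> Sym_n L) \<and> (\<forall>i c v. q i (c \<cdot> v) = c ^ i * q i v) \<and>
    (\<forall>i>N. \<forall>v. q i v = 0) \<and> (\<forall>v. p v = (\<Sum>i\<le>N. q i v))"
    using assms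
  proof (induction p rule: Sym_n.induct)
    case (Sym_const c)
    show ?case
      by (rule exI[of _ 0], rule exI[of _ "\<lambda>i _. if i = 0 then c else 0"])
        (auto intro: Sym_n.Sym_const)
  next
    case (Sym_elem y)
    have "(\<lambda>v. if i = 1 then kil y v else 0) \<in> Sym_n L" for i :: nat
      using Sym_n.Sym_elem[OF Sym_elem] Sym_n.Sym_const[of 0 L] by (cases "i = 1") simp_all
    then show ?case
      by (intro exI[of _ 1] exI[of _ "\<lambda>i v. if i = 1 then kil y v else 0"]) (auto simp: kil_simps)
  next
    case (Sym_add p q)
    then obtain N a M b where a: "\<forall>i. a i \<in> Sym_n L" "\<forall>i c v. a i (c \<cdot> v) = c ^ i * a i v"
        "\<forall>i>N. \<forall>v. a i v = 0" "\<forall>v. p v = (\<Sum>i\<le>N. a i v)"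
      and b: "\<forall>i. b i \<in> Sym_n L" "\<forall>i c v. b i (c \<cdot> v) = c ^ i * b i v"
        "\<forall>i>M. \<forall>v. b i v = 0" "\<forall>v. q v = (\<Sum>i\<le>M. b i v)" by blast
    have "p v + q v = (\<Sum>i\<le>max N M. a i v + b i v)" for v
    proof -
      have "(\<Sum>i\<le>N. a i v) = (\<Sum>i\<le>max N M. a i v)" by (rule sum.mono_neutral_left) (use a(3) in auto)
      moreover have "(\<Sum>i\<le>M. b i v) = (\<Sum>i\<le>max N M. b i v)" by (rule sum.mono_neutral_left) (use b(3) in auto)
      ultimately show ?thesis using a(4) b(4) by (simp add: sum.distrib)
    qed
    moreover have "(\<lambda>v. a i v + b i v) \<in> Sym_n L" for i
      by (rule Sym_n.Sym_add) (use a(1) b(1) in auto)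
    ultimately show ?case using a(2,3) b(2,3)
      by (intro exI[of _ "max N M"] exI[of _ "\<lambda>i v. a i v + b i v"]) (auto simp: algebra_simps)
  next
    case (Sym_mult p q)
    then obtain N a M b where a: "\<forall>i. a i \<in> Sym_n L" "\<forall>i c v. a i (c \<cdot> v) = c ^ i * a i v"
        "\<forall>i>N. \<forall>v. a i v = 0" "\<forall>v. p v = (\<Sum>i\<le>N. a i v)"
      and b: "\<forall>i. b i \<in> Sym_n L" "\<forall>i c v. b i (c \<cdot> v) = c ^ i * b i v"
        "\<forall>i>M. \<forall>v. b i v = 0" "\<forall>v. q v = (\<Sum>i\<le>M. b i v)" by blast
    define S where "S = {..N} \<times> {..M}"
    have S: "finite S" by (simp add: S_def)
    define r where "r k v = (\<Sum>x\<in>{x\<in>S. fst x + snd x = k}. a (fst x) v * b (snd x) v)" for k v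
    have "p v * q v = (\<Sum>k\<le>N + M. r k v)" for v
    proof -
      have "p v * q v = (\<Sum>x\<in>S. a (fst x) v * b (snd x) v)"
        using a(4) b(4) by (simp add: S_def sum_product sum.cartesian_product case_prod_beta)
      also have "\<dots> = (\<Sum>k\<le>N + M. r k v)"
        unfolding r_def by (rule sum.group[symmetric]) (auto simp: S_def)
      finally show ?thesis .
    qed
    moreover have "r k \<in> Sym_n L" for k
      unfolding r_def by (rule Sym_n_sum) (use S a(1) b(1) in \<open>auto intro: Sym_n.Sym_mult\<close>)
    moreover have "r k (c \<cdot> v) = c ^ k * r k v" for k c v
      unfolding r_def sum_distrib_left
      by (rule sum.cong) (use a(2) b(2) in \<open>auto simp: power_add\<close>)
    moreover have "r k v = 0" if "k > N + M" for k v
      unfolding r_def by (rule sum.neutral) (use that in \<open>auto simp: S_def\<close>)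
    ultimately show ?case by blast
  qed
  then show ?thesis by blast
qed

text \<open>Root vectors of the cascade are the coordinate functions of the torus, and all other
  positive root vectors vanish on it. The normalisation makes the coordinates exactly
  \<open>s\<close>.\<close>

lemma kil_r_elem:
  assumes norm: "\<forall>\<beta>\<in>C. kil (E \<beta>) (E (- \<beta>)) = 1" and "\<phi> \<in> pos"
  shows "kil (E \<phi>) (r_elem L s) = (if \<phi> \<in> C then s \<phi> else 0)"
proof -
  have "kil (E \<phi>) (E (- \<beta>)) = (if \<beta> = \<phi> then 1 else 0)" if \<beta>: "\<beta> \<in> C" for \<beta>
  proof (cases "\<beta> = \<phi>")
    case True then show ?thesis using norm \<beta> by simp
  next
    case False
    have "kil (E \<phi>) (E (- \<beta>)) = 0"
    proof (rule kil_rs_neq)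
      show "E \<phi> \<in> rs \<phi>" "E (- \<beta>) \<in> rs (- \<beta>)"
        using rootvec(1) roots_uminus cascade_roots[OF \<beta>] pos_roots[OF assms(2)] by blast+
      show "\<phi> \<in> dual" "- \<beta> \<in> dual"
        using roots_dual roots_uminus cascade_roots[OF \<beta>] pos_roots[OF assms(2)] by blast+
      show "- \<beta> \<noteq> - \<phi>" using False by (metis minus_minus)
    qed
    then show ?thesis using False by simp
  qed
  then have "kil (E \<phi>) (r_elem L s) = (\<Sum>\<beta>\<in>C. if \<beta> = \<phi> then s \<phi> else 0)"
    unfolding r_elem_def kil_simps by (intro sum.cong) auto
  then show ?thesis using finite_cascade by simp
qed

section \<open>A weight vector represented by a polynomial\<close>

context
  fixes f :: "'g \<Rightarrow> complex" and \<nu> :: "'g weight" and c :: "'g weight \<Rightarrow> int" and p :: "'g \<Rightarrow> complex"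
  assumes \<nu>: "\<nu> = (\<lambda>x. \<Sum>\<beta>\<in>C. of_int (c \<beta>) * \<beta> x)"
    and f: "inv_weight_vector L \<nu> f"
    and p: "p \<in> Sym_n L" "\<forall>v\<in>orbit_X L. f v = p v"
begin

abbreviation (input) "one_r \<equiv> r_elem L (\<lambda>_. 1)"

lemma weight_vector_on_torus:
  assumes "\<forall>\<beta>\<in>C. s \<beta> \<noteq> 0"
  shows "f (r_elem L s) = f one_r * (\<Prod>\<beta>\<in>C. s \<beta> powi c \<beta>)"
proof -
  obtain x where x: "x \<in> h" "\<forall>\<beta>\<in>C. exp (\<beta> x) = s \<beta>" using torus_surjective[OF assms] by blast
  have "r_elem L s = r_elem L (\<lambda>\<beta>. exp (\<beta> x) * 1)"
    unfolding r_elem_def by (rule sum.cong) (use x(2) in auto)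
  then have "r_elem L s = exp_ad L (- x) one_r" unfolding exp_ad_r_elem[OF x(1)] .
  then have "f (r_elem L s) = exp (\<nu> x) * f one_r"
    using f x(1) r_elem_orbit[of "\<lambda>_. 1"] by (simp add: inv_weight_vector_def)
  also have "exp (\<nu> x) = (\<Prod>\<beta>\<in>C. exp (of_int (c \<beta>) * \<beta> x))"
    unfolding \<nu> using finite_cascade by (rule exp_sum)
  also have "\<dots> = (\<Prod>\<beta>\<in>C. s \<beta> powi c \<beta>)"
    by (rule prod.cong) (use x(2) in \<open>auto simp flip: exp_power_int\<close>)
  finally show ?thesis by (simp add: mult.commute)
qed

text \<open>Otherwise \<open>f\<close> would vanish on the torus and by invariance on all of
  X.\<close>

lemma weight_vector_one_nonzero: "f one_r \<noteq> 0"
proof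
  assume z: "f one_r = 0"
  obtain v where v: "v \<in> orbit_X L" "f v \<noteq> 0" using f by (auto simp: inv_weight_vector_def)
  obtain u s where u: "u \<in> Ad_N L" "\<forall>\<beta>\<in>C. s \<beta> \<noteq> 0" "v = Coad L u (r_elem L s)" using orbitE[OF v(1)] by blast
  have "f v = f (r_elem L s)" using f u r_elem_orbit[OF u(2)] by (simp add: inv_weight_vector_def)
  then show False using v(2) z weight_vector_on_torus[OF u(2)] by simp
qed

text \<open>Along the line on which only the coordinate at \<beta> varies, \<open>p\<close> is a
  polynomial \<open>P\<close> with \<open>z^k * P(z) = f one_r\<close> for
  \<open>z \<noteq> 0\<close>. The identity extends to \<open>z = 0\<close>, where it contradicts
  \<open>f one_r \<noteq> 0\<close>.\<close>

lemma weight_coeff_nonneg: "\<beta> \<in> C \<Longrightarrow> c \<beta> \<ge> 0"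
proof (rule ccontr)
  assume \<beta>: "\<beta> \<in> C" and neg: "\<not> c \<beta> \<ge> 0"
  define k where "k = nat (- c \<beta>)"
  have k: "c \<beta> = - int k" "k > 0" using neg by (auto simp: k_def)
  define s where "s z \<gamma> = (if \<gamma> = \<beta> then z else (1::complex))" for z \<gamma>
  let ?v = "r_elem L (s 0)"
  have line: "r_elem L (s z) = ?v + z \<cdot> E (- \<beta>)" for z
  proof -
    have "r_elem L (s z) = (\<Sum>\<gamma>\<in>C. s 0 \<gamma> \<cdot> E (- \<gamma>) + (if \<gamma> = \<beta> then z \<cdot> E (- \<beta>) else 0))"
      unfolding r_elem_def by (rule sum.cong) (auto simp: s_def)
    then show ?thesis using \<beta> finite_cascade by (simp add: sum.distrib r_elem_def)
  qed
  obtain P where P: "\<forall>z. p (?v + z \<cdot> E (- \<beta>)) = poly P z" using Sym_n_line[OF p(1)] by blast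
  have pz: "p (r_elem L (s z)) = poly P z" for z using P unfolding line[of z] by blast
  have "poly (monom 1 k * P - [:f one_r:]) z = 0" if z: "z \<noteq> 0" for z
  proof -
    have nz: "\<forall>\<gamma>\<in>C. s z \<gamma> \<noteq> 0" using z by (simp add: s_def)
    have "poly P z = f (r_elem L (s z))" using pz p(2) r_elem_orbit[OF nz] by simp
    also have "\<dots> = f one_r * (\<Prod>\<gamma>\<in>C. s z \<gamma> powi c \<gamma>)" by (rule weight_vector_on_torus[OF nz])
    also have "(\<Prod>\<gamma>\<in>C. s z \<gamma> powi c \<gamma>) = (\<Prod>\<gamma>\<in>C. if \<gamma> = \<beta> then z powi c \<beta> else 1)"
      by (rule prod.cong) (auto simp: s_def)
    also have "\<dots> = z powi c \<beta>" using \<beta> finite_cascade by simp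
    also have "\<dots> = inverse (z ^ k)" unfolding k(1) by (simp add: power_int_minus)
    finally show ?thesis using z by (simp add: poly_monom)
  qed
  then have "monom 1 k * P - [:f one_r:] = 0" by (rule poly_zero_off_0)
  then have "poly (monom 1 k * P - [:f one_r:]) 0 = 0" by simp
  then show False using k(2) weight_vector_one_nonzero by (simp add: poly_monom zero_power)
qed

abbreviation (input) "mult_of \<beta> \<equiv> nat (c \<beta>)"
abbreviation (input) "deg_of \<equiv> \<Sum>\<beta>\<in>C. mult_of \<beta>"

lemma weight_vector_monomial:
  assumes "\<forall>\<beta>\<in>C. s \<beta> \<noteq> 0"
  shows "f (r_elem L s) = f one_r * (\<Prod>\<beta>\<in>C. s \<beta> ^ mult_of \<beta>)"
proof -
  have "(\<Prod>\<beta>\<in>C. s \<beta> powi c \<beta>) = (\<Prod>\<beta>\<in>C. s \<beta> ^ mult_of \<beta>)"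
    by (rule prod.cong) (auto simp: power_int_def weight_coeff_nonneg)
  then show ?thesis using weight_vector_on_torus[OF assms] by simp
qed

lemma weight_eq: "\<nu> = (\<lambda>x. \<Sum>\<beta>\<in>C. of_nat (mult_of \<beta>) * \<beta> x)"
  unfolding \<nu> by (intro ext sum.cong) (simp_all add: weight_coeff_nonneg of_nat_nat)

lemma weight_vector_homogeneous:
  assumes "v \<in> orbit_X L" "a \<noteq> 0" shows "f (a \<cdot> v) = a ^ deg_of * f v"
proof -
  obtain u s where u: "u \<in> Ad_N L" "\<forall>\<beta>\<in>C. s \<beta> \<noteq> 0" "v = Coad L u (r_elem L s)" using orbitE[OF assms(1)] by blast
  have as: "\<forall>\<beta>\<in>C. a * s \<beta> \<noteq> 0" using u(2) assms(2) by simp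
  have inv: "f (Coad L u w) = f w" if "w \<in> orbit_X L" for w using f u(1) that by (simp add: inv_weight_vector_def)
  have "f (a \<cdot> v) = f (Coad L u (r_elem L (\<lambda>\<beta>. a * s \<beta>)))" using u by (simp add: Coad_scale flip: r_elem_scale)
  also have "\<dots> = f (r_elem L (\<lambda>\<beta>. a * s \<beta>))" by (rule inv[OF r_elem_orbit[OF as]])
  also have "\<dots> = f one_r * (\<Prod>\<beta>\<in>C. (a * s \<beta>) ^ mult_of \<beta>)" by (rule weight_vector_monomial[OF as])
  also have "\<dots> = a ^ deg_of * (f one_r * (\<Prod>\<beta>\<in>C. s \<beta> ^ mult_of \<beta>))"
    by (simp add: power_mult_distrib prod.distrib power_sum)
  also have "f one_r * (\<Prod>\<beta>\<in>C. s \<beta> ^ mult_of \<beta>) = f (r_elem L s)" by (rule weight_vector_monomial[OF u(2), symmetric])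
  also have "f (r_elem L s) = f v" unfolding u(3) by (rule inv[OF r_elem_orbit[OF u(2)], symmetric])
  finally show ?thesis .
qed

text \<open>The orbit is a cone on which \<open>f\<close> is homogeneous, so that the component of \<open>p\<close> of the
  same degree represents \<open>f\<close> as well.\<close>

lemma homogeneous_representative:
  "\<exists>q\<in>Sym_n L. (\<forall>v\<in>orbit_X L. f v = q v) \<and> homogeneous L deg_of q"
proof -
  obtain N q where q: "\<forall>i. q i \<in> Sym_n L" "\<forall>i a v. q i (a \<cdot> v) = a ^ i * q i v" "\<forall>v. p v = (\<Sum>i\<le>N. q i v)"
    using Sym_n_homogeneous_components[OF p(1)] by blast
  \<comment> \<open>If \<open>deg_of\<close> exceeds \<open>N\<close> there is no such component,
    and the default 0 is right: the comparison of coefficients then yields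
    \<open>f v = 0\<close>.\<close>
  define r where "r v = (if deg_of \<le> N then q deg_of v else 0)" for v
  have "r \<in> Sym_n L" using q(1) Sym_const[of 0 L] unfolding r_def by (cases "deg_of \<le> N") (simp_all cong: if_cong)
  moreover have "homogeneous L deg_of r" using q(2) by (simp add: homogeneous_def r_def)
  moreover have "f v = r v" if v: "v \<in> orbit_X L" for v
  proof -
    let ?A = "(\<Sum>i\<le>N. monom (q i v) i) - monom (f v) deg_of"
    have "poly ?A a = 0" if a: "a \<noteq> 0" for a
    proof -
      have "(\<Sum>i\<le>N. q i v * a ^ i) = p (a \<cdot> v)" using q(2,3) by (simp add: mult.commute)
      also have "\<dots> = f (a \<cdot> v)" using p(2) orbit_scale[OF v a] by simp
      also have "\<dots> = a ^ deg_of * f v" by (rule weight_vector_homogeneous[OF v a])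
      finally show ?thesis by (simp add: poly_sum poly_monom mult.commute)
    qed
    then have "?A = 0" by (rule poly_zero_off_0)
    then have "coeff ?A deg_of = 0" by simp
    then show ?thesis by (simp add: coeff_sum r_def coeff_monom if_distrib split: if_splits cong: if_cong)
  qed
  ultimately show ?thesis by blast
qed

text \<open>It suffices to compare the values at \<open>one_r\<close> and at twice
  \<open>one_r\<close>: \<open>f\<close> is nonzero there and the powers of 2 are distinct.\<close>

lemma homogeneous_degree_unique:
  assumes "\<forall>v\<in>orbit_X L. f v = q v" "homogeneous L k q" shows "k = deg_of"
proof -
  have o: "one_r \<in> orbit_X L" by (rule r_elem_orbit) simp
  have "2 ^ k * f one_r = q (2 \<cdot> one_r)" using assms o r_elem_nil_minus by (simp add: homogeneous_def)
  also have "\<dots> = f (2 \<cdot> one_r)" using assms(1) orbit_scale[OF o, of 2] by simp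
  also have "\<dots> = 2 ^ deg_of * f one_r" by (rule weight_vector_homogeneous[OF o]) simp
  finally have "(2::complex) ^ k = 2 ^ deg_of" using weight_vector_one_nonzero by simp
  then have "norm ((2::complex) ^ k) = norm ((2::complex) ^ deg_of)" by simp
  then have "(2::real) ^ k = 2 ^ deg_of" by (simp add: norm_power)
  then show ?thesis by simp
qed

lemma weight_r_coeff: assumes "\<beta> \<in> C" shows "r_coeff L \<beta> \<nu> = of_nat (mult_of \<beta>)"
proof -
  let ?a = "\<Sum>\<gamma>\<in>C. of_nat (mult_of \<gamma>) \<cdot> t \<gamma>"
  have "represents ?a \<nu>" unfolding represents_def
  proof (intro conjI ballI)
    show "?a \<in> h"
      by (intro subspace_sum[OF h_subspace] subspace_scale[OF h_subspace] t_in_h cascade_roots)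
    fix x assume x: "x \<in> h"
    have "kil (t \<gamma>) x = \<gamma> x" if "\<gamma> \<in> C" for \<gamma>
      using represents_root[OF cascade_roots[OF that]] x by (simp add: represents_def)
    then show "kil ?a x = \<nu> x" unfolding weight_eq by (simp add: kil_simps)
  qed
  then have "ip \<beta> \<nu> = \<nu> (t \<beta>)" using ip_root[OF cascade_roots[OF assms]] by blast
  also have "\<dots> = of_nat (mult_of \<beta>) * ip \<beta> \<beta>" unfolding weight_eq by (rule cascade_sum_eval[OF assms])
  finally show ?thesis using cascade_ip_nonzero[OF assms] by (simp add: r_coeff_def)
qed

end

text \<open>On the torus the summand at \<gamma> vanishes unless \<gamma> is supported on the
  cascade. Such a \<gamma> is determined by \<nu>, since evaluation at \<open>t \<phi>\<close>
  isolates the coefficient of \<phi>.\<close>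

lemma expansion_at_torus:
  assumes norm: "\<forall>\<beta>\<in>C. kil (E \<beta>) (E (- \<beta>)) = 1"
    and \<nu>: "\<nu> = (\<lambda>x. \<Sum>\<beta>\<in>C. of_nat (m \<beta>) * \<beta> x)" and deg: "xi_degree L xi \<nu> = (\<Sum>\<beta>\<in>C. m \<beta>)"
  shows "(\<Sum>\<gamma>\<in>Gamma_nu L xi \<nu>. s \<gamma> * z_mono L \<gamma> (r_elem L z)) = s (gamma_r L xi \<nu>) * (\<Prod>\<beta>\<in>C. z \<beta> ^ m \<beta>)"
proof -
  let ?G = "Gamma_nu L xi \<nu>"
  have sub: "C \<subseteq> pos" using cascade_pos by blast
  define \<gamma>0 where "\<gamma>0 \<phi> = (if \<phi> \<in> C then m \<phi> else 0)" for \<phi>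
  have restrict: "(\<Sum>\<phi>\<in>pos. g \<phi>) = (\<Sum>\<phi>\<in>C. g \<phi>)" if "\<forall>\<phi>\<in>pos - C. g \<phi> = 0" for g :: "'g weight \<Rightarrow> 'x::comm_monoid_add"
    by (rule sum.mono_neutral_right) (use sub finite_pos that in auto)
  have G0: "\<gamma>0 \<in> ?G"
  proof -
    have "(\<Sum>\<phi>\<in>pos. \<gamma>0 \<phi>) = (\<Sum>\<phi>\<in>C. \<gamma>0 \<phi>)" by (rule restrict) (simp add: \<gamma>0_def)
    then have "(\<Sum>\<phi>\<in>pos. \<gamma>0 \<phi>) = xi_degree L xi \<nu>" unfolding deg by (simp add: \<gamma>0_def)
    moreover have "(\<Sum>\<phi>\<in>pos. of_nat (\<gamma>0 \<phi>) * \<phi> x) = (\<Sum>\<phi>\<in>C. of_nat (\<gamma>0 \<phi>) * \<phi> x)" for x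
      by (rule restrict) (simp add: \<gamma>0_def)
    then have "(\<lambda>x. \<Sum>\<phi>\<in>pos. of_nat (\<gamma>0 \<phi>) * \<phi> x) = \<nu>" unfolding \<nu> by (simp add: \<gamma>0_def)
    moreover have "\<gamma>0 \<in> Gamma_all L" using sub by (auto simp: Gamma_all_def \<gamma>0_def)
    ultimately show ?thesis by (simp add: Gamma_nu_def)
  qed
  have unique: "\<gamma> = \<gamma>0" if \<gamma>: "\<gamma> \<in> ?G" "\<forall>\<phi>\<in>pos - C. \<gamma> \<phi> = 0" for \<gamma>
  proof
    fix \<phi>
    show "\<gamma> \<phi> = \<gamma>0 \<phi>"
    proof (cases "\<phi> \<in> C")
      case True
      have "(\<Sum>\<theta>\<in>C. of_nat (\<gamma> \<theta>) * \<theta> (t \<phi>)) = (\<Sum>\<theta>\<in>pos. of_nat (\<gamma> \<theta>) * \<theta> (t \<phi>))"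
        by (rule restrict[symmetric]) (use \<gamma>(2) in simp)
      also have "\<dots> = \<nu> (t \<phi>)" using \<gamma>(1) by (auto simp: Gamma_nu_def dest: fun_cong)
      also have "\<dots> = (\<Sum>\<theta>\<in>C. of_nat (m \<theta>) * \<theta> (t \<phi>))" by (simp add: \<nu>)
      finally have "of_nat (\<gamma> \<phi>) = (of_nat (m \<phi>) :: complex)"
        using cascade_ip_nonzero[OF True] by (simp add: cascade_sum_eval[OF True])
      then show ?thesis using True by (simp add: \<gamma>0_def)
    next
      case False
      then show ?thesis using \<gamma> by (cases "\<phi> \<in> pos") (auto simp: \<gamma>0_def Gamma_nu_def Gamma_all_def)
    qed
  qed
  have gr: "gamma_r L xi \<nu> = \<gamma>0"
    unfolding gamma_r_def
  proof (rule the_equality)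
    show "\<gamma>0 \<in> ?G \<and> (\<forall>\<phi>\<in>pos - C. \<gamma>0 \<phi> = 0)" using G0 by (simp add: \<gamma>0_def)
  qed (use unique in blast)
  \<comment> \<open>Without finiteness the sum over \<open>?G\<close> would be 0 by default; the
    entries of its members are bounded by the degree.\<close>
  have fin: "finite ?G"
  proof (rule finite_subset)
    let ?d = "xi_degree L xi \<nu>"
    show "?G \<subseteq> {\<gamma>. \<forall>\<phi>. (\<phi> \<in> pos \<longrightarrow> \<gamma> \<phi> \<in> {..?d}) \<and> (\<phi> \<notin> pos \<longrightarrow> \<gamma> \<phi> = 0)}"
    proof
      fix \<gamma> assume \<gamma>: "\<gamma> \<in> ?G"
      have "\<gamma> \<phi> \<le> ?d" if "\<phi> \<in> pos" for \<phi>
        using \<gamma> member_le_sum[of \<phi> pos \<gamma>] that finite_pos by (simp add: Gamma_nu_def)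
      then show "\<gamma> \<in> {\<gamma>. \<forall>\<phi>. (\<phi> \<in> pos \<longrightarrow> \<gamma> \<phi> \<in> {..?d}) \<and> (\<phi> \<notin> pos \<longrightarrow> \<gamma> \<phi> = 0)}"
        using \<gamma> by (auto simp: Gamma_nu_def Gamma_all_def)
    qed
    show "finite {\<gamma>. \<forall>\<phi>. (\<phi> \<in> pos \<longrightarrow> \<gamma> \<phi> \<in> {..?d}) \<and> (\<phi> \<notin> pos \<longrightarrow> \<gamma> \<phi> = 0)}"
      by (rule finite_set_of_finite_funs) (use finite_pos in auto)
  qed
  have z: "z_mono L \<gamma> (r_elem L z) = (\<Prod>\<phi>\<in>pos. (if \<phi> \<in> C then z \<phi> else 0) ^ \<gamma> \<phi>)" for \<gamma>
    unfolding z_mono_def by (rule prod.cong) (simp_all add: kil_r_elem[OF norm])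
  have zero: "z_mono L \<gamma> (r_elem L z) = 0" if \<gamma>: "\<gamma> \<in> ?G - {\<gamma>0}" for \<gamma>
  proof -
    obtain \<phi> where "\<phi> \<in> pos - C" "\<gamma> \<phi> \<noteq> 0" using unique[of \<gamma>] \<gamma> by blast
    then show ?thesis unfolding z using finite_pos by (intro prod_zero) auto
  qed
  have "z_mono L \<gamma>0 (r_elem L z) = (\<Prod>\<phi>\<in>C. (if \<phi> \<in> C then z \<phi> else 0) ^ \<gamma>0 \<phi>)"
    unfolding z by (rule prod.mono_neutral_right) (use sub finite_pos in \<open>auto simp: \<gamma>0_def\<close>)
  also have "\<dots> = (\<Prod>\<beta>\<in>C. z \<beta> ^ m \<beta>)" by (rule prod.cong) (simp_all add: \<gamma>0_def)
  finally have z0: "z_mono L \<gamma>0 (r_elem L z) = (\<Prod>\<beta>\<in>C. z \<beta> ^ m \<beta>)" .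
  have "(\<Sum>\<gamma>\<in>?G. s \<gamma> * z_mono L \<gamma> (r_elem L z)) = (\<Sum>\<gamma>\<in>{\<gamma>0}. s \<gamma> * z_mono L \<gamma> (r_elem L z))"
    by (rule sum.mono_neutral_right) (use fin G0 zero in auto)
  then show ?thesis by (simp add: z0 gr)
qed

end

theorem theorem3p11:
  fixes L :: "'g::ab_group_add root_datum"
    and xi :: "'g weight \<Rightarrow> 'g \<Rightarrow> complex"
    and \<nu> :: "'g weight"
  assumes "triangular_datum L"
    and "\<forall>\<beta>\<in>cascade L. killing L (rootvec L \<beta>) (rootvec L (- \<beta>)) = 1"
    and "\<forall>\<mu>\<in>cascade_lattice L. inv_weight_vector L \<mu> (xi \<mu>)"
    and "\<nu> \<in> Lambda_n L xi"
  shows "of_nat (xi_degree L xi \<nu>) = r_total L \<nu> \<and>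
    (\<forall>s :: ('g weight \<Rightarrow> nat) \<Rightarrow> complex.
       (\<forall>v\<in>orbit_X L. xi \<nu> v = (\<Sum>\<gamma>\<in>Gamma_nu L xi \<nu>. s \<gamma> * z_mono L \<gamma> v)) \<longrightarrow>
       s (gamma_r L xi \<nu>) \<noteq> 0 \<and>
       (\<forall>t :: 'g weight \<Rightarrow> complex. (\<forall>\<beta>\<in>cascade L. t \<beta> \<noteq> 0) \<longrightarrow>
          xi \<nu> (r_elem L t) =
            s (gamma_r L xi \<nu>) * (\<Prod>\<beta>\<in>cascade L. t \<beta> powr r_coeff L \<beta> \<nu>)))"
proof -
  interpret triangular L by unfold_locales (rule assms(1))
  obtain c where \<nu>: "\<nu> = (\<lambda>x. \<Sum>\<beta>\<in>cascade L. of_int (c \<beta>) * \<beta> x)"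
    using assms(4) by (auto simp: Lambda_n_def cascade_lattice_def)
  obtain p where p: "p \<in> Sym_n L" "\<forall>v\<in>orbit_X L. xi \<nu> v = p v"
    using assms(4) by (auto simp: Lambda_n_def Sym_n_inv_def)
  have f: "inv_weight_vector L \<nu> (xi \<nu>)" using assms(3,4) by (simp add: Lambda_n_def)
  note facts = \<nu> f p
  let ?m = "\<lambda>\<beta>. nat (c \<beta>)"
  let ?d = "\<Sum>\<beta>\<in>cascade L. ?m \<beta>"
  have deg: "xi_degree L xi \<nu> = ?d"
    unfolding xi_degree_def
  proof (rule the_equality)
    show "\<exists>q\<in>Sym_n L. (\<forall>v\<in>orbit_X L. xi \<nu> v = q v) \<and> homogeneous L ?d q"
      by (rule homogeneous_representative[OF facts])
    fix k assume "\<exists>q\<in>Sym_n L. (\<forall>v\<in>orbit_X L. xi \<nu> v = q v) \<and> homogeneous L k q"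
    then show "k = ?d" using homogeneous_degree_unique[OF facts] by blast
  qed
  have r: "r_coeff L \<beta> \<nu> = of_nat (?m \<beta>)" if "\<beta> \<in> cascade L" for \<beta>
    by (rule weight_r_coeff[OF facts that])
  \<comment> \<open>The numbers \<open>r_coeff\<close> are complex, so the exponents are those of
    \<open>powr\<close>; at a nonzero base a natural exponent gives the ordinary power.\<close>
  have pow: "(\<Prod>\<beta>\<in>cascade L. t \<beta> powr r_coeff L \<beta> \<nu>) = (\<Prod>\<beta>\<in>cascade L. t \<beta> ^ ?m \<beta>)"
    if "\<forall>\<beta>\<in>cascade L. t \<beta> \<noteq> 0" for t
    by (rule prod.cong) (use that in \<open>auto simp: r powr_nat\<close>)
  have exp: "(\<Sum>\<gamma>\<in>Gamma_nu L xi \<nu>. s \<gamma> * z_mono L \<gamma> (r_elem L t)) =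
      s (gamma_r L xi \<nu>) * (\<Prod>\<beta>\<in>cascade L. t \<beta> ^ ?m \<beta>)" for s t
    by (rule expansion_at_torus[OF assms(2) weight_eq[OF facts] deg])
  show ?thesis
  proof (intro conjI allI impI)
    show "of_nat (xi_degree L xi \<nu>) = r_total L \<nu>" by (simp add: r_total_def deg r)
    fix s :: "('g weight \<Rightarrow> nat) \<Rightarrow> complex"
    assume s: "\<forall>v\<in>orbit_X L. xi \<nu> v = (\<Sum>\<gamma>\<in>Gamma_nu L xi \<nu>. s \<gamma> * z_mono L \<gamma> v)"
    have val: "xi \<nu> (r_elem L t) = s (gamma_r L xi \<nu>) * (\<Prod>\<beta>\<in>cascade L. t \<beta> ^ ?m \<beta>)"
      if "\<forall>\<beta>\<in>cascade L. t \<beta> \<noteq> 0" for t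
      using s r_elem_orbit[OF that] exp by simp
    \<comment> \<open>At the point with all coordinates 1 the value is the coefficient
      itself.\<close>
    show "s (gamma_r L xi \<nu>) \<noteq> 0"
      using val[of "\<lambda>_. 1"] weight_vector_one_nonzero[OF facts] by auto
    fix t :: "'g weight \<Rightarrow> complex" assume "\<forall>\<beta>\<in>cascade L. t \<beta> \<noteq> 0"
    then show "xi \<nu> (r_elem L t) = s (gamma_r L xi \<nu>) * (\<Prod>\<beta>\<in>cascade L. t \<beta> powr r_coeff L \<beta> \<nu>)"
      using val pow by simp
  qed
qed

end
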